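(* Let $p\neq2$ be a prime. For all integers $n,\ell\geq1$ we have, in $\mathbb{Q}_p$, $$\frac{(-1)^{\ell-1}}{\ell}\cdot S_\ell(np)=-\sum_{m\geq\ell/2}\binom{1+2m}{\ell}(np)^{1+2m-\ell}\cdot\frac{L_p(1+2m,\overline{\omega}_p^{2m})}{1+2m}.$$ Moreover for $\ell=1$ we have $S_1(np)=g_0(np)-g_0(0)$. In particular, for $n=p^{k-1}$, one has $\lim_{k\to\infty}p^{-k}\sum_{0\le i\le p^k-1,\,(i,p)=1}i^{-1}=0$ (because $g_0'(0)=0$).
   Context: For integers $\ell,k\ge1$, $S_\ell(k)=\sum_{1\le i\le k-1,\ (i,p)=1}\frac1{i^\ell}$. $\overline\omega_p$ is the inverse of the Teichmüller character $\omega_p$ mod $p$, and $L_p(s,\chi)$ is the Kubota–Leopoldt $p$-adic $L$-function of the Dirichlet character $\chi$ (standard normalization: $L_p(1-k,\chi)=-(1-\chi\omega_p^{-k}(p)p^{k-1})B_{k,\chi\omega_p^{-k}}/k$ for integers $k\ge1$). The index $m$ runs over integers. $\Gamma_p:\mathbb{Z}_p\to\mathbb{Z}_p$ is Morita's $p$-adic Gamma function, i.e. the continuous function with $\Gamma_p(0)=1$, $\Gamma_p(x+1)=-x\Gamma_p(x)$ if $|x|=1$ and $=-\Gamma_p(x)$ if $|x|<1$; $\Gamma_p^0(T)\in\mathbb{Q}_p[[T]]$ is its Taylor expansion at $0$, and $g_0(T)=\frac{d}{dT}\log\Gamma_p^0(T)=\Gamma_p^{0}{}'(T)/\Gamma_p^0(T)$,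 a power series converging on the open unit disc, with $g_0(T)=\lambda_0-\sum_{m\ge1}L_p(1+2m,\overline\omega_p^{2m})T^{2m}$ where $\lambda_0$ is the constant coefficient in the expansion $\zeta_p(s)=\sum_{n\ge-1}\lambda_n(s-1)^n$ of the $p$-adic zeta function at $s=1$. *)

theory Defs
  imports
    "HOL-Analysis.Analysis"
    "HOL-Computational_Algebra.Computational_Algebra"
    "Berlekamp_Zassenhaus.Finite_Field"
begin

section \<open>The \<open>p\<close>-adic absolute value on the rationals\<close>

definition padic_abs :: "nat \<Rightarrow> rat \<Rightarrow> real" where
  "padic_abs p q = (if q = 0 then 0 else
     real p powi (int (multiplicity (int p) (snd (quotient_of q)))
                - int (multiplicity (int p) (fst (quotient_of q)))))"

lemma padic_abs_0 [simp]: "padic_abs p 0 = 0"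
  by (simp add: padic_abs_def)

lemma padic_abs_divide:
  assumes p: "prime p" and a: "a \<noteq> 0" and b: "b \<noteq> 0"
  shows "padic_abs p (of_int a / of_int b) =
           real p powi (int (multiplicity (int p) b) - int (multiplicity (int p) a))"
proof -
  define q :: rat where "q = of_int a / of_int b"
  obtain c d where cd: "quotient_of q = (c, d)" by fastforce
  have d0: "d > 0" by (rule quotient_of_denom_pos[OF cd])
  have q: "q = of_int c / of_int d" by (rule quotient_of_div[OF cd])
  have q0: "q \<noteq> 0" using a b by (simp add: q_def)
  have c0: "c \<noteq> 0" using q q0 by auto
  have "of_int (c * b) = (of_int (a * d) :: rat)"
    using q d0 b by (simp add: q_def field_simps)
  hence eq: "c * b = a * d" by (simp only: of_int_eq_iff)
  have P: "prime_elem (int p)" using p by simp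
  have "multiplicity (int p) c + multiplicity (int p) b =
        multiplicity (int p) a + multiplicity (int p) d"
    using prime_elem_multiplicity_mult_distrib[OF P c0 b]
      prime_elem_multiplicity_mult_distrib[OF P a, of d] d0 eq by simp
  hence "int (multiplicity (int p) d) - int (multiplicity (int p) c) =
         int (multiplicity (int p) b) - int (multiplicity (int p) a)" by linarith
  thus ?thesis using q0 cd unfolding q_def[symmetric] padic_abs_def by simp
qed

lemma rat_as_fraction:
  obtains a b :: int where "(q :: rat) = of_int a / of_int b" "b \<noteq> 0"
  by (metis quotient_of_div quotient_of_denom_pos less_irrefl surj_pair)

lemma padic_abs_nonneg [simp]: "padic_abs p q \<ge> 0"
  by (simp add: padic_abs_def)

lemma padic_abs_pos: "prime p \<Longrightarrow> q \<noteq> 0 \<Longrightarrow> padic_abs p q > 0"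
  by (simp add: padic_abs_def prime_gt_0_nat)

lemma padic_abs_eq_0_iff: "prime p \<Longrightarrow> padic_abs p q = 0 \<longleftrightarrow> q = 0"
  using padic_abs_pos[of p q] by fastforce

lemma padic_abs_1 [simp]: "padic_abs p 1 = 1"
  by (simp add: padic_abs_def)

lemma padic_abs_mult:
  assumes p: "prime p"
  shows "padic_abs p (x * y) = padic_abs p x * padic_abs p y"
proof (cases "x = 0 \<or> y = 0")
  case True
  thus ?thesis by auto
next
  case False
  obtain a b where x: "x = of_int a / of_int b" "b \<noteq> 0" by (rule rat_as_fraction)
  obtain c d where y: "y = of_int c / of_int d" "d \<noteq> 0" by (rule rat_as_fraction)
  have a: "a \<noteq> 0" "c \<noteq> 0" using False x y by auto
  have P: "prime_elem (int p)" using p by simp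
  have "x * y = of_int (a * c) / of_int (b * d)" using x y by simp
  hence "padic_abs p (x * y) = real p powi
      (int (multiplicity (int p) (b * d)) - int (multiplicity (int p) (a * c)))"
    using padic_abs_divide[OF p, of "a * c" "b * d"] a x y by simp
  also have "\<dots> = real p powi
      ((int (multiplicity (int p) b) - int (multiplicity (int p) a)) +
       (int (multiplicity (int p) d) - int (multiplicity (int p) c)))"
    using a x y by (simp add: prime_elem_multiplicity_mult_distrib[OF P] algebra_simps)
  also have "\<dots> = padic_abs p x * padic_abs p y"
    using a x y padic_abs_divide[OF p] prime_gt_0_nat[OF p] by (simp add: power_int_add)
  finally show ?thesis .
qed

lemma padic_abs_minus [simp]: "padic_abs p (- x) = padic_abs p x"
  by (simp add: padic_abs_def rat_uminus_code case_prod_unfold Let_def)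

lemma padic_abs_minus_commute: "padic_abs p (x - y) = padic_abs p (y - x)"
  by (metis minus_diff_eq padic_abs_minus)

lemma padic_abs_inverse: "prime p \<Longrightarrow> padic_abs p (inverse x) = inverse (padic_abs p x)"
  using padic_abs_mult[of p x "inverse x"] padic_abs_eq_0_iff[of p x]
  by (cases "x = 0") (auto simp: field_simps)

lemma padic_abs_add:
  assumes p: "prime p"
  shows "padic_abs p (x + y) \<le> max (padic_abs p x) (padic_abs p y)"
proof (cases "x = 0 \<or> y = 0 \<or> x + y = 0")
  case True
  thus ?thesis by (auto simp: le_max_iff_disj)
next
  case False
  obtain a b where x: "x = of_int a / of_int b" "b \<noteq> 0" by (rule rat_as_fraction)
  obtain c d where y: "y = of_int c / of_int d" "d \<noteq> 0" by (rule rat_as_fraction)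
  define u v w where "u = a * d" and "v = c * b" and "w = b * d"
  have x': "x = of_int u / of_int w" and y': "y = of_int v / of_int w"
    and w: "w \<noteq> 0" using x y by (auto simp: u_def v_def w_def)
  have xy: "x + y = of_int (u + v) / of_int w" using x' y' by (simp add: add_divide_distrib)
  have nz: "u \<noteq> 0" "v \<noteq> 0" "u + v \<noteq> 0" using False x' y' xy by auto
  define k where "k = min (multiplicity (int p) u) (multiplicity (int p) v)"
  have "int p ^ k dvd u + v"
    by (intro dvd_add multiplicity_dvd') (auto simp: k_def)
  hence k: "k \<le> multiplicity (int p) (u + v)"
    using nz p by (intro multiplicity_geI) (auto simp: prime_gt_1_nat not_is_unit_0 prime_gt_0_nat)
  have p1: "real p \<ge> 1" using prime_gt_0_nat[OF p] by simp
  have "padic_abs p (x + y) \<le> real p powi (int (multiplicity (int p) w) - int k)"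
    unfolding xy using padic_abs_divide[OF p nz(3) w] k p1 by (simp add: power_int_increasing)
  also have "\<dots> \<le> max (padic_abs p x) (padic_abs p y)"
    unfolding x' y' using padic_abs_divide[OF p nz(1) w] padic_abs_divide[OF p nz(2) w]
    by (auto simp: k_def min_def le_max_iff_disj)
  finally show ?thesis .
qed

lemma padic_abs_triangle: "prime p \<Longrightarrow> padic_abs p (x + y) \<le> padic_abs p x + padic_abs p y"
  using padic_abs_add[of p x y] padic_abs_nonneg[of p x] padic_abs_nonneg[of p y] by linarith

lemma padic_abs_diff_triangle:
  "prime p \<Longrightarrow> \<bar>padic_abs p x - padic_abs p y\<bar> \<le> padic_abs p (x - y)"
  using padic_abs_triangle[of p "x - y" y] padic_abs_triangle[of p "y - x" x]
    padic_abs_minus_commute[of p x y] by auto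

section \<open>The field of \<open>p\<close>-adic numbers\<close>

definition padic_cauchy :: "nat \<Rightarrow> (nat \<Rightarrow> rat) \<Rightarrow> bool" where
  "padic_cauchy p X \<longleftrightarrow> (\<forall>e>0. \<exists>N. \<forall>m\<ge>N. \<forall>n\<ge>N. padic_abs p (X m - X n) < e)"

definition padic_null :: "nat \<Rightarrow> (nat \<Rightarrow> rat) \<Rightarrow> bool" where
  "padic_null p X \<longleftrightarrow> (\<lambda>n. padic_abs p (X n)) \<longlonglongrightarrow> 0"

lemma padic_null_bound:
  assumes "padic_null p Y" "\<And>n. padic_abs p (X n) \<le> C * padic_abs p (Y n)"
  shows "padic_null p X"
  unfolding padic_null_def
proof (rule tendsto_sandwich[OF _ _ tendsto_const])
  show "(\<lambda>n. C * padic_abs p (Y n)) \<longlonglongrightarrow> 0"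
    using tendsto_mult_right_zero[OF assms(1)[unfolded padic_null_def], of C] by simp
qed (use assms(2) in auto)

lemma padic_null_add:
  assumes "prime p" "padic_null p X" "padic_null p Y"
  shows "padic_null p (\<lambda>n. X n + Y n)"
  unfolding padic_null_def
proof (rule tendsto_sandwich[OF _ _ tendsto_const])
  show "(\<lambda>n. padic_abs p (X n) + padic_abs p (Y n)) \<longlonglongrightarrow> 0"
    using tendsto_add[OF assms(2,3)[unfolded padic_null_def]] by simp
qed (use padic_abs_triangle[OF assms(1)] in auto)

lemma padic_null_minus: "padic_null p X \<Longrightarrow> padic_null p (\<lambda>n. - X n)"
  by (simp add: padic_null_def)

lemma padic_null_diff:
  "prime p \<Longrightarrow> padic_null p X \<Longrightarrow> padic_null p Y \<Longrightarrow> padic_null p (\<lambda>n. X n - Y n)"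
  using padic_null_add[of p X "\<lambda>n. - Y n"] padic_null_minus[of p Y] by simp

lemma padic_null_0 [simp]: "padic_null p (\<lambda>n. 0)"
  by (simp add: padic_null_def)

lemma padic_null_const_iff: "prime p \<Longrightarrow> padic_null p (\<lambda>n. q) \<longleftrightarrow> q = 0"
  by (simp add: padic_null_def tendsto_const_iff padic_abs_eq_0_iff)

lemma padic_cauchy_const [simp]: "padic_cauchy p (\<lambda>n. q)"
  by (simp add: padic_cauchy_def)

lemma padic_cauchy_abs_Cauchy:
  assumes "prime p" "padic_cauchy p X"
  shows "Cauchy (\<lambda>n. padic_abs p (X n))"
  unfolding Cauchy_def dist_real_def
  using assms(2) padic_abs_diff_triangle[OF assms(1)] unfolding padic_cauchy_def
  by (meson le_less_trans)

lemma padic_cauchy_convergent: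
  "prime p \<Longrightarrow> padic_cauchy p X \<Longrightarrow> convergent (\<lambda>n. padic_abs p (X n))"
  using padic_cauchy_abs_Cauchy real_Cauchy_convergent by blast

lemma padic_cauchy_bounded:
  assumes "prime p" "padic_cauchy p X"
  obtains C where "C > 0" "\<And>n. padic_abs p (X n) \<le> C"
proof -
  have "Bseq (\<lambda>n. padic_abs p (X n))"
    using padic_cauchy_abs_Cauchy[OF assms] by (rule Cauchy_Bseq)
  then obtain C where "C > 0" "\<And>n. norm (padic_abs p (X n)) \<le> C"
    by (auto simp: Bseq_def)
  thus ?thesis using that by auto
qed

lemma padic_cauchy_add:
  assumes p: "prime p" and X: "padic_cauchy p X" and Y: "padic_cauchy p Y"
  shows "padic_cauchy p (\<lambda>n. X n + Y n)"
  unfolding padic_cauchy_def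
proof (intro allI impI)
  fix e :: real assume e: "e > 0"
  obtain M where M: "\<forall>m\<ge>M. \<forall>n\<ge>M. padic_abs p (X m - X n) < e"
    using X e unfolding padic_cauchy_def by blast
  obtain N where N: "\<forall>m\<ge>N. \<forall>n\<ge>N. padic_abs p (Y m - Y n) < e"
    using Y e unfolding padic_cauchy_def by blast
  have "padic_abs p (X m + Y m - (X n + Y n)) < e" if "m \<ge> max M N" "n \<ge> max M N" for m n
  proof -
    have "padic_abs p (X m + Y m - (X n + Y n)) = padic_abs p ((X m - X n) + (Y m - Y n))"
      by (simp add: algebra_simps)
    also have "\<dots> \<le> max (padic_abs p (X m - X n)) (padic_abs p (Y m - Y n))"
      by (rule padic_abs_add[OF p])
    also have "\<dots> < e" using M N that by simp
    finally show ?thesis .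
  qed
  thus "\<exists>K. \<forall>m\<ge>K. \<forall>n\<ge>K. padic_abs p (X m + Y m - (X n + Y n)) < e" by blast
qed

lemma padic_cauchy_minus: "padic_cauchy p X \<Longrightarrow> padic_cauchy p (\<lambda>n. - X n)"
  unfolding padic_cauchy_def by (metis minus_diff_minus padic_abs_minus)

lemma padic_cauchy_diff:
  "prime p \<Longrightarrow> padic_cauchy p X \<Longrightarrow> padic_cauchy p Y \<Longrightarrow> padic_cauchy p (\<lambda>n. X n - Y n)"
  using padic_cauchy_add[of p X "\<lambda>n. - Y n"] padic_cauchy_minus[of p Y] by simp

lemma padic_cauchy_mult:
  assumes p: "prime p" and X: "padic_cauchy p X" and Y: "padic_cauchy p Y"
  shows "padic_cauchy p (\<lambda>n. X n * Y n)"
  unfolding padic_cauchy_def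
proof (intro allI impI)
  fix e :: real assume e: "e > 0"
  obtain C where C: "C > 0" "\<And>n. padic_abs p (X n) \<le> C"
    using padic_cauchy_bounded[OF p X] by blast
  obtain D where D: "D > 0" "\<And>n. padic_abs p (Y n) \<le> D"
    using padic_cauchy_bounded[OF p Y] by blast
  obtain M where M: "\<forall>m\<ge>M. \<forall>n\<ge>M. padic_abs p (X m - X n) < e / D"
    using X e D unfolding padic_cauchy_def by (meson divide_pos_pos)
  obtain N where N: "\<forall>m\<ge>N. \<forall>n\<ge>N. padic_abs p (Y m - Y n) < e / C"
    using Y e C unfolding padic_cauchy_def by (meson divide_pos_pos)
  have "padic_abs p (X m * Y m - X n * Y n) < e" if mn: "m \<ge> max M N" "n \<ge> max M N" for m n
  proof -
    have "padic_abs p (X m * Y m - X n * Y n) =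
          padic_abs p (X m * (Y m - Y n) + (X m - X n) * Y n)"
      by (simp add: algebra_simps)
    also have "\<dots> \<le> max (padic_abs p (X m) * padic_abs p (Y m - Y n))
                          (padic_abs p (X m - X n) * padic_abs p (Y n))"
      using padic_abs_add[OF p] by (simp add: padic_abs_mult[OF p, symmetric])
    also have "\<dots> < e"
    proof -
      have "padic_abs p (X m) * padic_abs p (Y m - Y n) \<le> C * padic_abs p (Y m - Y n)"
        by (intro mult_right_mono C) simp
      also have "\<dots> < C * (e / C)" using N mn C by (intro mult_strict_left_mono) auto
      finally have 1: "padic_abs p (X m) * padic_abs p (Y m - Y n) < e" using C by simp
      have "padic_abs p (X m - X n) * padic_abs p (Y n) \<le> padic_abs p (X m - X n) * D"
        by (intro mult_left_mono D) simp
      also have "\<dots> < (e / D) * D" using M mn D by (intro mult_strict_right_mono) auto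
      finally have "padic_abs p (X m - X n) * padic_abs p (Y n) < e" using D by simp
      thus ?thesis using 1 by simp
    qed
    finally show ?thesis .
  qed
  thus "\<exists>K. \<forall>m\<ge>K. \<forall>n\<ge>K. padic_abs p (X m * Y m - X n * Y n) < e" by blast
qed

lemma padic_null_mult_bounded:
  assumes p: "prime p" and X: "padic_cauchy p X" and Y: "padic_null p Y"
  shows "padic_null p (\<lambda>n. X n * Y n)"
proof -
  obtain C where C: "C > 0" "\<And>n. padic_abs p (X n) \<le> C"
    using padic_cauchy_bounded[OF p X] by blast
  show ?thesis
    by (rule padic_null_bound[OF Y, of _ C])
       (simp add: padic_abs_mult[OF p] mult_right_mono C)
qed

lemma padic_cauchy_not_null:
  assumes p: "prime p" and X: "padic_cauchy p X" and n: "\<not> padic_null p X"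
  obtains b N where "b > 0" "\<And>n. n \<ge> N \<Longrightarrow> padic_abs p (X n) > b"
proof -
  obtain L where L: "(\<lambda>n. padic_abs p (X n)) \<longlonglongrightarrow> L"
    using padic_cauchy_convergent[OF p X] by (auto simp: convergent_def)
  have "L \<ge> 0" by (rule LIMSEQ_le_const[OF L]) auto
  moreover have "L \<noteq> 0" using L n by (auto simp: padic_null_def)
  ultimately have "L > 0" by simp
  hence "eventually (\<lambda>n. padic_abs p (X n) > L / 2) sequentially"
    by (intro order_tendstoD(1)[OF L]) simp
  thus ?thesis using that[of "L/2"] \<open>L > 0\<close> by (auto simp: eventually_sequentially)
qed

lemma padic_cauchy_inverse:
  assumes p: "prime p" and X: "padic_cauchy p X" and n: "\<not> padic_null p X"
  shows "padic_cauchy p (\<lambda>n. inverse (X n))"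
  unfolding padic_cauchy_def
proof (intro allI impI)
  fix e :: real assume e: "e > 0"
  obtain b M where b: "b > 0" "\<And>n. n \<ge> M \<Longrightarrow> padic_abs p (X n) > b"
    using padic_cauchy_not_null[OF assms] by blast
  obtain N where N: "\<forall>m\<ge>N. \<forall>n\<ge>N. padic_abs p (X m - X n) < e * (b * b)"
    using X e b unfolding padic_cauchy_def by (meson mult_pos_pos)
  have "padic_abs p (inverse (X m) - inverse (X n)) < e" if "m \<ge> max M N" "n \<ge> max M N" for m n
  proof -
    have bm: "padic_abs p (X m) > b" "padic_abs p (X n) > b" using that b by auto
    hence nz: "X m \<noteq> 0" "X n \<noteq> 0" using b(1) by auto
    have "inverse (X m) - inverse (X n) = (X n - X m) * inverse (X m * X n)"
      using nz by (simp add: field_simps)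
    hence "padic_abs p (inverse (X m) - inverse (X n)) =
           padic_abs p (X n - X m) / (padic_abs p (X m) * padic_abs p (X n))"
      by (simp only: padic_abs_mult[OF p] padic_abs_inverse[OF p] divide_inverse)
    also have "\<dots> \<le> padic_abs p (X n - X m) / (b * b)"
      using bm b by (intro divide_left_mono mult_mono mult_pos_pos) auto
    also have "\<dots> < e" using N that b by (simp add: field_simps)
    finally show ?thesis .
  qed
  thus "\<exists>K. \<forall>m\<ge>K. \<forall>n\<ge>K. padic_abs p (inverse (X m) - inverse (X n)) < e" by blast
qed

lemma padic_null_inverse_mult:
  assumes p: "prime p" and X: "padic_cauchy p X" and n: "\<not> padic_null p X"
  shows "padic_null p (\<lambda>n. inverse (X n) * X n - 1)"
proof -
  obtain b M where b: "b > 0" "\<And>n. n \<ge> M \<Longrightarrow> padic_abs p (X n) > b"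
    using padic_cauchy_not_null[OF assms] by blast
  have "inverse (X n) * X n - 1 = 0" if "n \<ge> M" for n
    using b(1) b(2)[OF that] by (cases "X n = 0") auto
  hence "eventually (\<lambda>n. padic_abs p (inverse (X n) * X n - 1) = 0) sequentially"
    unfolding eventually_sequentially by (metis padic_abs_0)
  thus ?thesis unfolding padic_null_def by (rule tendsto_eventually)
qed

definition padic_rel :: "'p::prime_card itself \<Rightarrow> (nat \<Rightarrow> rat) \<Rightarrow> (nat \<Rightarrow> rat) \<Rightarrow> bool" where
  "padic_rel _ X Y \<longleftrightarrow> padic_cauchy CARD('p) X \<and> padic_cauchy CARD('p) Y \<and>
     padic_null CARD('p) (\<lambda>n. X n - Y n)"

lemma part_equivp_padic_rel: "part_equivp (padic_rel TYPE('p::prime_card))"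
proof (rule part_equivpI)
  show "\<exists>X. padic_rel TYPE('p) X X"
    by (rule exI[of _ "\<lambda>_. 0"]) (simp add: padic_rel_def)
  show "symp (padic_rel TYPE('p))"
    by (auto simp: symp_def padic_rel_def padic_null_def padic_abs_minus_commute)
  show "transp (padic_rel TYPE('p))"
  proof (rule transpI)
    fix X Y Z assume "padic_rel TYPE('p) X Y" "padic_rel TYPE('p) Y Z"
    thus "padic_rel TYPE('p) X Z"
      using padic_null_add[OF prime_card[where 'a='p], of "\<lambda>n. X n - Y n" "\<lambda>n. Y n - Z n"]
      by (simp add: padic_rel_def)
  qed
qed

text \<open>
  The completion of the rationals for the absolute value above. The prime is the cardinality
  of the index type, so a statement about \<open>'p padic\<close> for a free type variable \<open>'p\<close> of class
  \<^class>\<open>prime_card\<close> is a statement about all primes.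
\<close>

typedef (overloaded) ('p :: prime_card) padic =
  "{{Y. padic_rel TYPE('p) X Y} | X. padic_cauchy CARD('p) X}"
  by (auto intro: exI[of _ "\<lambda>_. 0"])

definition Padic :: "(nat \<Rightarrow> rat) \<Rightarrow> 'p::prime_card padic" where
  "Padic X = Abs_padic {Y. padic_rel TYPE('p) X Y}"

definition padic_seq :: "'p::prime_card padic \<Rightarrow> nat \<Rightarrow> rat" where
  "padic_seq x = (SOME X. X \<in> Rep_padic x)"

lemma padic_rel_refl: "padic_cauchy CARD('p) X \<Longrightarrow> padic_rel TYPE('p::prime_card) X X"
  by (simp add: padic_rel_def)

lemma eq_Padic:
  assumes "padic_cauchy CARD('p) X" "padic_cauchy CARD('p) Y"
  shows "(Padic X :: 'p::prime_card padic) = Padic Y \<longleftrightarrow> padic_null CARD('p) (\<lambda>n. X n - Y n)"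
proof -
  have "(Padic X :: 'p padic) = Padic Y \<longleftrightarrow>
        {Z. padic_rel TYPE('p) X Z} = {Z. padic_rel TYPE('p) Y Z}"
    unfolding Padic_def by (rule Abs_padic_inject) (use assms in auto)
  also have "\<dots> \<longleftrightarrow> padic_rel TYPE('p) X Y"
  proof
    assume "{Z. padic_rel TYPE('p) X Z} = {Z. padic_rel TYPE('p) Y Z}"
    thus "padic_rel TYPE('p) X Y" using padic_rel_refl[OF assms(2)] by auto
  next
    assume "padic_rel TYPE('p) X Y"
    thus "{Z. padic_rel TYPE('p) X Z} = {Z. padic_rel TYPE('p) Y Z}"
      using part_equivp_padic_rel[where 'p='p]
      by (metis (no_types, lifting) Collect_cong part_equivp_symp part_equivp_transp)
  qed
  also have "\<dots> \<longleftrightarrow> padic_null CARD('p) (\<lambda>n. X n - Y n)"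
    using assms by (simp add: padic_rel_def)
  finally show ?thesis .
qed

lemma padic_seq_props:
  fixes x :: "'p::prime_card padic"
  shows "padic_cauchy CARD('p) (padic_seq x)" and Padic_padic_seq [simp]: "Padic (padic_seq x) = x"
proof -
  obtain X where X: "padic_cauchy CARD('p) X" "Rep_padic x = {Y. padic_rel TYPE('p) X Y}"
    using Rep_padic[of x] by auto
  have "X \<in> Rep_padic x" using X padic_rel_refl by auto
  hence "padic_seq x \<in> Rep_padic x" unfolding padic_seq_def by (rule someI[of "\<lambda>X. X \<in> Rep_padic x"])
  hence *: "padic_rel TYPE('p) X (padic_seq x)" using X by simp
  thus c: "padic_cauchy CARD('p) (padic_seq x)" by (simp add: padic_rel_def)
  have "x = Padic X" unfolding Padic_def X(2)[symmetric] by (simp add: Rep_padic_inverse)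
  also have "\<dots> = Padic (padic_seq x)" using * X c by (simp add: eq_Padic padic_rel_def)
  finally show "Padic (padic_seq x) = x" by simp
qed

lemma padic_seq_Padic:
  assumes "padic_cauchy CARD('p) X"
  shows "padic_null CARD('p) (\<lambda>n. padic_seq (Padic X :: 'p::prime_card padic) n - X n)"
  using eq_Padic[OF padic_seq_props(1)[of "Padic X :: 'p padic"] assms] by simp

lemma Padic_cases [cases type: padic]:
  obtains X where "(x :: 'p::prime_card padic) = Padic X" "padic_cauchy CARD('p) X"
  using padic_seq_props[of x] by metis

instantiation padic :: (prime_card) field
begin

definition "0 = Padic (\<lambda>n. 0)"
definition "1 = Padic (\<lambda>n. 1)"
definition "x + y = Padic (\<lambda>n. padic_seq x n + padic_seq y n)"
definition "- x = Padic (\<lambda>n. - padic_seq x n)"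
definition "x * y = Padic (\<lambda>n. padic_seq x n * padic_seq y n)"
definition "inverse x = (if x = 0 then 0 else Padic (\<lambda>n. inverse (padic_seq x n)))"
definition "x - y = x + - y" for x y :: "'a padic"
definition "x div y = x * inverse y" for x y :: "'a padic"

lemma add_Padic:
  assumes X: "padic_cauchy CARD('a) X" and Y: "padic_cauchy CARD('a) Y"
  shows "Padic X + Padic Y = (Padic (\<lambda>n. X n + Y n) :: 'a padic)"
proof -
  note p = prime_card[where 'a='a]
  have "padic_null CARD('a) (\<lambda>n. (padic_seq (Padic X :: 'a padic) n - X n) +
          (padic_seq (Padic Y :: 'a padic) n - Y n))"
    by (intro padic_null_add p padic_seq_Padic X Y)
  thus ?thesis unfolding plus_padic_def
    by (subst eq_Padic) (auto intro!: padic_cauchy_add p padic_seq_props X Y simp: algebra_simps)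
qed

lemma minus_Padic:
  assumes X: "padic_cauchy CARD('a) X"
  shows "- Padic X = (Padic (\<lambda>n. - X n) :: 'a padic)"
  using padic_null_minus[OF padic_seq_Padic[OF X]] unfolding uminus_padic_def
  by (subst eq_Padic) (auto intro!: padic_cauchy_minus padic_seq_props X simp: algebra_simps)

lemma diff_Padic:
  assumes X: "padic_cauchy CARD('a) X" and Y: "padic_cauchy CARD('a) Y"
  shows "Padic X - Padic Y = (Padic (\<lambda>n. X n - Y n) :: 'a padic)"
  using assms by (simp add: minus_padic_def minus_Padic add_Padic padic_cauchy_minus)

lemma mult_Padic:
  assumes X: "padic_cauchy CARD('a) X" and Y: "padic_cauchy CARD('a) Y"
  shows "Padic X * Padic Y = (Padic (\<lambda>n. X n * Y n) :: 'a padic)"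
proof -
  note p = prime_card[where 'a='a]
  let ?x = "padic_seq (Padic X :: 'a padic)" and ?y = "padic_seq (Padic Y :: 'a padic)"
  have "padic_null CARD('a) (\<lambda>n. ?x n * (?y n - Y n) + Y n * (?x n - X n))"
    by (intro padic_null_add p padic_null_mult_bounded padic_seq_props padic_seq_Padic X Y)
  thus ?thesis unfolding times_padic_def
    by (subst eq_Padic) (auto intro!: padic_cauchy_mult p padic_seq_props X Y simp: algebra_simps)
qed

lemma Padic_eq_0_iff:
  "padic_cauchy CARD('a) X \<Longrightarrow> (Padic X :: 'a padic) = 0 \<longleftrightarrow> padic_null CARD('a) X"
  unfolding zero_padic_def by (subst eq_Padic) auto

instance
proof
  note p = prime_card[where 'a='a]
  note ops = add_Padic minus_Padic diff_Padic mult_Padic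
    padic_cauchy_add[OF p] padic_cauchy_minus padic_cauchy_mult[OF p]
  fix a b c :: "'a padic"
  obtain A where A: "a = Padic A" "padic_cauchy CARD('a) A" by (cases a)
  obtain B where B: "b = Padic B" "padic_cauchy CARD('a) B" by (cases b)
  obtain C where C: "c = Padic C" "padic_cauchy CARD('a) C" by (cases c)
  show "a + b = b + a" "(a + b) + c = a + (b + c)" "(a * b) * c = a * (b * c)" "a * b = b * a"
    using A B C by (simp_all add: ops ac_simps)
  show "(a + b) * c = a * c + b * c"
    using A B C by (simp add: ops distrib_right)
  show "0 + a = a" "1 * a = a" "- a + a = 0"
    using A by (simp_all add: ops zero_padic_def one_padic_def)
  show "a - b = a + - b" "a div b = a * inverse b" "inverse (0 :: 'a padic) = 0"
    by (simp_all add: minus_padic_def divide_padic_def inverse_padic_def)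
  show "(0 :: 'a padic) \<noteq> 1"
    unfolding zero_padic_def one_padic_def by (simp add: eq_Padic padic_null_const_iff[OF p])
  assume a: "a \<noteq> 0"
  let ?A = "padic_seq a"
  have cA: "padic_cauchy CARD('a) ?A" by (rule padic_seq_props)
  have nA: "\<not> padic_null CARD('a) ?A" using a Padic_eq_0_iff[OF cA] by simp
  have "inverse a * a = Padic (\<lambda>n. inverse (?A n)) * Padic ?A"
    using a by (simp add: inverse_padic_def)
  also have "\<dots> = Padic (\<lambda>n. inverse (?A n) * ?A n)"
    by (rule mult_Padic) (intro padic_cauchy_inverse p cA nA)+
  also have "\<dots> = 1" unfolding one_padic_def
    by (subst eq_Padic)
       (auto intro!: padic_cauchy_mult padic_cauchy_inverse padic_null_inverse_mult p cA nA)
  finally show "inverse a * a = 1" .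
qed

end

lemma of_nat_Padic: "of_nat k = (Padic (\<lambda>n. of_nat k) :: 'p::prime_card padic)"
  by (induct k) (simp_all add: zero_padic_def one_padic_def add_Padic)

instance padic :: (prime_card) field_char_0
proof
  show "inj (of_nat :: nat \<Rightarrow> 'a padic)"
    by (rule injI) (simp add: of_nat_Padic eq_Padic padic_null_const_iff[OF prime_card])
qed

lemma of_int_Padic: "of_int k = (Padic (\<lambda>n. of_int k) :: 'p::prime_card padic)"
  by (cases k rule: int_diff_cases) (simp add: of_nat_Padic diff_Padic)

lemma of_rat_Padic: "of_rat q = (Padic (\<lambda>n. q) :: 'p::prime_card padic)"
proof -
  obtain a b where q: "q = of_int a / of_int b" "b \<noteq> 0" by (rule rat_as_fraction)
  have "Padic (\<lambda>n. q) * of_int b = (of_int a :: 'p padic)"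
    using q by (simp add: of_int_Padic mult_Padic)
  moreover have "of_rat q = (of_int a / of_int b :: 'p padic)"
    using q by (simp add: of_rat_divide)
  moreover have "(of_int b :: 'p padic) \<noteq> 0" using q by simp
  ultimately show ?thesis by (metis nonzero_eq_divide_eq)
qed

text \<open>
  The norm is the \<open>p\<close>-adic absolute value, so that \<open>padic_norm p = 1/p\<close>. The topology is the metric one.
\<close>

definition padic_norm :: "'p::prime_card padic \<Rightarrow> real" where
  "padic_norm x = lim (\<lambda>n. padic_abs CARD('p) (padic_seq x n))"

lemma norm_Padic_LIMSEQ:
  assumes X: "padic_cauchy CARD('p) X"
  shows "(\<lambda>n. padic_abs CARD('p) (X n)) \<longlonglongrightarrow> padic_norm (Padic X :: 'p::prime_card padic)"
proof -
  note p = prime_card[where 'a='p]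
  let ?x = "padic_seq (Padic X :: 'p padic)"
  have 1: "(\<lambda>n. padic_abs CARD('p) (?x n)) \<longlonglongrightarrow> padic_norm (Padic X :: 'p padic)"
    unfolding padic_norm_def using padic_cauchy_convergent[OF p padic_seq_props(1)]
    by (simp add: convergent_LIMSEQ_iff)
  have "(\<lambda>n. padic_abs CARD('p) (?x n - X n)) \<longlonglongrightarrow> 0"
    using padic_seq_Padic[OF X] by (simp add: padic_null_def)
  hence "(\<lambda>n. padic_abs CARD('p) (?x n) - padic_abs CARD('p) (X n)) \<longlonglongrightarrow> 0"
    by (rule Lim_null_comparison[rotated])
       (use padic_abs_diff_triangle[OF p] in \<open>auto intro!: always_eventually\<close>)
  from tendsto_diff[OF 1 this] show ?thesis by simp
qed

lemma padic_norm_of_rat: "padic_norm (of_rat q :: 'p::prime_card padic) = padic_abs CARD('p) q"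
  using LIMSEQ_unique[OF norm_Padic_LIMSEQ[of "\<lambda>_. q"] tendsto_const]
  by (simp add: of_rat_Padic)

lemma padic_norm_eq_0_iff: "padic_norm (x :: 'p::prime_card padic) = 0 \<longleftrightarrow> x = 0"
proof (cases x)
  case (1 X)
  have "padic_norm x = 0 \<longleftrightarrow> padic_null CARD('p) X"
    unfolding padic_null_def 1(1) using norm_Padic_LIMSEQ[OF 1(2)] LIMSEQ_unique by auto
  thus ?thesis using 1 by (simp add: Padic_eq_0_iff)
qed

lemma padic_norm_mult: "padic_norm (x * y :: 'p::prime_card padic) = padic_norm x * padic_norm y"
proof (cases x; cases y)
  fix X Y assume x: "x = Padic X" "padic_cauchy CARD('p) X"
    and y: "y = Padic Y" "padic_cauchy CARD('p) Y"
  note p = prime_card[where 'a='p]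
  have "(\<lambda>n. padic_abs CARD('p) (X n * Y n)) \<longlonglongrightarrow> padic_norm x * padic_norm y"
    unfolding padic_abs_mult[OF p] using x y by (auto intro!: tendsto_mult norm_Padic_LIMSEQ)
  moreover have "(\<lambda>n. padic_abs CARD('p) (X n * Y n)) \<longlonglongrightarrow> padic_norm (x * y)"
    using x y norm_Padic_LIMSEQ[OF padic_cauchy_mult[OF p x(2) y(2)]] by (simp add: mult_Padic)
  ultimately show ?thesis using LIMSEQ_unique by blast
qed

lemma padic_norm_add: "padic_norm (x + y :: 'p::prime_card padic) \<le> max (padic_norm x) (padic_norm y)"
proof (cases x; cases y)
  fix X Y assume x: "x = Padic X" "padic_cauchy CARD('p) X"
    and y: "y = Padic Y" "padic_cauchy CARD('p) Y"
  note p = prime_card[where 'a='p]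
  have "(\<lambda>n. padic_abs CARD('p) (X n + Y n)) \<longlonglongrightarrow> padic_norm (x + y)"
    using x y norm_Padic_LIMSEQ[OF padic_cauchy_add[OF p x(2) y(2)]] by (simp add: add_Padic)
  moreover have "(\<lambda>n. max (padic_abs CARD('p) (X n)) (padic_abs CARD('p) (Y n)))
                   \<longlonglongrightarrow> max (padic_norm x) (padic_norm y)"
    using x y by (auto intro!: tendsto_max norm_Padic_LIMSEQ)
  ultimately show ?thesis
    by (rule LIMSEQ_le) (use padic_abs_add[OF p] in blast)
qed

lemma padic_norm_minus: "padic_norm (- x :: 'p::prime_card padic) = padic_norm x"
proof -
  have "padic_norm (- x) = padic_norm (- 1 :: 'p padic) * padic_norm x" using padic_norm_mult[of "- 1" x] by simp
  also have "padic_norm (- 1 :: 'p padic) = padic_norm (of_rat (- 1) :: 'p padic)" by simp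
  also have "\<dots> = 1" unfolding padic_norm_of_rat by simp
  finally show ?thesis by simp
qed

lemma padic_norm_nonneg: "padic_norm (x :: 'p::prime_card padic) \<ge> 0"
  using padic_norm_add[of x "- x"] padic_norm_eq_0_iff[of "0 :: 'p padic"] by (simp add: padic_norm_minus)

instantiation padic :: (prime_card) "metric_space"
begin

definition dist_padic :: "'a padic \<Rightarrow> 'a padic \<Rightarrow> real" where
  "dist_padic x y = padic_norm (x - y)"

definition uniformity_padic :: "('a padic \<times> 'a padic) filter" where
  "uniformity_padic = (INF e\<in>{0<..}. principal {(x, y). dist x y < e})"

definition open_padic :: "'a padic set \<Rightarrow> bool" where
  "open_padic U \<longleftrightarrow> (\<forall>x\<in>U. \<forall>\<^sub>F (x', y) in uniformity. x' = x \<longrightarrow> y \<in> U)"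

instance
proof
  fix x y z :: "'a padic"
  show "dist x y = 0 \<longleftrightarrow> x = y" by (simp add: dist_padic_def padic_norm_eq_0_iff)
  have "dist x y \<le> max (padic_norm (x - z)) (padic_norm (z - y))"
    using padic_norm_add[of "x - z" "z - y"] by (simp add: dist_padic_def)
  thus "dist x y \<le> dist x z + dist y z"
    using padic_norm_nonneg[of "x - z"] padic_norm_nonneg[of "z - y"]
      padic_norm_minus[of "y - z"] by (simp add: dist_padic_def)
qed (fact dist_padic_def uniformity_padic_def open_padic_def)+

end

lemma padic_rat_dense:
  fixes x :: "'p::prime_card padic"
  assumes "e > 0"
  obtains q where "padic_norm (x - of_rat q) < e"
proof (cases x)
  case (1 X)
  note p = prime_card[where 'a='p]
  obtain N where N: "\<forall>m\<ge>N. \<forall>n\<ge>N. padic_abs CARD('p) (X m - X n) < e / 2"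
    using 1(2) assms unfolding padic_cauchy_def by (meson half_gt_zero)
  have "x - of_rat (X N) = Padic (\<lambda>n. X n - X N)"
    using 1 by (simp add: of_rat_Padic diff_Padic)
  hence "(\<lambda>n. padic_abs CARD('p) (X n - X N)) \<longlonglongrightarrow> padic_norm (x - of_rat (X N))"
    using norm_Padic_LIMSEQ[of "\<lambda>n. X n - X N", where 'p='p] 1 p by (simp add: padic_cauchy_diff)
  hence "padic_norm (x - of_rat (X N)) \<le> e / 2"
    by (rule LIMSEQ_le_const2) (use N in \<open>auto intro!: exI[of _ N] less_imp_le\<close>)
  thus ?thesis using that[of "X N"] assms by simp
qed

instance padic :: (prime_card) complete_space
proof
  fix X :: "nat \<Rightarrow> 'a padic" assume X: "Cauchy X"
  note p = prime_card[where 'a='a]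
  have "\<exists>q. padic_norm (X n - of_rat q) < inverse (of_nat (Suc n))" for n
    by (rule padic_rat_dense[of "inverse (of_nat (Suc n))" "X n"]) auto
  then obtain q where q: "\<And>n. padic_norm (X n - of_rat (q n)) < inverse (of_nat (Suc n))" by metis
  have q0: "(\<lambda>n. padic_norm (X n - of_rat (q n))) \<longlonglongrightarrow> 0"
    by (rule tendsto_sandwich[OF _ _ tendsto_const LIMSEQ_inverse_real_of_nat])
       (use q in \<open>auto intro!: always_eventually less_imp_le padic_norm_nonneg\<close>)
  have qc: "padic_cauchy CARD('a) q"
    unfolding padic_cauchy_def
  proof (intro allI impI)
    fix e :: real assume e: "e > 0"
    obtain M where M: "\<forall>m\<ge>M. \<forall>n\<ge>M. dist (X m) (X n) < e"
      using X e unfolding Cauchy_def by blast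
    obtain N where N: "\<forall>n\<ge>N. padic_norm (X n - of_rat (q n)) < e"
      using order_tendstoD(2)[OF q0 e] by (auto simp: eventually_sequentially)
    have "padic_abs CARD('a) (q m - q n) < e" if "m \<ge> max M N" "n \<ge> max M N" for m n
    proof -
      have "padic_abs CARD('a) (q m - q n) = padic_norm (of_rat (q m) - of_rat (q n) :: 'a padic)"
        by (simp add: padic_norm_of_rat[symmetric] of_rat_diff)
      also have "of_rat (q m) - of_rat (q n) =
                 (- (X m - of_rat (q m)) + (X m - X n)) + (X n - of_rat (q n))" by simp
      also have "padic_norm \<dots> \<le> max (max (padic_norm (X m - of_rat (q m))) (padic_norm (X m - X n)))
                               (padic_norm (X n - of_rat (q n)))"
        by (meson max.mono padic_norm_add padic_norm_minus order.refl order.trans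
              eq_refl[OF padic_norm_minus])
      also have "\<dots> < e" using M N that by (simp add: dist_padic_def)
      finally show ?thesis .
    qed
    thus "\<exists>K. \<forall>m\<ge>K. \<forall>n\<ge>K. padic_abs CARD('a) (q m - q n) < e" by blast
  qed
  define x :: "'a padic" where "x = Padic q"
  have "(\<lambda>n. padic_norm (x - of_rat (q n))) \<longlonglongrightarrow> 0"
  proof (rule LIMSEQ_I)
    fix e :: real assume e: "e > 0"
    then obtain N where N: "\<forall>m\<ge>N. \<forall>n\<ge>N. padic_abs CARD('a) (q m - q n) < e / 2"
      using qc unfolding padic_cauchy_def by (meson half_gt_zero)
    have "norm (padic_norm (x - of_rat (q n)) - 0) < e" if n: "n \<ge> N" for n
    proof -
      have "x - of_rat (q n) = Padic (\<lambda>m. q m - q n)"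
        using qc by (simp add: x_def of_rat_Padic diff_Padic)
      hence "(\<lambda>m. padic_abs CARD('a) (q m - q n)) \<longlonglongrightarrow> padic_norm (x - of_rat (q n))"
        using norm_Padic_LIMSEQ[of "\<lambda>m. q m - q n", where 'p='a] qc p
        by (simp add: padic_cauchy_diff)
      hence "padic_norm (x - of_rat (q n)) \<le> e / 2"
        by (rule LIMSEQ_le_const2) (use N n in \<open>auto intro!: exI[of _ N] less_imp_le\<close>)
      thus ?thesis using e padic_norm_nonneg[of "x - of_rat (q n)"] by simp
    qed
    thus "\<exists>N. \<forall>n\<ge>N. norm (padic_norm (x - of_rat (q n)) - 0) < e" by blast
  qed
  from tendsto_add[OF q0 this]
  have lim: "(\<lambda>n. padic_norm (X n - of_rat (q n)) + padic_norm (x - of_rat (q n))) \<longlonglongrightarrow> 0" by simp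
  have "dist (X n) x \<le> padic_norm (X n - of_rat (q n)) + padic_norm (x - of_rat (q n))" for n
    using dist_triangle2[of "X n" x "of_rat (q n)"] by (simp add: dist_padic_def)
  hence "(\<lambda>n. dist (X n) x) \<longlonglongrightarrow> 0"
    by (intro tendsto_sandwich[OF _ _ tendsto_const lim]) (auto intro!: always_eventually)
  hence "X \<longlonglongrightarrow> x" by (rule iffD2[OF tendsto_dist_iff])
  thus "convergent X" by (auto simp: convergent_def)
qed

definition padic_integers :: "'p::prime_card padic set" where
  "padic_integers = {x. padic_norm x \<le> 1}"

section \<open>Dirichlet characters and the Kubota--Leopoldt function\<close>

definition dirichlet_character :: "nat \<Rightarrow> (int \<Rightarrow> 'a::field) \<Rightarrow> bool" where
  "dirichlet_character N \<theta> \<longleftrightarrow> N > 0 \<and>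
     (\<forall>a b. \<theta> (a * b) = \<theta> a * \<theta> b) \<and>
     (\<forall>a. \<theta> (a + int N) = \<theta> a) \<and>
     (\<forall>a. \<theta> a \<noteq> 0 \<longleftrightarrow> coprime a (int N))"

definition conductor :: "(int \<Rightarrow> 'a::field) \<Rightarrow> nat" where
  "conductor \<theta> = (LEAST f. \<exists>\<psi>. dirichlet_character f \<psi> \<and> (\<forall>a. \<theta> a \<noteq> 0 \<longrightarrow> \<psi> a = \<theta> a))"

text \<open>
  The primitive character inducing \<open>\<theta>\<close>. For a principal character this is the constant function 1,
  of conductor 1, whose value at \<open>p\<close> is 1 and not 0.
\<close>

definition primitive_character :: "(int \<Rightarrow> 'a::field) \<Rightarrow> int \<Rightarrow> 'a" where
  "primitive_character \<theta> = (THE \<psi>. dirichlet_character (conductor \<theta>) \<psi> \<and>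
     (\<forall>a. \<theta> a \<noteq> 0 \<longrightarrow> \<psi> a = \<theta> a))"

text \<open>
  For a primitive character \<open>\<theta>\<close> of conductor \<open>f\<close>, the numbers with generating series
  \<open>\<Sum>a=1..f. \<theta>(a) T exp(a T) / (exp(f T) - 1) = \<Sum>k. B(k, \<theta>) T^k / k!\<close>. The denominator has
  subdegree 1 and divides the numerator, which is a multiple of \<open>T\<close>.
\<close>

definition generalized_bernoulli :: "nat \<Rightarrow> (int \<Rightarrow> 'a::field_char_0) \<Rightarrow> 'a" where
  "generalized_bernoulli k \<theta> = (let f = conductor \<theta> in
     fact k * fps_nth ((\<Sum>a = 1..f. fps_const (\<theta> (int a)) * fps_X * fps_exp (of_nat a)) /
                       (fps_exp (of_nat f) - 1)) k)"

text \<open>For \<open>p = 2\<close> one would need characters mod 4 instead; only odd \<open>p\<close> is used.\<close>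

definition teichmueller :: "int \<Rightarrow> 'p::prime_card padic" where
  "teichmueller a = (if int CARD('p) dvd a then 0 else
     (THE z. z ^ (CARD('p) - 1) = 1 \<and> padic_norm (z - of_int a) < 1))"

text \<open>
  The product \<open>\<theta> \<omega>^(-k)\<close> is the product of Dirichlet characters in the usual sense, i.e. the primitive
  character inducing the pointwise product. Since the integers \<open>1 - k\<close> with \<open>k \<ge> 1\<close> are dense in
  the \<open>p\<close>-adic integers, the interpolation property below determines a continuous function;
  it has a pole at 1 when \<open>\<theta>\<close> is principal. Outside its domain it is set to 0.
\<close>

definition teichmueller_twist :: "(int \<Rightarrow> 'p::prime_card padic) \<Rightarrow> nat \<Rightarrow> int \<Rightarrow> 'p padic" where
  "teichmueller_twist \<theta> k = primitive_character (\<lambda>a. \<theta> a * inverse (teichmueller a) ^ k)"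

definition padic_L_domain :: "(int \<Rightarrow> 'p::prime_card padic) \<Rightarrow> 'p padic set" where
  "padic_L_domain \<theta> = (if conductor \<theta> = 1 then padic_integers - {1} else padic_integers)"

definition padic_L :: "(int \<Rightarrow> 'p::prime_card padic) \<Rightarrow> 'p padic \<Rightarrow> 'p padic" where
  "padic_L \<theta> = (THE L.
     continuous_on (padic_L_domain \<theta>) L \<and>
     (\<forall>k\<ge>1. L (1 - of_nat k) =
        - (1 - teichmueller_twist \<theta> k (int CARD('p)) * of_nat CARD('p) ^ (k - 1)) *
          generalized_bernoulli k (teichmueller_twist \<theta> k) / of_nat k) \<and>
     (\<forall>s. s \<notin> padic_L_domain \<theta> \<longrightarrow> L s = 0))"

section \<open>Morita's Gamma function\<close>

text \<open>Extended by 0 outside the \<open>p\<close>-adic integers.\<close>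

definition padic_Gamma :: "'p::prime_card padic \<Rightarrow> 'p padic" where
  "padic_Gamma = (THE G.
     continuous_on padic_integers G \<and>
     G ` padic_integers \<subseteq> padic_integers \<and>
     G 0 = 1 \<and>
     (\<forall>x\<in>padic_integers. G (x + 1) = (if padic_norm x = 1 then - x * G x else - G x)) \<and>
     (\<forall>x. x \<notin> padic_integers \<longrightarrow> G x = 0))"

definition padic_Gamma_fps :: "'p::prime_card padic fps" where
  "padic_Gamma_fps = (THE F. \<exists>r>0. \<forall>x. padic_norm x < r \<longrightarrow>
     (\<lambda>n. fps_nth F n * x ^ n) sums padic_Gamma x)"

definition padic_log_deriv_Gamma :: "'p::prime_card padic fps" where
  "padic_log_deriv_Gamma = fps_deriv padic_Gamma_fps / padic_Gamma_fps"

definition padic_fps_eval :: "'p::prime_card padic fps \<Rightarrow> 'p padic \<Rightarrow> 'p padic" where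
  "padic_fps_eval F x = (\<Sum>n. fps_nth F n * x ^ n)"

definition coprime_power_sum :: "nat \<Rightarrow> nat \<Rightarrow> 'p::prime_card padic" where
  "coprime_power_sum l k = (\<Sum>i | 1 \<le> i \<and> i \<le> k - 1 \<and> coprime i CARD('p). 1 / of_nat i ^ l)"

end

theory Submission
  imports Defs "HOL-Number_Theory.Residues" "HOL-Combinatorics.Stirling"
begin

text \<open>
  Write \<open>V n\<close> for the Volkenborn integral of \<open>u^(-n)\<close> over the \<open>p\<close>-adic units, the limit of
  \<open>p^(-N) * (\<Sum>a<p^N. a^(-n))\<close>, where \<open>a\<close> is prime to \<open>p\<close>. It vanishes for odd \<open>n\<close> by pairing
  \<open>a\<close> with \<open>p^N - a\<close>. Expanding \<open>\<langle>a\<rangle>^c\<close> as a binomial series in \<open>\<langle>a\<rangle> - 1\<close> and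
  integrating termwise gives a function of \<open>c\<close> that interpolates the generalized Bernoulli numbers, which are the limits of
  \<open>p^(-N) * (\<Sum>a<p^N. \<theta>(a) a^k)\<close>; hence \<open>V n = n * L_p (1 + n, \<omega>^(-n))\<close>.

  Computing the integral of \<open>f (u + x) - f u\<close> with \<open>x = n p\<close>, for \<open>f u = u^(1-l)\<close> or \<open>f = log\<close>, once by
  expanding in powers of \<open>x\<close> and once by telescoping expresses \<open>S_l (n p)\<close> as a power series with coefficients \<open>V k\<close>.

  For the Gamma function, the functional equation shows that the \<open>k\<close>-th differences of
  \<open>n \<mapsto> \<Gamma>_p (p^4 n)\<close> are divisible by \<open>p^(2k)\<close>, so the Newton series is a convergent power series. Differentiating
  the logarithm of \<open>\<Gamma>_p (x + p^s) = \<plusminus> (\<Prod>i<p^s. x + i) \<Gamma>_p x\<close> formally, dividing by \<open>p^s\<close> and letting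
  \<open>s\<close> tend to infinity identifies the coefficients of the logarithmic derivative with the \<open>V k\<close>.
\<close>

section \<open>Ultrametric analysis\<close>

text \<open>The integral is not continuous for the supremum norm: the division by \<open>p^N\<close>
  can destroy any bound. Termwise integration therefore rests on a Lipschitz condition on the units
  (\<open>unit_lip\<close>), which bounds all Riemann sums by \<open>p\<close>, uniformly in
  \<open>N\<close>. Limits and sums are then interchanged by dominated convergence, where in the
  ultrametric setting a dominating sequence need only tend to zero. The scale \<open>p^4\<close> for
  the Gamma function is dictated by the denominators \<open>k!\<close> of the Newton series. Write
  \<open>q = p^2\<close> and \<open>p^4 n = q (q n)\<close>: one factor \<open>q\<close> makes the
  translation of \<open>z = q n\<close> trivial modulo \<open>q\<close>, the other does the same to
  the argument of the polynomial quotient of consecutive values. So every difference gains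
  \<open>p^2\<close>, and since \<open>k!\<close> costs at most \<open>p^k\<close>, a decay of
  \<open>p^(-k)\<close> remains. A small disc is enough, because the logarithmic derivative is
  identified coefficient by coefficient. The oddness of \<open>p\<close> enters in three places: 2
  is a unit in the pairing argument, the sign \<open>(-1)^p\<close> cancels the one in Wilson's
  theorem, and \<open>p\<close> divides \<open>0 + 1 + ... + (p - 1)\<close>.\<close>

lemma padic_norm_0 [simp]: "padic_norm (0 :: 'p::prime_card padic) = 0"
  by (simp add: padic_norm_eq_0_iff)

lemma padic_norm_1 [simp]: "padic_norm (1 :: 'p::prime_card padic) = 1"
  using padic_norm_of_rat[of 1, where 'p='p] by simp

declare padic_norm_minus [simp] padic_norm_eq_0_iff [simp] padic_norm_nonneg [simp]

lemma padic_norm_minus_commute: "padic_norm (x - y) = padic_norm (y - x :: 'p::prime_card padic)"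
  by (metis minus_diff_eq padic_norm_minus)

lemma padic_norm_add_le: "padic_norm (x::'p::prime_card padic) \<le> C \<Longrightarrow> padic_norm y \<le> C \<Longrightarrow> padic_norm (x + y) \<le> C"
  using padic_norm_add[of x y] by linarith

lemma padic_norm_diff_le: "padic_norm (x::'p::prime_card padic) \<le> C \<Longrightarrow> padic_norm y \<le> C \<Longrightarrow> padic_norm (x - y) \<le> C"
  using padic_norm_add_le[of x C "- y"] by simp

lemma padic_norm_add_less: "padic_norm (x::'p::prime_card padic) < C \<Longrightarrow> padic_norm y < C \<Longrightarrow> padic_norm (x + y) < C"
  using padic_norm_add[of x y] by linarith

lemma padic_norm_diff_less: "padic_norm (x::'p::prime_card padic) < C \<Longrightarrow> padic_norm y < C \<Longrightarrow> padic_norm (x - y) < C"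
  using padic_norm_add_less[of x C "- y"] by simp

text \<open>In the ultrametric inequality for \<open>x = (x + y) - y\<close> the term
  \<open>y\<close> is too small to account for \<open>x\<close>.\<close>

lemma padic_norm_add_eq:
  assumes "padic_norm (y::'p::prime_card padic) < padic_norm x"
  shows "padic_norm (x + y) = padic_norm x"
  using padic_norm_add[of x y] padic_norm_add[of "x + y" "- y"] assms by simp

lemma padic_norm_sum_le:
  "C \<ge> 0 \<Longrightarrow> (\<And>i. i \<in> A \<Longrightarrow> padic_norm (f i :: 'p::prime_card padic) \<le> C) \<Longrightarrow> padic_norm (sum f A) \<le> C"
  by (induction A rule: infinite_finite_induct) (auto intro!: padic_norm_add_le)

lemma padic_norm_power: "padic_norm (x ^ n :: 'p::prime_card padic) = padic_norm x ^ n"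
  by (induction n) (auto simp: padic_norm_mult)

lemma padic_norm_prod: "padic_norm (prod f A :: 'p::prime_card padic) = (\<Prod>i\<in>A. padic_norm (f i))"
  by (induction A rule: infinite_finite_induct) (auto simp: padic_norm_mult)

lemma padic_norm_inverse: "padic_norm (inverse x :: 'p::prime_card padic) = inverse (padic_norm x)"
proof (cases "x = 0")
  case False
  have "padic_norm x * padic_norm (inverse x) = 1"
    using False by (simp flip: padic_norm_mult)
  thus ?thesis by (metis inverse_unique)
qed auto

lemma padic_norm_divide: "padic_norm (x / y :: 'p::prime_card padic) = padic_norm x / padic_norm y"
  by (simp add: divide_inverse padic_norm_mult padic_norm_inverse)

lemma CARD_gt_1: "1 < real CARD('p::prime_card)"
  using prime_gt_1_nat[OF prime_card[where 'a='p]] by simp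

lemma CARD_pos: "0 < real CARD('p::prime_card)"
  using CARD_gt_1[where 'p='p] by linarith

lemma padic_norm_of_int:
  "a \<noteq> 0 \<Longrightarrow> padic_norm (of_int a :: 'p::prime_card padic) = 1 / real CARD('p) ^ multiplicity (int CARD('p)) a"
  using padic_norm_of_rat[of "of_int a", where 'p='p] padic_abs_divide[OF prime_card[where 'a='p], of a 1]
  by (simp add: power_int_minus field_simps)

text \<open>The dictionary that turns integer congruences modulo \<open>p^k\<close> into norm
  estimates and back.\<close>

lemma padic_norm_of_int_le_iff:
  "padic_norm (of_int a :: 'p::prime_card padic) \<le> 1 / real CARD('p) ^ k \<longleftrightarrow> int CARD('p) ^ k dvd a"
proof (cases "a = 0")
  case False
  have "int CARD('p) ^ k dvd a \<longleftrightarrow> k \<le> multiplicity (int CARD('p)) a"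
    using False prime_card[where 'a='p] by (intro power_dvd_iff_le_multiplicity) (auto simp: not_is_unit_0 prime_gt_1_nat)
  also have "\<dots> \<longleftrightarrow> real CARD('p) ^ k \<le> real CARD('p) ^ multiplicity (int CARD('p)) a"
    using CARD_gt_1[where 'p='p] by (simp only: power_increasing_iff)
  finally show ?thesis
    using False CARD_pos[where 'p='p] by (simp add: padic_norm_of_int divide_simps)
qed auto

lemma padic_norm_of_int_le_1 [simp]: "padic_norm (of_int a :: 'p::prime_card padic) \<le> 1"
  using padic_norm_of_int_le_iff[of a 0, where 'p='p] by simp

lemma padic_norm_of_nat_le_1 [simp]: "padic_norm (of_nat a :: 'p::prime_card padic) \<le> 1"
  using padic_norm_of_int_le_1[of "int a", where 'p='p] by simp

lemma padic_norm_of_int_le_inverse_iff: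
  "padic_norm (of_int a :: 'p::prime_card padic) \<le> 1 / real CARD('p) \<longleftrightarrow> int CARD('p) dvd a"
  using padic_norm_of_int_le_iff[of a 1, where 'p='p] by simp

lemma padic_norm_of_int_eq_1_iff:
  "padic_norm (of_int a :: 'p::prime_card padic) = 1 \<longleftrightarrow> \<not> int CARD('p) dvd a"
proof
  assume "padic_norm (of_int a :: 'p::prime_card padic) = 1"
  thus "\<not> int CARD('p) dvd a"
    using padic_norm_of_int_le_inverse_iff[of a, where 'p='p] CARD_gt_1[where 'p='p]
    by (auto simp: field_simps)
next
  assume a: "\<not> int CARD('p) dvd a"
  hence "a \<noteq> 0" "multiplicity (int CARD('p)) a = 0" by (auto simp: not_dvd_imp_multiplicity_0)
  thus "padic_norm (of_int a :: 'p::prime_card padic) = 1" by (simp add: padic_norm_of_int)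
qed

lemma padic_norm_of_int_less_1_iff:
  "padic_norm (of_int a :: 'p::prime_card padic) < 1 \<longleftrightarrow> int CARD('p) dvd a"
  using padic_norm_of_int_eq_1_iff[of a, where 'p='p] padic_norm_of_int_le_1[of a, where 'p='p]
  by linarith

lemma padic_norm_of_nat_eq_1_iff:
  "padic_norm (of_nat a :: 'p::prime_card padic) = 1 \<longleftrightarrow> coprime a CARD('p)"
  using padic_norm_of_int_eq_1_iff[of "int a", where 'p='p] prime_card[where 'a='p]
  by (metis coprime_commute coprime_absorb_left int_dvd_int_iff not_prime_unit of_int_of_nat_eq prime_imp_coprime_nat)

lemma padic_norm_CARD [simp]: "padic_norm (of_nat CARD('p) :: 'p::prime_card padic) = 1 / real CARD('p)"
proof -
  have "multiplicity (int CARD('p)) (int CARD('p)) = 1"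
    using prime_card[where 'a='p] by (intro multiplicity_self) (auto simp: prime_gt_1_nat)
  thus ?thesis using padic_norm_of_int[of "int CARD('p)", where 'p='p] CARD_pos[where 'p='p] by simp
qed

lemma padic_norm_CARD_power [simp]:
  "padic_norm (of_nat CARD('p) ^ k :: 'p::prime_card padic) = 1 / real CARD('p) ^ k"
  by (simp add: padic_norm_power power_one_over)

lemma padic_integers_of_nat [simp]: "of_nat n \<in> (padic_integers :: 'p::prime_card padic set)"
  by (simp add: padic_integers_def)

lemma padic_integers_0_1 [simp]: "0 \<in> (padic_integers :: 'p::prime_card padic set)" "1 \<in> (padic_integers :: 'p padic set)"
  by (simp_all add: padic_integers_def)

lemma padic_integers_closed:
  fixes x y :: "'p::prime_card padic"
  assumes "x \<in> padic_integers" "y \<in> padic_integers"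
  shows "x + y \<in> padic_integers" "x - y \<in> padic_integers" "x * y \<in> padic_integers" "- x \<in> padic_integers"
  using assms by (auto simp: padic_integers_def padic_norm_mult mult_le_one intro: padic_norm_add_le padic_norm_diff_le)

lemma padic_norm_mult_le:
  "padic_norm (x::'p::prime_card padic) \<le> a \<Longrightarrow> padic_norm y \<le> b \<Longrightarrow> padic_norm (x * y) \<le> a * b"
  unfolding padic_norm_mult by (intro mult_mono) (auto intro: order.trans[OF padic_norm_nonneg])

section \<open>Limits and continuity of the field operations\<close>

lemma tendsto_padic_iff:
  fixes f :: "'a \<Rightarrow> 'p::prime_card padic"
  shows "(f \<longlongrightarrow> l) F \<longleftrightarrow> ((\<lambda>x. padic_norm (f x - l)) \<longlongrightarrow> 0) F"
  using tendsto_dist_iff[of f l F] by (simp add: dist_padic_def)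

lemma tendsto_padic_iff_less:
  fixes f :: "'a \<Rightarrow> 'p::prime_card padic"
  shows "(f \<longlongrightarrow> l) F \<longleftrightarrow> (\<forall>e>0. eventually (\<lambda>x. padic_norm (f x - l) < e) F)"
  by (simp add: tendsto_iff dist_padic_def)

lemma tendsto_padic_norm:
  fixes f :: "'a \<Rightarrow> 'p::prime_card padic"
  assumes "(f \<longlongrightarrow> l) F"
  shows "((\<lambda>x. padic_norm (f x)) \<longlongrightarrow> padic_norm l) F"
  using tendsto_dist[OF assms tendsto_const[of 0]] by (simp add: dist_padic_def)

text \<open>The field is not a real normed algebra; the topological group and semigroup instances
  give access to the calculus of \<open>has_sum\<close> and \<open>infsum\<close>.\<close>

instance padic :: (prime_card) topological_ab_group_add
proof
  fix a b :: "'a padic"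
  have "\<forall>\<^sub>F x in nhds a \<times>\<^sub>F nhds b. padic_norm (fst x + snd x - (a + b)) < e" if e: "e > 0" for e
  proof (rule eventually_mono)
    show "\<forall>\<^sub>F x in nhds a \<times>\<^sub>F nhds b. dist (fst x) a < e \<and> dist (snd x) b < e"
      unfolding eventually_prod_filter
      using e by (intro exI[of _ "\<lambda>x. dist x a < e"] exI[of _ "\<lambda>x. dist x b < e"])
        (auto simp: eventually_nhds_metric)
    fix x assume "dist (fst x) a < e \<and> dist (snd x) b < e"
    hence "padic_norm ((fst x - a) + (snd x - b)) < e"
      by (intro padic_norm_add_less) (auto simp: dist_padic_def)
    thus "padic_norm (fst x + snd x - (a + b)) < e" by (simp add: algebra_simps)
  qed
  thus "LIM x nhds a \<times>\<^sub>F nhds b. fst x + snd x :> nhds (a + b)"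
    by (simp add: tendsto_padic_iff_less)
  show "(uminus \<longlongrightarrow> - a) (nhds a)"
    unfolding tendsto_padic_iff_less
  proof (intro allI impI)
    fix e :: real assume "e > 0"
    thus "\<forall>\<^sub>F x in nhds a. padic_norm (- x - - a) < e"
      unfolding eventually_nhds_metric
      by (auto simp: dist_padic_def padic_norm_minus_commute)
  qed
qed

instance padic :: (prime_card) topological_semigroup_mult
proof
  fix a b :: "'a padic"
  have "\<forall>\<^sub>F x in nhds a \<times>\<^sub>F nhds b. padic_norm (fst x * snd x - a * b) < e" if e: "e > 0" for e
  proof -
    \<comment> \<open>The minimum with 1 controls the product of the two increments, the quotient
      controls the two mixed terms.\<close>
    define d where "d = min 1 (e / (1 + padic_norm a + padic_norm b))"
    have pos: "1 + padic_norm a + padic_norm b > 0"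
      using padic_norm_nonneg[of a] padic_norm_nonneg[of b] by linarith
    hence d: "d > 0" "d \<le> 1" using e by (auto simp: d_def)
    have "d \<le> e / (1 + padic_norm a + padic_norm b)" by (simp add: d_def)
    hence de: "d * (1 + padic_norm a + padic_norm b) \<le> e" using pos by (simp add: field_simps)
    show ?thesis
    proof (rule eventually_mono)
      show "\<forall>\<^sub>F x in nhds a \<times>\<^sub>F nhds b. dist (fst x) a < d \<and> dist (snd x) b < d"
        unfolding eventually_prod_filter
        using d by (intro exI[of _ "\<lambda>x. dist x a < d"] exI[of _ "\<lambda>x. dist x b < d"])
          (auto simp: eventually_nhds_metric)
      fix x assume x: "dist (fst x) a < d \<and> dist (snd x) b < d"
      have "fst x * snd x - a * b = (fst x - a) * (snd x - b) + ((fst x - a) * b + a * (snd x - b))"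
        by (simp add: algebra_simps)
      hence "padic_norm (fst x * snd x - a * b) \<le> max (padic_norm ((fst x - a) * (snd x - b)))
          (max (padic_norm ((fst x - a) * b)) (padic_norm (a * (snd x - b))))"
        using padic_norm_add[of "(fst x - a) * (snd x - b)" "(fst x - a) * b + a * (snd x - b)"]
          padic_norm_add[of "(fst x - a) * b" "a * (snd x - b)"] by (simp only: le_max_iff_disj) linarith
      also have "\<dots> < e"
      proof -
        have "padic_norm ((fst x - a) * (snd x - b)) < d"
          using x d mult_strict_mono[of "padic_norm (fst x - a)" d "padic_norm (snd x - b)" 1]
          by (auto simp: padic_norm_mult dist_padic_def)
        moreover have "d \<le> e"
        proof -
          have "d * padic_norm a \<ge> 0" "d * padic_norm b \<ge> 0" using d by auto
          thus ?thesis using de unfolding distrib_left mult_1_right by linarith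
        qed
        moreover have "padic_norm ((fst x - a) * b) \<le> d * padic_norm b"
          using x by (auto simp: padic_norm_mult dist_padic_def intro!: mult_right_mono)
        moreover have "padic_norm (a * (snd x - b)) \<le> d * padic_norm a"
          using x unfolding padic_norm_mult mult.commute[of _ "padic_norm a"]
          by (intro mult_left_mono) (auto simp: dist_padic_def)
        moreover have "d * padic_norm a \<ge> 0" "d * padic_norm b \<ge> 0" using d by auto
        ultimately show ?thesis using de d unfolding distrib_left mult_1_right max_less_iff_conj by linarith
      qed
      finally show "padic_norm (fst x * snd x - a * b) < e" .
    qed
  qed
  thus "LIM x nhds a \<times>\<^sub>F nhds b. fst x * snd x :> nhds (a * b)"
    by (simp add: tendsto_padic_iff_less)
qed

lemma tendsto_mult_padic [tendsto_intros]:
  fixes f g :: "'a \<Rightarrow> 'p::prime_card padic"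
  assumes "(f \<longlongrightarrow> a) F" "(g \<longlongrightarrow> b) F"
  shows "((\<lambda>x. f x * g x) \<longlongrightarrow> a * b) F"
  using filterlim_compose[OF tendsto_mult_Pair, of "\<lambda>x. (f x, g x)" a b F] assms
  by (simp add: nhds_prod[symmetric] tendsto_Pair)

lemma tendsto_power_padic [tendsto_intros]:
  fixes f :: "'a \<Rightarrow> 'p::prime_card padic"
  assumes "(f \<longlongrightarrow> a) F"
  shows "((\<lambda>x. f x ^ n) \<longlongrightarrow> a ^ n) F"
  by (induction n) (auto intro!: tendsto_mult_padic assms)

lemma tendsto_prod_padic:
  fixes f :: "'i \<Rightarrow> 'a \<Rightarrow> 'p::prime_card padic"
  assumes "\<And>i. i \<in> A \<Longrightarrow> (f i \<longlongrightarrow> a i) F"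
  shows "((\<lambda>x. \<Prod>i\<in>A. f i x) \<longlongrightarrow> (\<Prod>i\<in>A. a i)) F"
  using assms by (induction A rule: infinite_finite_induct) (auto intro!: tendsto_mult_padic)

lemma tendsto_inverse_padic [tendsto_intros]:
  fixes f :: "'a \<Rightarrow> 'p::prime_card padic"
  assumes f: "(f \<longlongrightarrow> a) F" and a: "a \<noteq> 0"
  shows "((\<lambda>x. inverse (f x)) \<longlongrightarrow> inverse a) F"
  unfolding tendsto_padic_iff
proof (rule Lim_transform_eventually)
  have na: "padic_norm a > 0" using a padic_norm_nonneg[of a] by (simp add: less_le)
  have "((\<lambda>x. padic_norm (f x - a) / (padic_norm (f x) * padic_norm a)) \<longlongrightarrow> 0 / (padic_norm a * padic_norm a)) F"
    using f na by (intro tendsto_intros tendsto_padic_norm f) (auto simp: tendsto_padic_iff[symmetric] a)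
  thus "((\<lambda>x. padic_norm (f x - a) / (padic_norm (f x) * padic_norm a)) \<longlongrightarrow> 0) F" by simp
  have "eventually (\<lambda>x. padic_norm (f x) > 0) F"
    by (rule order_tendstoD(1)[OF tendsto_padic_norm[OF f] na])
  thus "\<forall>\<^sub>F x in F. padic_norm (f x - a) / (padic_norm (f x) * padic_norm a) = padic_norm (inverse (f x) - inverse a)"
  proof eventually_elim
    case (elim x)
    hence "f x \<noteq> 0" by auto
    hence "inverse (f x) - inverse a = (a - f x) / (f x * a)" using a by (simp add: field_simps)
    thus ?case by (simp only: padic_norm_divide padic_norm_mult padic_norm_minus_commute)
  qed
qed

lemma tendsto_divide_padic [tendsto_intros]:
  fixes f g :: "'a \<Rightarrow> 'p::prime_card padic"
  shows "(f \<longlongrightarrow> a) F \<Longrightarrow> (g \<longlongrightarrow> b) F \<Longrightarrow> b \<noteq> 0 \<Longrightarrow> ((\<lambda>x. f x / g x) \<longlongrightarrow> a / b) F"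
  by (simp add: divide_inverse tendsto_mult_padic tendsto_inverse_padic)

lemma one_over_CARD_power_tendsto_0: "(\<lambda>n. 1 / real CARD('p::prime_card) ^ n) \<longlonglongrightarrow> 0"
  using LIMSEQ_power_zero[of "1 / real CARD('p)"] CARD_gt_1[where 'p='p] by (simp add: power_one_over)

lemma CARD_power_tendsto_0: "(\<lambda>n. of_nat CARD('p) ^ n :: 'p::prime_card padic) \<longlonglongrightarrow> 0"
  unfolding tendsto_padic_iff using one_over_CARD_power_tendsto_0[where 'p='p] by simp

lemma one_over_CARD_power_less:
  assumes "e > 0" obtains k where "1 / real CARD('p::prime_card) ^ k < e"
  using order_tendstoD(2)[OF one_over_CARD_power_tendsto_0[where 'p='p] assms]
  by (auto simp: eventually_sequentially)

section \<open>Unordered sums and dominated convergence\<close>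

lemma tendsto_0_padicI:
  fixes f :: "'a \<Rightarrow> 'p::prime_card padic"
  assumes "\<forall>\<^sub>F x in F. padic_norm (f x) \<le> g x" "(g \<longlongrightarrow> 0) F"
  shows "(f \<longlongrightarrow> 0) F"
  unfolding tendsto_padic_iff
  by (rule tendsto_sandwich[OF _ _ tendsto_const assms(2)]) (use assms(1) in auto)

lemma padic_norm_limit_le:
  fixes f :: "'a \<Rightarrow> 'p::prime_card padic"
  assumes "(f \<longlongrightarrow> l) F" "F \<noteq> bot" "\<forall>\<^sub>F x in F. padic_norm (f x) \<le> C"
  shows "padic_norm l \<le> C"
  using tendsto_upperbound[OF tendsto_padic_norm[OF assms(1)] assms(3,2)] .

text \<open>Once a finite partial sum contains the finitely many terms of norm at least
  \<open>e / 2\<close>, enlarging it changes little by the ultrametric inequality. So the net of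
  partial sums is Cauchy without any absolute convergence.\<close>

lemma padic_summable_onI:
  fixes f :: "'a \<Rightarrow> 'p::prime_card padic"
  assumes "\<And>e. e > 0 \<Longrightarrow> finite {x\<in>A. padic_norm (f x) \<ge> e}"
  shows "f summable_on A"
proof -
  have "cauchy_filter (filtermap (sum f) (finite_subsets_at_top A))"
    unfolding cauchy_filter_metric_filtermap
  proof (intro allI impI)
    fix e :: real assume e: "e > 0"
    define S where "S = {x\<in>A. padic_norm (f x) \<ge> e / 2}"
    have S: "finite S" "S \<subseteq> A" using assms[of "e/2"] e by (auto simp: S_def)
    have small: "padic_norm (sum f T - sum f S) \<le> e / 2" if "finite T" "S \<subseteq> T" "T \<subseteq> A" for T
    proof -
      have "sum f T - sum f S = sum f (T - S)" using that by (simp add: sum_diff)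
      also have "padic_norm \<dots> \<le> e / 2" using e that by (intro padic_norm_sum_le) (auto simp: S_def)
      finally show ?thesis .
    qed
    show "\<exists>P. eventually P (finite_subsets_at_top A) \<and> (\<forall>x y. P x \<and> P y \<longrightarrow> dist (sum f x) (sum f y) < e)"
    proof (intro exI[of _ "\<lambda>T. finite T \<and> S \<subseteq> T \<and> T \<subseteq> A"] conjI allI impI)
      show "\<forall>\<^sub>F T in finite_subsets_at_top A. finite T \<and> S \<subseteq> T \<and> T \<subseteq> A"
        unfolding eventually_finite_subsets_at_top using S by (intro exI[of _ S]) auto
      fix T U assume "(finite T \<and> S \<subseteq> T \<and> T \<subseteq> A) \<and> (finite U \<and> S \<subseteq> U \<and> U \<subseteq> A)"
      hence "padic_norm ((sum f T - sum f S) - (sum f U - sum f S)) \<le> e / 2"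
        by (intro padic_norm_diff_le small) auto
      thus "dist (sum f T) (sum f U) < e" using e by (simp add: dist_padic_def)
    qed
  qed
  moreover have "filtermap (sum f) (finite_subsets_at_top A) \<noteq> bot" by (simp add: filtermap_bot_iff)
  ultimately have "convergent_filter (filtermap (sum f) (finite_subsets_at_top A))"
    by (simp add: cauchy_filter_convergent)
  thus ?thesis
    by (simp add: convergent_filter_iff summable_on_def has_sum_def filterlim_def)
qed

lemma padic_summable_on_natI:
  fixes f :: "nat \<Rightarrow> 'p::prime_card padic"
  assumes "f \<longlonglongrightarrow> 0"
  shows "f summable_on A"
proof (rule padic_summable_onI)
  fix e :: real assume "e > 0"
  then obtain N where "\<And>n. n \<ge> N \<Longrightarrow> padic_norm (f n) < e"
    using assms unfolding tendsto_padic_iff_less by (auto simp: eventually_sequentially)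
  hence "{x\<in>A. padic_norm (f x) \<ge> e} \<subseteq> {..<N}" by (auto simp: not_le[symmetric])
  thus "finite {x\<in>A. padic_norm (f x) \<ge> e}" by (rule finite_subset) auto
qed

lemma padic_norm_infsum_le:
  fixes f :: "'a \<Rightarrow> 'p::prime_card padic"
  assumes "C \<ge> 0" "\<And>x. x \<in> A \<Longrightarrow> padic_norm (f x) \<le> C"
  shows "padic_norm (infsum f A) \<le> C"
proof (cases "f summable_on A")
  case True
  have "(sum f \<longlongrightarrow> infsum f A) (finite_subsets_at_top A)" using True by (rule infsum_tendsto)
  moreover have "\<forall>\<^sub>F X in finite_subsets_at_top A. padic_norm (sum f X) \<le> C"
    by (intro eventually_finite_subsets_at_top_weakI padic_norm_sum_le assms) auto
  ultimately show ?thesis by (rule padic_norm_limit_le[OF _ finite_subsets_at_top_neq_bot])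
qed (use assms(1) in \<open>simp add: infsum_not_exists\<close>)

lemma padic_infsum_diff:
  fixes f g :: "'a \<Rightarrow> 'p::prime_card padic"
  assumes "f summable_on A" "g summable_on A"
  shows "infsum (\<lambda>x. f x - g x) A = infsum f A - infsum g A"
  using infsum_add[OF assms(1) summable_on_uminus[THEN iffD2, OF assms(2)]] by (simp add: infsum_uminus)

lemma finite_norm_ge_le:
  assumes "finite {x\<in>A. B x \<ge> (e::real)}" "\<And>x. x \<in> A \<Longrightarrow> padic_norm (f x :: 'p::prime_card padic) \<le> B x"
  shows "finite {x\<in>A. padic_norm (f x) \<ge> e}"
  by (rule finite_subset[OF _ assms(1)]) (use assms(2) in \<open>auto intro: order.trans\<close>)

text \<open>Dominated convergence. The dominator only has to exceed each positive bound finitely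
  often: on that finite set pointwise convergence is uniform, elsewhere both terms are small
  already.\<close>

lemma tendsto_padic_infsum:
  fixes f :: "'b \<Rightarrow> 'a \<Rightarrow> 'p::prime_card padic"
  assumes lim: "\<And>x. x \<in> A \<Longrightarrow> ((\<lambda>N. f N x) \<longlongrightarrow> g x) F"
    and bound: "\<forall>\<^sub>F N in F. \<forall>x\<in>A. padic_norm (f N x) \<le> B x"
    and fin: "\<And>e. e > 0 \<Longrightarrow> finite {x\<in>A. B x \<ge> e}"
  shows "((\<lambda>N. infsum (f N) A) \<longlongrightarrow> infsum g A) F"
proof (cases "F = bot")
  case False
  have gB: "padic_norm (g x) \<le> B x" if "x \<in> A" for x
    by (rule padic_norm_limit_le[OF lim[OF that] False]) (use bound that in \<open>auto elim: eventually_mono\<close>)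
  have sg: "g summable_on A"
    by (intro padic_summable_onI finite_norm_ge_le[OF fin gB])
  show ?thesis unfolding tendsto_padic_iff_less
  proof (intro allI impI)
    fix e :: real assume e: "e > 0"
    define S where "S = {x\<in>A. B x \<ge> e / 2}"
    have S: "finite S" "S \<subseteq> A" using fin[of "e/2"] e by (auto simp: S_def)
    have "\<forall>\<^sub>F N in F. \<forall>x\<in>S. padic_norm (f N x - g x) < e / 2"
      using S lim half_gt_zero[OF e] by (intro eventually_ball_finite) (unfold tendsto_padic_iff_less, blast+)
    with bound show "\<forall>\<^sub>F N in F. padic_norm (infsum (f N) A - infsum g A) < e"
    proof eventually_elim
      case (elim N)
      have sf: "f N summable_on A"
        by (intro padic_summable_onI finite_norm_ge_le[OF fin]) (use elim in auto)
      have "padic_norm (infsum (\<lambda>x. f N x - g x) A) \<le> e / 2"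
      proof (rule padic_norm_infsum_le)
        fix x assume x: "x \<in> A"
        show "padic_norm (f N x - g x) \<le> e / 2"
        proof (cases "x \<in> S")
          case False
          hence "B x \<le> e / 2" using x by (auto simp: S_def)
          with elim(1) gB[OF x] x show ?thesis by (intro padic_norm_diff_le) (fastforce intro: order.trans)+
        qed (use elim(2) in \<open>auto intro: less_imp_le\<close>)
      qed (use e in auto)
      thus ?case using e by (simp add: padic_infsum_diff[OF sf sg])
    qed
  qed
qed auto

lemma finite_nat_ge_of_tendsto_0:
  fixes B :: "nat \<Rightarrow> real"
  assumes "B \<longlonglongrightarrow> 0" "e > 0"
  shows "finite {x\<in>A. B x \<ge> e}"
proof -
  obtain N where "\<And>n. n \<ge> N \<Longrightarrow> B n < e"
    using order_tendstoD(2)[OF assms] by (auto simp: eventually_sequentially)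
  hence "{x\<in>A. B x \<ge> e} \<subseteq> {..<N}" by (auto simp: not_le[symmetric])
  thus ?thesis by (rule finite_subset) auto
qed

text \<open>Approximate \<open>x\<close> by a reduced fraction \<open>a / b\<close>. Its norm is at
  most 1, so \<open>p\<close> does not divide \<open>b\<close>, and \<open>b\<close> can be inverted
  modulo \<open>p^k\<close>; the natural number is the residue of \<open>a\<close> times this
  inverse.\<close>

lemma padic_integers_nat_dense:
  fixes x :: "'p::prime_card padic"
  assumes x: "x \<in> padic_integers"
  obtains n :: nat where "padic_norm (x - of_nat n) \<le> 1 / real CARD('p) ^ k"
proof -
  let ?P = "int CARD('p)"
  have pos: "1 / real CARD('p) ^ k > 0" using CARD_pos[where 'p='p] by simp
  have le1: "1 / real CARD('p) ^ k \<le> 1" using CARD_gt_1[where 'p='p] by simp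
  obtain q where q: "padic_norm (x - of_rat q) < 1 / real CARD('p) ^ k"
    using padic_rat_dense[OF pos] by blast
  have nq: "padic_norm (of_rat q :: 'p padic) \<le> 1"
    using padic_norm_diff_le[of x 1 "x - of_rat q"] x q le1 by (simp add: padic_integers_def)
  obtain a b where ab: "quotient_of q = (a, b)" by fastforce
  have b: "b > 0" "coprime a b" using quotient_of_denom_pos[OF ab] quotient_of_coprime[OF ab] by auto
  have qab: "q = of_int a / of_int b" by (rule quotient_of_div[OF ab])
  have qb: "(of_rat q :: 'p padic) * of_int b = of_int a"
    using b qab by (simp add: of_rat_divide)
  have "\<not> ?P dvd b"
  proof
    assume d: "?P dvd b"
    hence "\<not> ?P dvd a" using b(2) prime_card[where 'a='p] 
      by (metis coprime_common_divisor not_prime_unit prime_nat_int_transfer)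
    hence "1 = padic_norm (of_rat q :: 'p padic) * padic_norm (of_int b :: 'p padic)"
      using padic_norm_of_int_eq_1_iff[of a, where 'p='p] by (simp flip: padic_norm_mult add: qb)
    also have "\<dots> \<le> 1 * padic_norm (of_int b :: 'p padic)" by (intro mult_right_mono nq) simp
    also have "\<dots> < 1" using d padic_norm_of_int_less_1_iff[of b, where 'p='p] by simp
    finally show False by simp
  qed
  hence nb: "padic_norm (of_int b :: 'p padic) = 1" by (simp add: padic_norm_of_int_eq_1_iff)
  have "coprime b (?P ^ k)" using \<open>\<not> ?P dvd b\<close> prime_card[where 'a='p]
    by (metis coprime_commute coprime_power_right_iff prime_imp_coprime prime_nat_int_transfer)
  then obtain c where c: "[b * c = 1] (mod ?P ^ k)" using cong_solve_coprime_int by blast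
  define n where "n = nat ((a * c) mod ?P ^ k)"
  have n: "int n = (a * c) mod ?P ^ k" using CARD_pos[where 'p='p] by (simp add: n_def)
  have "[b * int n = b * (a * c)] (mod ?P ^ k)" unfolding n by (simp add: cong_def mod_mult_right_eq)
  also have "[b * (a * c) = a * (b * c)] (mod ?P ^ k)" by (simp add: algebra_simps)
  also have "[a * (b * c) = a * 1] (mod ?P ^ k)" by (intro cong_mult c) auto
  finally have "?P ^ k dvd a - b * int n" by (simp add: cong_iff_dvd_diff dvd_diff_commute)
  hence "padic_norm (of_int (a - b * int n) :: 'p padic) \<le> 1 / real CARD('p) ^ k"
    by (simp only: padic_norm_of_int_le_iff)
  also have "of_int (a - b * int n) = (of_rat q - of_nat n) * (of_int b :: 'p padic)"
    by (simp add: qb[symmetric] algebra_simps)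
  also have "padic_norm \<dots> = padic_norm (of_rat q - of_nat n :: 'p padic)" by (simp add: padic_norm_mult nb)
  finally have "padic_norm ((x - of_rat q) + (of_rat q - of_nat n)) \<le> 1 / real CARD('p) ^ k"
    using q by (intro padic_norm_add_le) auto
  thus ?thesis using that[of n] by simp
qed

text \<open>Both sequences are bounded, so a large product forces both factors to be large. This
  makes the double family behind a product of two power series summable.\<close>

lemma finite_nat_prod_ge:
  fixes a b :: "nat \<Rightarrow> real"
  assumes a: "a \<longlonglongrightarrow> 0" and b: "b \<longlonglongrightarrow> 0" and a0: "\<And>n. a n \<ge> 0" and b0: "\<And>n. b n \<ge> 0" and e: "e > 0"
  shows "finite {(i,j). a i * b j \<ge> e}"
proof -
  obtain K where K: "K > 0" "\<And>n. \<bar>a n\<bar> \<le> K"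
    using convergent_imp_Bseq[OF convergentI[OF a]] by (auto simp: Bseq_def)
  obtain L where L: "L > 0" "\<And>n. \<bar>b n\<bar> \<le> L"
    using convergent_imp_Bseq[OF convergentI[OF b]] by (auto simp: Bseq_def)
  have "{(i,j). a i * b j \<ge> e} \<subseteq> {i\<in>UNIV. a i \<ge> e / L} \<times> {j\<in>UNIV. b j \<ge> e / K}"
  proof (clarify, intro SigmaI CollectI conjI UNIV_I)
    fix i j assume ij: "e \<le> a i * b j"
    have "a i * b j \<le> a i * L" using L(2)[of j] a0 by (intro mult_left_mono) auto
    with ij show "e / L \<le> a i" using L(1) by (simp add: field_simps)
    have "a i * b j \<le> K * b j" using K(2)[of i] b0 by (intro mult_right_mono) auto
    with ij show "e / K \<le> b j" using K(1) by (simp add: field_simps)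
  qed
  thus ?thesis using e K L
    by (elim finite_subset) (intro finite_cartesian_product finite_nat_ge_of_tendsto_0 a b; simp)
qed

section \<open>Evaluation of convergent power series\<close>

text \<open>Over a complete ultrametric field, terms tending to zero already mean that the series
  converges, unconditionally.\<close>

definition fps_conv :: "'p::prime_card padic fps \<Rightarrow> 'p padic \<Rightarrow> bool" where
  "fps_conv F x \<longleftrightarrow> (\<lambda>n. fps_nth F n * x ^ n) \<longlonglongrightarrow> 0"

definition fps_val :: "'p::prime_card padic fps \<Rightarrow> 'p padic \<Rightarrow> 'p padic" where
  "fps_val F x = (\<Sum>\<^sub>\<infinity>n. fps_nth F n * x ^ n)"

lemma fps_conv_has_sum:
  "fps_conv F x \<Longrightarrow> ((\<lambda>n. fps_nth F n * x ^ n) has_sum fps_val F x) UNIV"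
  unfolding fps_conv_def fps_val_def by (intro has_sum_infsum padic_summable_on_natI)

text \<open>The array of products is summable as a whole. Summed by rows it gives the product of the
  values, summed along the diagonals the Cauchy product.\<close>

lemma fps_val_mult:
  fixes F G :: "'p::prime_card padic fps"
  assumes F: "fps_conv F x" and G: "fps_conv G x"
  shows "fps_val (F * G) x = fps_val F x * fps_val G x" (is ?th1)
    and "((\<lambda>n. fps_nth (F * G) n * x ^ n) has_sum fps_val F x * fps_val G x) UNIV" (is ?th2)
proof -
  define f where "f = (\<lambda>i. fps_nth F i * x ^ i)"
  define g where "g = (\<lambda>i. fps_nth G i * x ^ i)"
  define h where "h = (\<lambda>(i,j). f i * g j)"
  have f0: "(\<lambda>i. padic_norm (f i)) \<longlonglongrightarrow> 0" and g0: "(\<lambda>i. padic_norm (g i)) \<longlonglongrightarrow> 0"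
    using F G tendsto_padic_norm[of _ 0] unfolding fps_conv_def f_def g_def by fastforce+
  have hs: "h summable_on (UNIV \<times> UNIV)"
  proof (rule padic_summable_onI)
    fix e :: real assume "e > 0"
    have "{x \<in> UNIV \<times> UNIV. e \<le> padic_norm (h x)} = {(i,j). padic_norm (f i) * padic_norm (g j) \<ge> e}"
      by (auto simp: h_def padic_norm_mult)
    thus "finite {x \<in> UNIV \<times> UNIV. e \<le> padic_norm (h x)}"
      using finite_nat_prod_ge[OF f0 g0 _ _ \<open>e > 0\<close>] by simp
  qed
  then obtain S where S: "(h has_sum S) (UNIV \<times> UNIV)" by (auto simp: summable_on_def)
  have fs: "(f has_sum fps_val F x) UNIV" and gs: "(g has_sum fps_val G x) UNIV"
    using fps_conv_has_sum[OF F] fps_conv_has_sum[OF G] by (simp_all add: f_def g_def)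
  have "((\<lambda>i. f i * fps_val G x) has_sum S) UNIV"
    by (rule has_sum_SigmaD[OF S]) (auto simp: h_def intro!: has_sum_cmult_right gs)
  moreover have "((\<lambda>i. f i * fps_val G x) has_sum fps_val F x * fps_val G x) UNIV"
    by (intro has_sum_cmult_left fs)
  ultimately have S_eq: "S = fps_val F x * fps_val G x" by (rule has_sum_unique)
  \<comment> \<open>The pair \<open>(i, j)\<close> is renamed to \<open>(i + j, i)\<close>, which
    groups the array by diagonals.\<close>
  have "((\<lambda>(n,i). f i * g (n - i)) has_sum S) (Sigma UNIV (\<lambda>n. {..n}))"
  proof (rule has_sum_reindex_bij_witness[THEN iffD1, OF _ _ _ _ _ _ S])
    show "(\<lambda>(n,i). (i, n - i)) b \<in> UNIV \<times> UNIV" for b :: "nat \<times> nat" by auto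
    show "(\<lambda>(i,j). (i + j, i)) ((\<lambda>(n,i). (i, n - i)) b) = b" if "b \<in> Sigma UNIV (\<lambda>n. {..n})" for b :: "nat \<times> nat"
      using that by auto
    show "(\<lambda>(n,i). (i, n - i)) ((\<lambda>(i,j). (i + j, i)) a) = a" for a :: "nat \<times> nat" by (cases a) auto
  qed (auto simp: h_def)
  hence "((\<lambda>n. \<Sum>i\<le>n. f i * g (n - i)) has_sum S) UNIV"
    by (rule has_sum_SigmaD) (auto intro!: has_sum_finiteI)
  also have "(\<lambda>n. \<Sum>i\<le>n. f i * g (n - i)) = (\<lambda>n. fps_nth (F * G) n * x ^ n)"
    by (auto simp: fun_eq_iff fps_mult_nth atMost_atLeast0 f_def g_def sum_distrib_left sum_distrib_right
       power_add[symmetric] mult.assoc mult.left_commute intro!: sum.cong)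
  finally show ?th2 by (simp add: S_eq)
  thus ?th1 unfolding fps_val_def by (rule infsumI)
qed

section \<open>Sums over units\<close>

text \<open>The class of integrands whose Riemann sums stay bounded. Values at multiples of
  \<open>p\<close> are unconstrained, since the sums only run over integers prime to
  \<open>p\<close>.\<close>

definition unit_lip :: "(int \<Rightarrow> 'p::prime_card padic) \<Rightarrow> bool" where
  "unit_lip h \<longleftrightarrow> (\<forall>a. \<not> int CARD('p) dvd a \<longrightarrow> padic_norm (h a) \<le> 1) \<and>
     (\<forall>a b. \<not> int CARD('p) dvd a \<longrightarrow> \<not> int CARD('p) dvd b \<longrightarrow>
        padic_norm (h a - h b) \<le> padic_norm (of_int (a - b) :: 'p padic))"

definition unit_sum :: "(int \<Rightarrow> 'p::prime_card padic) \<Rightarrow> nat \<Rightarrow> 'p padic" where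
  "unit_sum h N = (\<Sum>a | a < CARD('p) ^ N \<and> coprime a CARD('p). h (int a))"

text \<open>The Volkenborn integral of \<open>h\<close> over the \<open>p\<close>-adic units.\<close>

definition has_volk :: "(int \<Rightarrow> 'p::prime_card padic) \<Rightarrow> 'p padic \<Rightarrow> bool" where
  "has_volk h v \<longleftrightarrow> (\<lambda>N. unit_sum h N / of_nat CARD('p) ^ N) \<longlonglongrightarrow> v"

lemma unit_lipD:
  "unit_lip (h :: int \<Rightarrow> 'p::prime_card padic) \<Longrightarrow> \<not> int CARD('p) dvd a \<Longrightarrow> padic_norm (h a) \<le> 1"
  "unit_lip (h :: int \<Rightarrow> 'p::prime_card padic) \<Longrightarrow> \<not> int CARD('p) dvd a \<Longrightarrow> \<not> int CARD('p) dvd b \<Longrightarrow>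
     padic_norm (h a - h b) \<le> padic_norm (of_int (a - b) :: 'p padic)"
  unfolding unit_lip_def by auto

lemma unit_lip_const: "padic_norm (c :: 'p::prime_card padic) \<le> 1 \<Longrightarrow> unit_lip (\<lambda>_. c)"
  by (simp add: unit_lip_def)

lemma unit_lip_of_int: "unit_lip (of_int :: int \<Rightarrow> 'p::prime_card padic)"
  by (simp add: unit_lip_def)

lemma unit_lip_add:
  "unit_lip (f :: int \<Rightarrow> 'p::prime_card padic) \<Longrightarrow> unit_lip g \<Longrightarrow> unit_lip (\<lambda>a. f a + g a)"
  unfolding unit_lip_def add_diff_add by (auto intro!: padic_norm_add_le)

lemma unit_lip_mult:
  fixes f g :: "int \<Rightarrow> 'p::prime_card padic"
  assumes f: "unit_lip f" and g: "unit_lip g"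
  shows "unit_lip (\<lambda>a. f a * g a)"
  unfolding unit_lip_def
proof (intro conjI allI impI)
  fix a b assume a: "\<not> int CARD('p) dvd a" and b: "\<not> int CARD('p) dvd b"
  have "f a * g a - f b * g b = f a * (g a - g b) + (f a - f b) * g b" by (simp add: algebra_simps)
  also have "padic_norm \<dots> \<le> padic_norm (of_int (a - b) :: 'p padic)"
    using padic_norm_mult_le[OF unit_lipD(1)[OF f a] unit_lipD(2)[OF g a b]]
      padic_norm_mult_le[OF unit_lipD(2)[OF f a b] unit_lipD(1)[OF g b]]
    by (intro padic_norm_add_le) auto
  finally show "padic_norm (f a * g a - f b * g b) \<le> padic_norm (of_int (a - b) :: 'p padic)" .
next
  fix a assume a: "\<not> int CARD('p) dvd a"
  show "padic_norm (f a * g a) \<le> 1"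
    using padic_norm_mult_le[OF unit_lipD(1)[OF f a] unit_lipD(1)[OF g a]] by simp
qed

lemma unit_lip_power: "unit_lip (f :: int \<Rightarrow> 'p::prime_card padic) \<Longrightarrow> unit_lip (\<lambda>a. f a ^ n)"
  by (induction n) (auto intro!: unit_lip_mult simp: unit_lip_const)

lemma unit_lip_sum:
  "(\<And>i. i \<in> I \<Longrightarrow> unit_lip (f i :: int \<Rightarrow> 'p::prime_card padic)) \<Longrightarrow> unit_lip (\<lambda>a. \<Sum>i\<in>I. f i a)"
  by (induction I rule: infinite_finite_induct) (auto intro!: unit_lip_add simp: unit_lip_const)

lemma unit_lip_inverse:
  fixes f :: "int \<Rightarrow> 'p::prime_card padic"
  assumes f: "unit_lip f" and u: "\<And>a. \<not> int CARD('p) dvd a \<Longrightarrow> padic_norm (f a) = 1"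
  shows "unit_lip (\<lambda>a. inverse (f a))"
  unfolding unit_lip_def
proof (intro conjI allI impI)
  fix a b assume a: "\<not> int CARD('p) dvd a" and b: "\<not> int CARD('p) dvd b"
  have nz: "f a \<noteq> 0" "f b \<noteq> 0" using u[OF a] u[OF b] by auto
  hence "inverse (f a) - inverse (f b) = (f b - f a) / (f a * f b)" by (simp add: field_simps)
  hence "padic_norm (inverse (f a) - inverse (f b)) = padic_norm (f a - f b)"
    using u[OF a] u[OF b] by (simp add: padic_norm_divide padic_norm_mult padic_norm_minus_commute[of "f a"])
  thus "padic_norm (inverse (f a) - inverse (f b)) \<le> padic_norm (of_int (a - b) :: 'p padic)"
    using unit_lipD(2)[OF f a b] by simp
qed (use u in \<open>simp add: padic_norm_inverse\<close>)

lemma unit_lip_inverse_power: "unit_lip (\<lambda>a. inverse (of_int a) ^ j :: 'p::prime_card padic)"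
  by (intro unit_lip_power unit_lip_inverse unit_lip_of_int) (simp add: padic_norm_of_int_eq_1_iff)

text \<open>For \<open>a\<close> and \<open>b\<close> incongruent modulo \<open>p\<close> the norm
  of \<open>a - b\<close> is 1, and boundedness alone gives the Lipschitz estimate.\<close>

lemma unit_lip_periodic:
  fixes f :: "int \<Rightarrow> 'p::prime_card padic"
  assumes "\<And>a. \<not> int CARD('p) dvd a \<Longrightarrow> padic_norm (f a) \<le> 1"
    and "\<And>a b. [a = b] (mod int CARD('p)) \<Longrightarrow> f a = f b"
  shows "unit_lip f"
  unfolding unit_lip_def
proof (intro conjI allI impI assms(1))
  fix a b assume a: "\<not> int CARD('p) dvd a" and b: "\<not> int CARD('p) dvd b"
  show "padic_norm (f a - f b) \<le> padic_norm (of_int (a - b) :: 'p padic)"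
  proof (cases "int CARD('p) dvd a - b")
    case True
    thus ?thesis using assms(2)[of a b] by (simp add: cong_iff_dvd_diff)
  next
    case False
    hence "padic_norm (of_int (a - b) :: 'p padic) = 1" by (simp only: padic_norm_of_int_eq_1_iff) simp
    thus ?thesis using assms(1)[OF a] assms(1)[OF b] by (metis padic_norm_diff_le)
  qed
qed

lemma coprime_CARD_iff: "coprime a CARD('p::prime_card) \<longleftrightarrow> \<not> int CARD('p) dvd int a"
  using padic_norm_of_nat_eq_1_iff[of a, where 'p='p] padic_norm_of_int_eq_1_iff[of "int a", where 'p='p]
  by simp

lemma unit_sum_0 [simp]: "unit_sum (h :: int \<Rightarrow> 'p::prime_card padic) 0 = 0"
  using prime_gt_1_nat[OF prime_card[where 'a='p]] unfolding unit_sum_def by (intro sum.neutral) auto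

text \<open>Numbers below \<open>p^(N+1)\<close> are split as \<open>a + c p^N\<close>; for
  \<open>N \<ge> 1\<close> coprimality to \<open>p\<close> depends on \<open>a\<close> only.\<close>

lemma sum_coprime_blocks:
  fixes f :: "nat \<Rightarrow> 'a::comm_monoid_add"
  assumes N: "N \<ge> 1" and p: "p > 0"
  shows "(\<Sum>a | a < p ^ Suc N \<and> coprime a p. f a) =
         (\<Sum>c<p. \<Sum>a | a < p ^ N \<and> coprime a p. f (a + c * p ^ N))"
proof -
  have cop: "coprime (a + c * p ^ N) p \<longleftrightarrow> coprime a p" for a c
  proof -
    obtain M where "N = Suc M" using N by (cases N) auto
    hence "a + c * p ^ N = a + (c * p ^ M) * p" by simp
    thus ?thesis by (metis coprime_commute coprime_iff_gcd_eq_1 gcd_add_mult add.commute mult.commute)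
  qed
  have P: "p ^ N > 0" using p by simp
  have "(\<Sum>c<p. \<Sum>a | a < p ^ N \<and> coprime a p. f (a + c * p ^ N)) =
        (\<Sum>(c,a)\<in>{..<p} \<times> {a. a < p ^ N \<and> coprime a p}. f (a + c * p ^ N))"
    by (rule sum.cartesian_product)
  also have "\<dots> = (\<Sum>a | a < p ^ Suc N \<and> coprime a p. f a)"
  proof (rule sum.reindex_bij_witness[of _ "\<lambda>a. (a div p ^ N, a mod p ^ N)" "\<lambda>(c,a). a + c * p ^ N"])
    fix x assume x: "x \<in> {..<p} \<times> {a. a < p ^ N \<and> coprime a p}"
    obtain c a where ca: "x = (c, a)" "c < p" "a < p ^ N" "coprime a p" using x by auto
    have "a + c * p ^ N < p ^ N + c * p ^ N" using ca by simp
    also have "\<dots> = Suc c * p ^ N" by simp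
    also have "\<dots> \<le> p * p ^ N" using ca by (intro mult_right_mono) auto
    finally show "(case x of (c, a) \<Rightarrow> a + c * p ^ N) \<in> {a. a < p ^ Suc N \<and> coprime a p}"
      using ca cop by simp
    show "((case x of (c, a) \<Rightarrow> a + c * p ^ N) div p ^ N, (case x of (c, a) \<Rightarrow> a + c * p ^ N) mod p ^ N) = x"
      using ca by simp
  next
    fix a assume a: "a \<in> {a. a < p ^ Suc N \<and> coprime a p}"
    show "(case (a div p ^ N, a mod p ^ N) of (c, a) \<Rightarrow> a + c * p ^ N) = a" by (simp add: mod_div_mult_eq)
    show "(a div p ^ N, a mod p ^ N) \<in> {..<p} \<times> {a. a < p ^ N \<and> coprime a p}"
      using a P cop[of "a mod p ^ N" "a div p ^ N"] unfolding mod_div_mult_eq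
      by (auto simp: less_mult_imp_div_less)
  qed auto
  finally show ?thesis by simp
qed

text \<open>Replacing \<open>a + c p^N\<close> by \<open>a\<close> changes a term by at most
  \<open>p^(-N)\<close>, and after the replacement level \<open>N + 1\<close> is \<open>p\<close>
  times level \<open>N\<close>. The recursion effectively starts at \<open>N = 1\<close> with the
  bound 1, which accounts for the extra factor \<open>p\<close>.\<close>

lemma unit_sum_lip_le:
  fixes h :: "int \<Rightarrow> 'p::prime_card padic"
  assumes h: "unit_lip h"
  shows "padic_norm (unit_sum h N) \<le> real CARD('p) / real CARD('p) ^ N"
proof (induction N)
  case 0
  thus ?case by simp
next
  case (Suc N)
  define p where "p = CARD('p)"
  have p0: "p > 0" "real p > 0" using CARD_pos[where 'p='p] by (simp_all add: p_def)
  show ?case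
  proof (cases "N = 0")
    case True
    have "padic_norm (unit_sum h 1) \<le> 1" unfolding unit_sum_def
      by (intro padic_norm_sum_le unit_lipD(1)[OF h]) (auto simp: coprime_CARD_iff)
    thus ?thesis using True p0 by (simp add: p_def)
  next
    case False
    let ?U = "{a. a < p ^ N \<and> coprime a p}"
    have "unit_sum h (Suc N) = (\<Sum>c<p. \<Sum>a\<in>?U. h (int (a + c * p ^ N)))"
      unfolding unit_sum_def using sum_coprime_blocks[of N p "\<lambda>a. h (int a)"] False p0 by (simp add: p_def)
    also have "\<dots> = (\<Sum>c<p. \<Sum>a\<in>?U. (h (int (a + c * p ^ N)) - h (int a))) + of_nat p * unit_sum h N"
      unfolding unit_sum_def sum_subtractf p_def by simp
    also have "padic_norm \<dots> \<le> 1 / real p ^ N"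
    proof (intro padic_norm_add_le padic_norm_sum_le)
      fix c a assume a: "a \<in> ?U"
      have "int p dvd int c * int p ^ N" using False by simp
      hence "\<not> int p dvd int a + int c * int p ^ N"
        using a coprime_CARD_iff[of a, where 'p='p] by (simp add: p_def dvd_add_left_iff)
      hence "padic_norm (h (int (a + c * p ^ N)) - h (int a)) \<le> padic_norm (of_int (int (a + c * p ^ N) - int a) :: 'p padic)"
        using a by (intro unit_lipD(2)[OF h]) (auto simp: p_def coprime_CARD_iff)
      also have "\<dots> \<le> 1 / real p ^ N" unfolding p_def padic_norm_of_int_le_iff by simp
      finally show "padic_norm (h (int (a + c * p ^ N)) - h (int a)) \<le> 1 / real p ^ N" .
    next
      have "padic_norm (of_nat p * unit_sum h N) \<le> (1 / real p) * (real p / real p ^ N)"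
        using Suc.IH by (intro padic_norm_mult_le) (auto simp: p_def)
      thus "padic_norm (of_nat p * unit_sum h N) \<le> 1 / real p ^ N" using p0 by simp
    qed auto
    finally show ?thesis using p0 by (simp add: p_def)
  qed
qed

lemma unit_sum_lip_le':
  fixes h :: "int \<Rightarrow> 'p::prime_card padic"
  assumes h: "unit_lip h"
  shows "padic_norm (unit_sum h N / of_nat CARD('p) ^ N) \<le> real CARD('p)"
  using unit_sum_lip_le[OF h, of N] CARD_pos[where 'p='p]
  by (simp add: padic_norm_divide field_simps)

section \<open>Linearity of the integral and termwise integration\<close>

lemma unit_sum_cong:
  "(\<And>a. \<not> int CARD('p) dvd a \<Longrightarrow> f a = g a) \<Longrightarrow> unit_sum f N = unit_sum (g :: int \<Rightarrow> 'p::prime_card padic) N"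
  unfolding unit_sum_def by (intro sum.cong) (auto simp: coprime_CARD_iff)

lemma has_volk_cong:
  "(\<And>a. \<not> int CARD('p) dvd a \<Longrightarrow> f a = g a) \<Longrightarrow> has_volk f v \<longleftrightarrow> has_volk (g :: int \<Rightarrow> 'p::prime_card padic) v"
  unfolding has_volk_def using unit_sum_cong[of f g] by simp

lemma has_volk_sum:
  fixes f :: "'i \<Rightarrow> int \<Rightarrow> 'p::prime_card padic"
  assumes "\<And>i. i \<in> I \<Longrightarrow> has_volk (f i) (v i)"
  shows "has_volk (\<lambda>a. \<Sum>i\<in>I. f i a) (\<Sum>i\<in>I. v i)"
proof -
  have "unit_sum (\<lambda>a. \<Sum>i\<in>I. f i a) N = (\<Sum>i\<in>I. unit_sum (f i) N)" for N
    unfolding unit_sum_def by (rule sum.swap)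
  thus ?thesis using assms unfolding has_volk_def by (simp add: sum_divide_distrib tendsto_sum)
qed

lemma unit_sum_cmult: "unit_sum (\<lambda>a. c * f a) N = c * unit_sum (f :: int \<Rightarrow> 'p::prime_card padic) N"
  by (simp add: unit_sum_def sum_distrib_left)

lemma has_volk_cmult:
  fixes f :: "int \<Rightarrow> 'p::prime_card padic"
  shows "has_volk f v \<Longrightarrow> has_volk (\<lambda>a. c * f a) (c * v)"
  unfolding has_volk_def unit_sum_cmult times_divide_eq_right[symmetric] by (intro tendsto_mult_padic) auto

lemma has_volk_bound:
  fixes h :: "int \<Rightarrow> 'p::prime_card padic"
  assumes "has_volk h v" "\<And>N. padic_norm (unit_sum h N / of_nat CARD('p) ^ N) \<le> B"
  shows "padic_norm v \<le> B"
  by (rule padic_norm_limit_le[OF assms(1)[unfolded has_volk_def]]) (use assms(2) in auto)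

lemma has_volk_unique: "has_volk h v \<Longrightarrow> has_volk h w \<Longrightarrow> v = (w :: 'p::prime_card padic)"
  unfolding has_volk_def by (rule LIMSEQ_unique)

lemma has_sum_sum:
  fixes f :: "'i \<Rightarrow> 'a \<Rightarrow> 'b::topological_comm_monoid_add"
  shows "(\<And>i. i \<in> I \<Longrightarrow> (f i has_sum s i) A) \<Longrightarrow> ((\<lambda>x. \<Sum>i\<in>I. f i x) has_sum (\<Sum>i\<in>I. s i)) A"
  by (induction I rule: infinite_finite_induct) (auto intro!: has_sum_add)

text \<open>At each finite level a finite sum is exchanged with the series; the limit over levels is
  then taken by dominated convergence. This is why \<open>B k\<close> must bound the Riemann sums of
  \<open>g k\<close> for all \<open>N\<close> at once, not just the integral.\<close>

lemma has_volk_has_sum: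
  fixes g :: "nat \<Rightarrow> int \<Rightarrow> 'p::prime_card padic"
  assumes h: "\<And>a. \<not> int CARD('p) dvd a \<Longrightarrow> ((\<lambda>k. g k a) has_sum h a) UNIV"
    and v: "\<And>k. has_volk (g k) (v k)"
    and b: "\<And>k N. padic_norm (unit_sum (g k) N / of_nat CARD('p) ^ N) \<le> B k"
    and B: "B \<longlonglongrightarrow> 0"
  shows "(v has_sum infsum v UNIV) UNIV" and "has_volk h (infsum v UNIV)"
proof -
  have "v \<longlonglongrightarrow> 0"
    by (rule tendsto_0_padicI[OF _ B]) (use has_volk_bound[OF v b] in auto)
  thus "(v has_sum infsum v UNIV) UNIV"
    by (intro has_sum_infsum padic_summable_on_natI)
  have "unit_sum h N / of_nat CARD('p) ^ N = (\<Sum>\<^sub>\<infinity>k. unit_sum (g k) N / of_nat CARD('p) ^ N)" for N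
  proof -
    have "((\<lambda>k. \<Sum>a | a < CARD('p) ^ N \<and> coprime a CARD('p). g k (int a)) has_sum unit_sum h N) UNIV"
      unfolding unit_sum_def by (intro has_sum_sum h) (auto simp: coprime_CARD_iff)
    hence "((\<lambda>k. unit_sum (g k) N * inverse (of_nat CARD('p) ^ N)) has_sum unit_sum h N * inverse (of_nat CARD('p) ^ N)) UNIV"
      unfolding unit_sum_def by (rule has_sum_cmult_left)
    thus ?thesis by (simp add: divide_inverse infsumI)
  qed
  thus "has_volk h (infsum v UNIV)"
    unfolding has_volk_def
    by (simp only:) (rule tendsto_padic_infsum[where B=B], use v b finite_nat_ge_of_tendsto_0[OF B, of _ UNIV] in \<open>auto simp: has_volk_def\<close>)
qed

lemma power_sum_factor_odd:
  fixes x y :: "'a::comm_ring_1"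
  assumes "odd j"
  shows "x ^ j + y ^ j = (x + y) * (\<Sum>i<j. (- y) ^ (j - Suc i) * x ^ i)"
  using power_diff_sumr2[of x j "- y"] assms by simp

text \<open>The two members of a pair add up to a multiple of \<open>p^N\<close>, which cancels the
  denominator. What remains is an undivided sum of a Lipschitz function, and such sums tend to zero
  with \<open>N\<close>; the factor 2 from counting pairs twice is a unit.\<close>

lemma has_volk_inverse_power_odd:
  assumes j: "odd j" and p2: "CARD('p::prime_card) \<noteq> 2"
  shows "has_volk (\<lambda>a. inverse (of_int a) ^ j :: 'p padic) 0"
proof -
  define p where "p = CARD('p)"
  have p: "prime p" unfolding p_def by (rule prime_card)
  define h where "h = (\<lambda>a. inverse (of_int a) ^ j :: 'p padic)"
  \<comment> \<open>The cofactor of \<open>p^N\<close> in \<open>a^(-j) + (p^N - a)^(-j)\<close>,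
    from the factorization of \<open>x^j + y^j\<close> for odd \<open>j\<close>. It varies with
    \<open>N\<close>, so it matters that the Lipschitz bound does not.\<close>
  define g where "g = (\<lambda>N a. (\<Sum>i<j. (- of_int (int p ^ N - a)) ^ (j - Suc i) * of_int a ^ i) *
       inverse ((of_int (int p ^ N - a) * of_int a) ^ j) :: 'p padic)"
  have nd: "\<not> int p dvd int p ^ N - a \<longleftrightarrow> \<not> int p dvd a" if "N \<ge> 1" for N a
    using that by (cases N) (auto simp: dvd_diff_right_iff algebra_simps dvd_diff_left_iff)
  have gl: "unit_lip (g N)" if N: "N \<ge> 1" for N
  proof -
    have 1: "unit_lip (\<lambda>a. of_int (int p ^ N - a) :: 'p padic)"
      unfolding unit_lip_def
    proof (intro conjI allI impI padic_norm_of_int_le_1)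
      fix a b
      have "of_int (int p ^ N - a) - of_int (int p ^ N - b) = (- of_int (a - b) :: 'p padic)" by simp
      thus "padic_norm (of_int (int p ^ N - a) - of_int (int p ^ N - b) :: 'p padic) \<le> padic_norm (of_int (a - b) :: 'p padic)"
        by (simp only: padic_norm_minus order.refl)
    qed
    have 2: "unit_lip (\<lambda>a. - of_int (int p ^ N - a) :: 'p padic)"
      using unit_lip_mult[OF unit_lip_const[of "-1"] 1] by simp
    have 3: "unit_lip (\<lambda>a. \<Sum>i<j. (- of_int (int p ^ N - a)) ^ (j - Suc i) * of_int a ^ i :: 'p padic)"
      by (rule unit_lip_sum, rule unit_lip_mult; rule unit_lip_power, rule 2 unit_lip_of_int)
    have 4: "unit_lip (\<lambda>a. inverse ((of_int (int p ^ N - a) * of_int a) ^ j) :: 'p padic)"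
    proof (rule unit_lip_inverse)
      show "unit_lip (\<lambda>a. (of_int (int p ^ N - a) * of_int a) ^ j :: 'p padic)"
        by (rule unit_lip_power, rule unit_lip_mult, rule 1, rule unit_lip_of_int)
      fix a assume a: "\<not> int CARD('p) dvd a"
      hence "padic_norm (of_int (int p ^ N - a) :: 'p padic) = 1" "padic_norm (of_int a :: 'p padic) = 1"
        using nd[OF N, of a] by (simp_all only: padic_norm_of_int_eq_1_iff p_def not_False_eq_True)
      thus "padic_norm ((of_int (int p ^ N - a) * of_int a) ^ j :: 'p padic) = 1"
        by (simp only: padic_norm_power padic_norm_mult mult_1_right power_one)
    qed
    show ?thesis unfolding g_def by (rule unit_lip_mult[OF 3 4])
  qed
  have "2 * unit_sum h N / of_nat p ^ N = unit_sum (g N) N" if N: "N \<ge> 1" for N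
  proof -
    let ?U = "{a. a < p ^ N \<and> coprime a p}"
    have cop: "coprime (p ^ N - a) p \<longleftrightarrow> coprime a p" if "a \<le> p ^ N" for a
      using nd[OF N, of "int a"] that coprime_CARD_iff[of a, where 'p='p] coprime_CARD_iff[of "p^N - a", where 'p='p]
      by (simp add: p_def of_nat_diff)
    have pos: "a > 0" if "coprime a p" for a using that p by (cases "a = 0") auto
    have "unit_sum h N = (\<Sum>a\<in>?U. h (int (p ^ N - a)))"
      unfolding unit_sum_def p_def[symmetric]
      by (rule sum.reindex_bij_witness[of _ "\<lambda>a. p ^ N - a" "\<lambda>a. p ^ N - a"]) (auto simp: cop dest: pos)
    hence "2 * unit_sum h N = (\<Sum>a\<in>?U. h (int a) + h (int (p ^ N - a)))"
      by (simp add: sum.distrib unit_sum_def p_def)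
    also have "\<dots> = (\<Sum>a\<in>?U. of_nat p ^ N * g N (int a))"
    proof (rule sum.cong, goal_cases)
      case (2 a)
      hence a: "a < p ^ N" "coprime a p" by auto
      define x y :: "'p padic" where "x = of_int (int a)" and "y = of_int (int p ^ N - int a)"
      have "\<not> int p dvd int a" using a coprime_CARD_iff[of a, where 'p='p] by (simp add: p_def)
      hence nz: "x \<noteq> 0" "y \<noteq> 0" using nd[OF N, of "int a"] unfolding x_def y_def of_int_eq_0_iff by (metis dvd_0_right)+
      have xy: "x + y = of_nat p ^ N" by (simp add: x_def y_def)
      have "h (int a) + h (int (p ^ N - a)) = inverse x ^ j + inverse y ^ j"
        using a by (simp add: h_def x_def y_def of_nat_diff)
      also have "\<dots> = (x ^ j + y ^ j) * inverse ((y * x) ^ j)"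
        using nz by (simp add: field_simps power_mult_distrib)
      also have "\<dots> = of_nat p ^ N * g N (int a)"
        unfolding power_sum_factor_odd[OF j] xy by (simp add: g_def x_def y_def)
      finally show ?case .
    qed auto
    also have "\<dots> = of_nat p ^ N * unit_sum (g N) N" by (simp add: unit_sum_def sum_distrib_left p_def)
    finally show ?thesis using p prime_gt_0_nat[OF p] by (simp add: field_simps)
  qed
  hence eq: "unit_sum h N / of_nat p ^ N = unit_sum (g N) N / 2" if "N \<ge> 1" for N
    using that by (metis nonzero_mult_div_cancel_left times_divide_eq_right zero_neq_numeral)
  have n2: "padic_norm (2 :: 'p padic) = 1"
    using padic_norm_of_nat_eq_1_iff[of 2, where 'p='p] p p2 primes_coprime[of 2 p] by (simp add: p_def)
  show ?thesis unfolding h_def[symmetric] has_volk_def p_def[symmetric]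
  proof (rule tendsto_0_padicI)
    show "\<forall>\<^sub>F N in sequentially. padic_norm (unit_sum h N / of_nat p ^ N) \<le> real p * (1 / real p ^ N)"
      using eventually_ge_at_top[of 1]
    proof eventually_elim
      case (elim N)
      show ?case unfolding eq[OF elim] using unit_sum_lip_le[OF gl[OF elim], of N]
        by (simp add: padic_norm_divide n2 p_def)
    qed
    show "(\<lambda>N. real p * (1 / real p ^ N)) \<longlonglongrightarrow> 0"
      using tendsto_mult_right_zero[OF one_over_CARD_power_tendsto_0[where 'p='p]] by (simp add: p_def)
  qed
qed

section \<open>Binomial series\<close>

text \<open>Binomial coefficients of natural numbers are integers, and the bound passes to limits of
  natural numbers.\<close>

lemma padic_norm_gbinomial_le_1:
  fixes x :: "'p::prime_card padic"
  assumes x: "x \<in> padic_integers"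
  shows "padic_norm (x gchoose k) \<le> 1"
proof -
  have "\<exists>n::nat. padic_norm (x - of_nat n) \<le> 1 / real CARD('p) ^ i" for i
    using padic_integers_nat_dense[OF x] by metis
  then obtain n where n: "\<And>i. padic_norm (x - of_nat (n i)) \<le> 1 / real CARD('p) ^ i" by metis
  have "(\<lambda>i. of_nat (n i) :: 'p padic) \<longlonglongrightarrow> x"
    unfolding tendsto_padic_iff
    by (rule tendsto_sandwich[OF _ _ tendsto_const one_over_CARD_power_tendsto_0[where 'p='p]])
       (use n in \<open>auto simp: padic_norm_minus_commute\<close>)
  hence "(\<lambda>i. of_nat (n i) gchoose k :: 'p padic) \<longlonglongrightarrow> x gchoose k"
    unfolding gbinomial_prod_rev by (intro tendsto_intros tendsto_prod_padic) auto
  thus ?thesis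
    by (rule padic_norm_limit_le) (auto simp: binomial_gbinomial[symmetric])
qed

lemma fps_conv_1 [simp]: "fps_conv 1 (x :: 'p::prime_card padic)"
  and fps_val_1 [simp]: "fps_val 1 x = 1"
proof -
  have "((\<lambda>n. fps_nth 1 n * x ^ n) has_sum 1) UNIV"
    by (rule has_sum_finite_neutralI[of "{0}"]) auto
  thus "fps_val 1 x = 1" by (simp add: fps_val_def infsumI)
  show "fps_conv 1 x" unfolding fps_conv_def
    by (rule tendsto_eventually) (auto simp: eventually_sequentially intro!: exI[of _ 1])
qed

lemma fps_conv_binomial:
  fixes y :: "'p::prime_card padic"
  assumes c: "c \<in> padic_integers" and y: "padic_norm y < 1"
  shows "fps_conv (fps_binomial c) y"
  unfolding fps_conv_def
proof (rule tendsto_0_padicI)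
  show "\<forall>\<^sub>F n in sequentially. padic_norm (fps_nth (fps_binomial c) n * y ^ n) \<le> padic_norm y ^ n"
    using padic_norm_mult_le[OF padic_norm_gbinomial_le_1[OF c] order.refl, of _ "y ^ _"]
    by (simp add: padic_norm_power)
  show "(\<lambda>n. padic_norm y ^ n) \<longlonglongrightarrow> 0" using y by (intro LIMSEQ_power_zero) auto
qed

lemma fps_val_binomial_of_nat: "fps_val (fps_binomial (of_nat j)) y = (1 + y :: 'p::prime_card padic) ^ j"
proof -
  have "((\<lambda>n. fps_nth (fps_binomial (of_nat j)) n * y ^ n) has_sum (\<Sum>n\<le>j. of_nat (j choose n) * y ^ n)) UNIV"
    by (rule has_sum_finite_neutralI[of "{..j}"]) (auto simp: binomial_gbinomial[symmetric])
  thus ?thesis by (simp add: fps_val_def infsumI binomial_ring add.commute[of 1])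
qed

text \<open>The value is found formally: the series for exponents \<open>-j\<close> and
  \<open>j\<close> have product 1, evaluation is multiplicative, and the second series is the finite
  binomial formula.\<close>

lemma binomial_series_neg:
  fixes y :: "'p::prime_card padic"
  assumes y: "padic_norm y < 1"
  shows "((\<lambda>n. ((- of_nat j) gchoose n) * y ^ n) has_sum inverse (1 + y) ^ j) UNIV"
proof -
  have c: "fps_conv (fps_binomial (- of_nat j)) y" "fps_conv (fps_binomial (of_nat j)) y"
    using y by (auto intro!: fps_conv_binomial simp: padic_integers_def)
  have "fps_val (fps_binomial (- of_nat j)) y * fps_val (fps_binomial (of_nat j)) y = 1"
    using fps_val_mult(1)[OF c] by (simp flip: fps_binomial_add_mult)
  hence "fps_val (fps_binomial (- of_nat j)) y = inverse (1 + y) ^ j"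
    unfolding fps_val_binomial_of_nat by (metis inverse_unique mult.commute power_inverse)
  thus ?thesis using fps_conv_has_sum[OF c(1)] by simp
qed

section \<open>The Teichmueller character\<close>

lemma padic_norm_less_1I:
  assumes "padic_norm (x :: 'p::prime_card padic) \<le> 1 / real CARD('p)"
  shows "padic_norm x < 1"
proof -
  have "1 / real CARD('p) < 1" using CARD_gt_1[where 'p='p] by simp
  with assms show ?thesis by linarith
qed

lemma padic_norm_power_diff_le:
  fixes u v :: "'p::prime_card padic"
  assumes "padic_norm u \<le> 1" "padic_norm v \<le> 1"
  shows "padic_norm (u ^ n - v ^ n) \<le> padic_norm (u - v)"
proof -
  have "padic_norm (\<Sum>i<n. v ^ (n - Suc i) * u ^ i) \<le> 1"
    using assms by (intro padic_norm_sum_le) (auto simp: padic_norm_mult padic_norm_power intro!: mult_le_one power_le_one)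
  from padic_norm_mult_le[OF order.refl this, of "u - v"] show ?thesis
    unfolding power_diff_sumr2 by simp
qed

text \<open>The sum is the cofactor of \<open>u - v\<close> in \<open>u^n - v^n\<close>; it is
  compared with the derivative of the \<open>n\<close>-th power at \<open>v\<close>. Both the
  contraction by \<open>p\<close>-th powers and the separation of roots of unity rest on it.\<close>

lemma sum_powers_near:
  fixes u v :: "'p::prime_card padic"
  assumes u: "padic_norm u \<le> 1" "padic_norm v \<le> 1"
  shows "padic_norm ((\<Sum>i<n. v ^ (n - Suc i) * u ^ i) - of_nat n * v ^ (n - 1)) \<le> padic_norm (u - v)"
proof -
  have "(\<Sum>i<n. v ^ (n - Suc i) * u ^ i) - of_nat n * v ^ (n - 1) =
        (\<Sum>i<n. v ^ (n - Suc i) * (u ^ i - v ^ i))"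
    by (simp add: right_diff_distrib sum_subtractf flip: power_add)
  also have "padic_norm \<dots> \<le> padic_norm (u - v)"
  proof (intro padic_norm_sum_le)
    fix i
    have "padic_norm (v ^ (n - Suc i)) \<le> 1" using u by (simp add: padic_norm_power power_le_one)
    from padic_norm_mult_le[OF this padic_norm_power_diff_le[OF u, of i]]
    show "padic_norm (v ^ (n - Suc i) * (u ^ i - v ^ i)) \<le> padic_norm (u - v)" by simp
  qed auto
  finally show ?thesis .
qed

text \<open>The cofactor of \<open>u - v\<close> is close to \<open>p v^(p-1)\<close>, hence itself
  divisible by \<open>p\<close>: taking \<open>p\<close>-th powers gains one digit.\<close>

lemma padic_norm_power_CARD_diff:
  fixes u v :: "'p::prime_card padic"
  assumes u: "padic_norm u \<le> 1" "padic_norm v \<le> 1" and uv: "padic_norm (u - v) \<le> 1 / real CARD('p) ^ Suc k"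
  shows "padic_norm (u ^ CARD('p) - v ^ CARD('p)) \<le> 1 / real CARD('p) ^ Suc (Suc k)"
proof -
  let ?n = "CARD('p)"
  have "1 / real ?n ^ Suc k \<le> 1 / real ?n"
    using CARD_gt_1[where 'p='p] by (simp add: field_simps)
  hence "padic_norm ((\<Sum>i<?n. v ^ (?n - Suc i) * u ^ i) - of_nat ?n * v ^ (?n - 1)) \<le> 1 / real ?n"
    using sum_powers_near[OF u, of ?n] uv by linarith
  moreover have "padic_norm (of_nat ?n * v ^ (?n - 1)) \<le> 1 / real ?n * 1"
    using u by (intro padic_norm_mult_le) (auto simp: padic_norm_power power_le_one)
  ultimately have "padic_norm (\<Sum>i<?n. v ^ (?n - Suc i) * u ^ i) \<le> 1 / real ?n"
    using padic_norm_add_le[of "(\<Sum>i<?n. v ^ (?n - Suc i) * u ^ i) - of_nat ?n * v ^ (?n - 1)" "1 / real ?n"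
      "of_nat ?n * v ^ (?n - 1)"] by simp
  from padic_norm_mult_le[OF uv this] show ?thesis unfolding power_diff_sumr2 by (simp add: mult.commute)
qed

text \<open>For distinct roots the cofactor of \<open>z - w\<close> would vanish, yet it is close to
  \<open>n w^(n-1)\<close> with \<open>n = p - 1\<close>, which is a unit.\<close>

lemma roots_of_unity_eq:
  fixes z w :: "'p::prime_card padic"
  assumes z: "z ^ (CARD('p) - 1) = 1" and w: "w ^ (CARD('p) - 1) = 1" and zw: "padic_norm (z - w) < 1"
  shows "z = w"
proof (rule ccontr)
  assume ne: "z \<noteq> w"
  define n where "n = CARD('p) - 1"
  have p: "prime CARD('p)" by (rule prime_card)
  have n0: "n > 0" using prime_gt_1_nat[OF p] by (simp add: n_def)
  have norm1: "padic_norm y = 1" if "y ^ n = 1" for y :: "'p padic"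
  proof -
    have "padic_norm y ^ n = 1" using that by (simp flip: padic_norm_power)
    thus ?thesis using n0 by (metis padic_norm_nonneg power_eq_iff_eq_base power_one zero_le_one)
  qed
  have nz: "padic_norm z = 1" "padic_norm w = 1" using norm1 z w by (auto simp: n_def)
  have "(z - w) * (\<Sum>i<n. w ^ (n - Suc i) * z ^ i) = 0"
    using power_diff_sumr2[of z n w] z w by (simp add: n_def)
  hence s0: "(\<Sum>i<n. w ^ (n - Suc i) * z ^ i) = 0" using ne by simp
  have "padic_norm (of_nat n * w ^ (n - 1)) \<le> padic_norm (z - w)"
    using sum_powers_near[of z w n] nz by (simp add: s0)
  moreover have "coprime n CARD('p)"
  proof -
    have "\<not> CARD('p) dvd n" using n0 by (intro nat_dvd_not_less) (auto simp: n_def)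
    thus ?thesis using prime_imp_coprime_nat[OF p] by (simp add: coprime_commute)
  qed
  hence "padic_norm (of_nat n :: 'p padic) = 1" by (simp only: padic_norm_of_nat_eq_1_iff)
  ultimately show False using zw nz by (simp add: padic_norm_mult padic_norm_power)
qed

lemma convergent_padicI:
  fixes X :: "nat \<Rightarrow> 'p::prime_card padic"
  assumes "(\<lambda>n. X (Suc n) - X n) \<longlonglongrightarrow> 0"
  shows "convergent X"
proof -
  obtain S where "(\<lambda>n. X (Suc n) - X n) sums S"
    using summable_on_imp_summable[OF padic_summable_on_natI[OF assms]] by (auto simp: summable_def)
  hence "(\<lambda>n. X n - X 0) \<longlonglongrightarrow> S" by (simp add: sums_def sum_lessThan_telescope)
  from tendsto_add[OF this tendsto_const[of "X 0"]] show ?thesis by (auto simp: convergent_def)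
qed

lemma fermat_int:
  assumes "prime p" shows "int p dvd a ^ p - a"
proof -
  define b where "b = nat (a mod int p)"
  have p0: "p > 0" using assms prime_gt_0_nat by blast
  have b: "[a = int b] (mod int p)" using p0 by (simp add: b_def cong_def)
  have "[b ^ p = b] (mod p)"
  proof (cases "p dvd b")
    case True
    moreover from True have "p dvd b ^ p" using p0 by (cases p) auto
    ultimately show ?thesis by (simp add: cong_def mod_eq_0_iff_dvd[THEN iffD2])
  next
    case False
    have "[b * b ^ (p - 1) = b * 1] (mod p)" by (intro cong_mult fermat_theorem assms False) auto
    thus ?thesis using p0 by (simp add: power_eq_if)
  qed
  hence "[int b ^ p = int b] (mod int p)" by (metis cong_int_iff of_nat_power)
  hence "[a ^ p = a] (mod int p)" using b by (metis cong_pow cong_sym cong_trans)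
  thus ?thesis by (simp add: cong_iff_dvd_diff)
qed

text \<open>The root of unity is the limit of \<open>a^(p^n)\<close>: Fermat's congruence starts the
  sequence, and each \<open>p\<close>-th power gains a digit.\<close>

lemma teichmueller_exists:
  assumes a: "\<not> int CARD('p) dvd a"
  obtains z :: "'p::prime_card padic" where "z ^ (CARD('p) - 1) = 1" "padic_norm (z - of_int a) \<le> 1 / real CARD('p)"
proof -
  define p where "p = CARD('p)"
  have p: "prime p" "p > 0" using prime_card[where 'a='p] prime_gt_0_nat by (auto simp: p_def)
  define X where "X = (\<lambda>n. of_int a ^ (p ^ n) :: 'p padic)"
  have X_Suc: "X (Suc n) = X n ^ p" for n by (simp add: X_def power_mult[symmetric] mult.commute)
  have X1: "padic_norm (X n) = 1" for n
    using a by (simp add: X_def padic_norm_power padic_norm_of_int_eq_1_iff[THEN iffD2])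
  have step: "padic_norm (X (Suc n) - X n) \<le> 1 / real p ^ Suc n" for n
  proof (induction n)
    case 0
    have "padic_norm (of_int (a ^ p - a) :: 'p padic) \<le> 1 / real p ^ 1"
      using fermat_int[OF p(1), of a] unfolding p_def padic_norm_of_int_le_iff by simp
    thus ?case by (simp add: X_def)
  next
    case (Suc n)
    have "padic_norm (X (Suc n) ^ p - X n ^ p) \<le> 1 / real p ^ Suc (Suc n)"
      unfolding p_def by (rule padic_norm_power_CARD_diff) (use Suc X1 in \<open>simp_all add: p_def\<close>)
    thus ?case by (simp only: X_Suc)
  qed
  have "(\<lambda>n. X (Suc n) - X n) \<longlonglongrightarrow> 0"
  proof (rule tendsto_0_padicI)
    show "\<forall>\<^sub>F n in sequentially. padic_norm (X (Suc n) - X n) \<le> 1 / real p ^ Suc n" using step by simp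
    show "(\<lambda>n. 1 / real p ^ Suc n) \<longlonglongrightarrow> 0"
      unfolding p_def by (rule LIMSEQ_Suc[OF one_over_CARD_power_tendsto_0])
  qed
  then obtain z where z: "X \<longlonglongrightarrow> z" using convergent_padicI by (auto simp: convergent_def)
  have near: "padic_norm (X n - of_int a) \<le> 1 / real p" for n
  proof (induction n)
    case (Suc n)
    have "1 / real p ^ Suc n \<le> 1 / real p"
      using CARD_gt_1[where 'p='p] by (simp add: p_def field_simps)
    hence "padic_norm ((X (Suc n) - X n) + (X n - of_int a)) \<le> 1 / real p"
      using step[of n] Suc by (intro padic_norm_add_le) auto
    thus ?case by simp
  qed (simp add: X_def)
  have "(\<lambda>n. X n ^ p) \<longlonglongrightarrow> z ^ p" by (intro tendsto_intros z)
  moreover have "(\<lambda>n. X n ^ p) \<longlonglongrightarrow> z" using LIMSEQ_Suc[OF z] by (simp add: X_Suc)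
  ultimately have "z ^ p = z" by (rule LIMSEQ_unique)
  hence "z * z ^ (p - 1) = z * 1" using p by (simp add: power_eq_if)
  moreover have "padic_norm z = 1"
    using LIMSEQ_unique[OF tendsto_padic_norm[OF z]] X1 by simp
  ultimately have "z ^ (p - 1) = 1" by (metis mult_left_cancel padic_norm_0 zero_neq_one)
  moreover have "padic_norm (z - of_int a) \<le> 1 / real p"
    by (rule padic_norm_limit_le[OF tendsto_diff[OF z tendsto_const]]) (use near in auto)
  ultimately show ?thesis using that by (simp add: p_def)
qed

lemma teichmueller_eqI:
  fixes z :: "'p::prime_card padic"
  assumes "z ^ (CARD('p) - 1) = 1" "padic_norm (z - of_int a) < 1" "\<not> int CARD('p) dvd a"
  shows "teichmueller a = z"
proof -
  have "(THE z :: 'p padic. z ^ (CARD('p) - 1) = 1 \<and> padic_norm (z - of_int a) < 1) = z"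
  proof (rule the_equality)
    fix w :: "'p padic" assume w: "w ^ (CARD('p) - 1) = 1 \<and> padic_norm (w - of_int a) < 1"
    hence "padic_norm ((w - of_int a) - (z - of_int a)) < 1" using assms by (intro padic_norm_diff_less[of "w - _"]) auto
    thus "w = z" using w assms by (auto intro: roots_of_unity_eq[of w z])
  qed (use assms in auto)
  thus ?thesis using assms(3) by (simp add: teichmueller_def)
qed

lemma teichmueller:
  assumes a: "\<not> int CARD('p) dvd a"
  shows "teichmueller a ^ (CARD('p) - 1) = (1 :: 'p::prime_card padic)"
    and "padic_norm (teichmueller a - of_int a :: 'p padic) \<le> 1 / real CARD('p)"
    and "padic_norm (teichmueller a :: 'p padic) = 1"
proof -
  obtain z :: "'p padic" where z: "z ^ (CARD('p) - 1) = 1" "padic_norm (z - of_int a) \<le> 1 / real CARD('p)"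
    using teichmueller_exists[OF a] .
  have eq: "teichmueller a = z" using z a by (intro teichmueller_eqI padic_norm_less_1I)
  show "teichmueller a ^ (CARD('p) - 1) = (1 :: 'p::prime_card padic)"
    and *: "padic_norm (teichmueller a - of_int a :: 'p padic) \<le> 1 / real CARD('p)"
    using z eq by auto
  have "padic_norm (of_int a :: 'p padic) = 1" using a by (simp only: padic_norm_of_int_eq_1_iff not_False_eq_True)
  thus "padic_norm (teichmueller a :: 'p padic) = 1"
    using padic_norm_add_eq[of "teichmueller a - of_int a :: 'p padic" "of_int a"] padic_norm_less_1I[OF *] by simp
qed

lemma teichmueller_eq_0_iff: "teichmueller a = (0 :: 'p::prime_card padic) \<longleftrightarrow> int CARD('p) dvd a"
  using teichmueller(3)[of a, where 'p='p] by (cases "int CARD('p) dvd a") (auto simp: teichmueller_def)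

lemma teichmueller_mult: "teichmueller (a * b) = (teichmueller a * teichmueller b :: 'p::prime_card padic)"
proof (cases "int CARD('p) dvd a \<or> int CARD('p) dvd b")
  case True
  thus ?thesis by (auto simp: teichmueller_def)
next
  case False
  let ?w = "teichmueller :: int \<Rightarrow> 'p padic"
  have nd: "\<not> int CARD('p) dvd a * b"
    using False prime_card[where 'a='p] by (simp add: prime_dvd_mult_iff)
  have "?w a * ?w b - of_int (a * b) = ?w a * (?w b - of_int b) + (?w a - of_int a) * of_int b"
    by (simp add: algebra_simps)
  also have "padic_norm \<dots> \<le> 1 / real CARD('p)"
    using padic_norm_mult_le[of "?w a" 1 "?w b - of_int b" "1 / real CARD('p)"] teichmueller[of a, where 'p='p]
      padic_norm_mult_le[of "?w a - of_int a" "1 / real CARD('p)" "of_int b" 1] teichmueller[of b, where 'p='p] False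
    by (intro padic_norm_add_le) auto
  finally show ?thesis
    using False nd teichmueller(1)[of a, where 'p='p] teichmueller(1)[of b, where 'p='p]
    by (intro teichmueller_eqI padic_norm_less_1I) (auto simp: power_mult_distrib)
qed

lemma teichmueller_cong:
  assumes "[a = b] (mod int CARD('p))"
  shows "teichmueller a = (teichmueller b :: 'p::prime_card padic)"
proof (cases "int CARD('p) dvd b")
  case True
  hence "int CARD('p) dvd a" using assms by (simp add: cong_dvd_iff)
  thus ?thesis using True by (simp add: teichmueller_def)
next
  case False
  hence a: "\<not> int CARD('p) dvd a" using assms by (simp add: cong_dvd_iff)
  have "padic_norm (of_int (b - a) :: 'p padic) \<le> 1 / real CARD('p)"
    using assms unfolding padic_norm_of_int_le_inverse_iff by (simp add: cong_iff_dvd_diff dvd_diff_commute)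
  hence "padic_norm ((teichmueller b - of_int b) + of_int (b - a) :: 'p padic) \<le> 1 / real CARD('p)"
    using teichmueller(2)[OF False] by (intro padic_norm_add_le) auto
  moreover have "(teichmueller b - of_int b) + of_int (b - a) = (teichmueller b - of_int a :: 'p padic)" by simp
  ultimately show ?thesis using a teichmueller(1)[OF False] by (intro teichmueller_eqI padic_norm_less_1I) auto
qed

section \<open>Powers of the Teichmueller character\<close>

text \<open>This is \<open>\<omega>^(-e)\<close>. For \<open>e = 0\<close> the value at multiples of
  \<open>p\<close> is 1 instead of 0, so characters are considered for
  \<open>e \<ge> 1\<close>.\<close>

definition teich_char :: "nat \<Rightarrow> int \<Rightarrow> 'p::prime_card padic" where
  "teich_char e a = inverse (teichmueller a) ^ e"

text \<open>The principal case, kept as a predicate in place of the divisibility of \<open>e\<close>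
  by \<open>p - 1\<close>.\<close>

definition trivial_on_units :: "(int \<Rightarrow> 'p::prime_card padic) \<Rightarrow> bool" where
  "trivial_on_units \<theta> \<longleftrightarrow> (\<forall>a. \<not> int CARD('p) dvd a \<longrightarrow> \<theta> a = 1)"

lemma coprime_int_CARD_iff: "coprime a (int CARD('p::prime_card)) \<longleftrightarrow> \<not> int CARD('p) dvd a"
proof -
  have P: "prime (int CARD('p))" using prime_card[where 'a='p] by simp
  show ?thesis
    using prime_imp_coprime[OF P, of a] not_prime_unit[of "int CARD('p)"] P
    by (metis coprime_absorb_left coprime_commute)
qed

lemma teich_char_norm: "\<not> int CARD('p) dvd a \<Longrightarrow> padic_norm (teich_char e a :: 'p::prime_card padic) = 1"
  by (simp add: teich_char_def padic_norm_power padic_norm_inverse teichmueller)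

lemma teich_char_cong: "[a = b] (mod int CARD('p)) \<Longrightarrow> teich_char e a = (teich_char e b :: 'p::prime_card padic)"
  unfolding teich_char_def by (subst teichmueller_cong) auto

lemma teich_char_mult: "teich_char e (a * b) = (teich_char e a * teich_char e b :: 'p::prime_card padic)"
  by (simp add: teich_char_def teichmueller_mult power_mult_distrib)

lemma teich_char_eq_0_iff: "e \<ge> 1 \<Longrightarrow> teich_char e a = (0 :: 'p::prime_card padic) \<longleftrightarrow> int CARD('p) dvd a"
  by (simp add: teich_char_def teichmueller_eq_0_iff)

lemma dirichlet_teich_char: "e \<ge> 1 \<Longrightarrow> dirichlet_character CARD('p) (teich_char e :: int \<Rightarrow> 'p::prime_card padic)"
  using prime_gt_0_nat[OF prime_card[where 'a='p]]
  by (auto simp: dirichlet_character_def teich_char_mult coprime_int_CARD_iff teich_char_eq_0_iff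
      intro!: teich_char_cong simp: cong_def)

lemma dirichlet_character_1: "dirichlet_character f \<psi> \<Longrightarrow> \<psi> 1 = 1"
  unfolding dirichlet_character_def by (metis coprime_1_left mult_cancel_right1 mult_1)

lemma dirichlet_character_cong:
  assumes d: "dirichlet_character f \<psi>" and ab: "[a = b] (mod int f)"
  shows "\<psi> a = \<psi> b"
proof -
  have per: "\<psi> (a + int f) = \<psi> a" for a using d by (auto simp: dirichlet_character_def)
  have n: "\<psi> (a + int n * int f) = \<psi> a" for n a
    by (induction n) (use per in \<open>auto simp: algebra_simps\<close>, metis add.assoc add.commute per)
  obtain k where k: "b = a + int f * k" using ab by (auto simp: cong_iff_lin)
  show ?thesis
  proof (cases "k \<ge> 0")
    case True
    thus ?thesis using n[of a "nat k"] k by (simp add: mult.commute)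
  next
    case False
    thus ?thesis using n[of b "nat (- k)"] k by (simp add: mult.commute)
  qed
qed

lemma dirichlet_trivial: "dirichlet_character 1 (\<lambda>_. 1 :: 'a::field)"
  by (simp add: dirichlet_character_def)

lemma conductor_eq_1:
  assumes "\<forall>a. \<theta> a \<noteq> 0 \<longrightarrow> \<theta> a = (1 :: 'a::field)"
  shows "conductor \<theta> = 1"
  unfolding conductor_def
proof (rule Least_equality)
  show "\<exists>\<psi>. dirichlet_character 1 \<psi> \<and> (\<forall>a. \<theta> a \<noteq> 0 \<longrightarrow> \<psi> a = \<theta> a)"
    using dirichlet_trivial assms by (intro exI[of _ "\<lambda>_. 1"]) auto
qed (auto simp: dirichlet_character_def)

text \<open>A modulus \<open>f < p\<close> is prime to \<open>p\<close>, so by the Chinese remainder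
  theorem any unit class modulo \<open>p\<close> has a representative that is 1 modulo
  \<open>f\<close>. A character agreeing with \<theta> and periodic modulo \<open>f\<close> then
  forces \<theta> to be trivial on units.\<close>

lemma conductor_teich_char:
  assumes e: "e \<ge> 1"
  shows "conductor (teich_char e :: int \<Rightarrow> 'p::prime_card padic) =
         (if trivial_on_units (teich_char e :: int \<Rightarrow> 'p padic) then 1 else CARD('p))"
proof (cases "trivial_on_units (teich_char e :: int \<Rightarrow> 'p padic)")
  case True
  hence "conductor (teich_char e :: int \<Rightarrow> 'p padic) = 1"
    using e by (intro conductor_eq_1) (auto simp: trivial_on_units_def teich_char_eq_0_iff)
  thus ?thesis using True by simp
next
  case False
  let ?\<theta> = "teich_char e :: int \<Rightarrow> 'p padic"
  have "conductor ?\<theta> = CARD('p)"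
    unfolding conductor_def
  proof (rule Least_equality)
    show "\<exists>\<psi>. dirichlet_character CARD('p) \<psi> \<and> (\<forall>a. ?\<theta> a \<noteq> 0 \<longrightarrow> \<psi> a = ?\<theta> a)"
      using dirichlet_teich_char[OF e] by blast
    fix f assume "\<exists>\<psi>. dirichlet_character f \<psi> \<and> (\<forall>a. ?\<theta> a \<noteq> 0 \<longrightarrow> \<psi> a = ?\<theta> a)"
    then obtain \<psi> where d: "dirichlet_character f \<psi>" and \<psi>: "\<And>a. ?\<theta> a \<noteq> 0 \<Longrightarrow> \<psi> a = ?\<theta> a" by blast
    show "CARD('p) \<le> f"
    proof (rule ccontr)
      assume "\<not> CARD('p) \<le> f"
      hence f: "0 < f" "f < CARD('p)" using d by (auto simp: dirichlet_character_def)
      hence "\<not> int CARD('p) dvd int f" by (auto dest: dvd_imp_le)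
      hence cop: "coprime (int CARD('p)) (int f)" by (simp only: coprime_commute coprime_int_CARD_iff not_False_eq_True)
      have "?\<theta> a = 1" if a: "\<not> int CARD('p) dvd a" for a
      proof -
        obtain x where x: "[x = a] (mod int CARD('p))" "[x = 1] (mod int f)"
          using binary_chinese_remainder_int[OF cop] by blast
        have "?\<theta> a = ?\<theta> x" using x(1) by (intro teich_char_cong) (simp add: cong_sym)
        also have "\<dots> = \<psi> x" using x(1) a e by (intro \<psi>[symmetric]) (simp add: teich_char_eq_0_iff cong_dvd_iff)
        also have "\<dots> = 1" using dirichlet_character_cong[OF d x(2)] dirichlet_character_1[OF d] by simp
        finally show ?thesis .
      qed
      thus False using False by (auto simp: trivial_on_units_def)
    qed
  qed
  thus ?thesis using False by simp
qed

text \<open>The distinction matters at multiples of \<open>p\<close>: in the principal case the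
  primitive character has value 1 there, otherwise 0.\<close>

lemma primitive_teich_char:
  assumes e: "e \<ge> 1"
  shows "primitive_character (teich_char e :: int \<Rightarrow> 'p::prime_card padic) =
         (if trivial_on_units (teich_char e :: int \<Rightarrow> 'p padic) then (\<lambda>_. 1) else teich_char e)"
proof -
  let ?\<theta> = "teich_char e :: int \<Rightarrow> 'p padic"
  have "primitive_character ?\<theta> = (if trivial_on_units ?\<theta> then (\<lambda>_. 1) else ?\<theta>)"
    unfolding primitive_character_def
  proof (rule the_equality, goal_cases)
    case 1
    show ?case using dirichlet_teich_char[OF e, where 'p='p] dirichlet_trivial e
      by (auto simp: conductor_teich_char trivial_on_units_def teich_char_eq_0_iff simp del: One_nat_def)
  next
    case (2 \<psi>)
    show ?case
    proof (cases "trivial_on_units ?\<theta>")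
      case True
      hence d: "dirichlet_character 1 \<psi>" using 2 e by (simp add: conductor_teich_char)
      have "\<psi> a = 1" for a
        using dirichlet_character_cong[OF d, of a 1] dirichlet_character_1[OF d] by simp
      thus ?thesis using True by auto
    next
      case False
      hence d: "dirichlet_character CARD('p) \<psi>" using 2 e by (simp add: conductor_teich_char)
      have "\<psi> a = ?\<theta> a" for a
      proof (cases "int CARD('p) dvd a")
        case True
        hence "\<psi> a = 0" using d by (auto simp: dirichlet_character_def coprime_int_CARD_iff)
        thus ?thesis using True e by (metis teich_char_eq_0_iff)
      next
        case False
        thus ?thesis using 2 e by (simp add: teich_char_eq_0_iff)
      qed
      thus ?thesis using False by auto
    qed
  qed
  thus ?thesis by simp
qed

section \<open>Generalized Bernoulli numbers as limits of power sums\<close>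

text \<open>The generating series of \<open>generalized_bernoulli\<close> with the modulus as a free
  parameter, decoupled from the conductor.\<close>

definition bernoulli_fps :: "nat \<Rightarrow> (int \<Rightarrow> 'a::field_char_0) \<Rightarrow> 'a fps" where
  "bernoulli_fps f \<theta> = (\<Sum>a = 1..f. fps_const (\<theta> (int a)) * fps_X * fps_exp (of_nat a)) / (fps_exp (of_nat f) - 1)"

lemma bernoulli_fps_times:
  assumes f: "f \<ge> 1"
  shows "bernoulli_fps f \<theta> * (fps_exp (of_nat f) - 1) =
         (\<Sum>a = 1..f. fps_const (\<theta> (int a)) * fps_X * fps_exp (of_nat a :: 'a::field_char_0))" (is "_ = ?num")
proof -
  let ?E = "fps_exp (of_nat f :: 'a) - 1"
  have s1: "subdegree ?E = 1" using f by (intro subdegreeI) auto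
  have "?E dvd ?num"
  proof (cases "?num = 0")
    case False
    have "fps_nth ?num 0 = 0" by (simp add: fps_sum_nth mult.assoc)
    hence n1: "subdegree ?num \<ge> 1" using False by (intro subdegree_geI) auto
    have E0: "?E \<noteq> 0"
    proof
      assume "?E = 0"
      hence "subdegree ?E = 0" by (simp only: subdegree_0)
      thus False using s1 by linarith
    qed
    show ?thesis unfolding fps_dvd_iff[OF E0 False] s1 by (rule n1)
  qed simp
  thus ?thesis unfolding bernoulli_fps_def by (rule dvd_div_mult_self)
qed

text \<open>Each further period multiplies the numerator by another \<open>exp (f T)\<close>, so the
  sum over \<open>M\<close> periods telescopes to the Bernoulli series times
  \<open>exp (f M T) - 1\<close>. Power sums are coefficients of this product.\<close>

lemma bernoulli_fps_power_sum:
  fixes \<theta> :: "int \<Rightarrow> 'a::field_char_0"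
  assumes f: "f \<ge> 1" and per: "\<And>a. \<theta> (a + int f) = \<theta> a"
  shows "(\<Sum>a = 1..f * M. \<theta> (int a) * of_nat a ^ k) =
         fact k * (\<Sum>i\<le>k. fps_nth (bernoulli_fps f \<theta>) i * of_nat (f * M) ^ (k + 1 - i) / fact (k + 1 - i))"
proof -
  let ?Q = "bernoulli_fps f \<theta>"
  have per': "\<theta> (a + int f * int M) = \<theta> a" for a M
    by (induction M) (auto simp: algebra_simps, metis add.assoc add.commute per)
  have T: "(\<Sum>a = 1..f * M. fps_const (\<theta> (int a)) * fps_X * fps_exp (of_nat a)) = ?Q * (fps_exp (of_nat (f * M)) - 1)"
  proof (induction M)
    case (Suc M)
    have "{1..f * Suc M} = {1..f * M} \<union> {1 + f * M..f + f * M}" by auto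
    hence "(\<Sum>a = 1..f * Suc M. fps_const (\<theta> (int a)) * fps_X * fps_exp (of_nat a)) =
       (\<Sum>a = 1..f * M. fps_const (\<theta> (int a)) * fps_X * fps_exp (of_nat a)) +
       (\<Sum>a = 1 + f * M..f + f * M. fps_const (\<theta> (int a)) * fps_X * fps_exp (of_nat a))"
      by (simp only:) (rule sum.union_disjoint, auto)
    also have "(\<Sum>a = 1 + f * M..f + f * M. fps_const (\<theta> (int a)) * fps_X * fps_exp (of_nat a)) =
       (\<Sum>a = 1..f. fps_const (\<theta> (int (a + f * M))) * fps_X * fps_exp (of_nat (a + f * M)))"
      by (rule sum.shift_bounds_cl_nat_ivl)
    also have "\<dots> = fps_exp (of_nat (f * M)) * (\<Sum>a = 1..f. fps_const (\<theta> (int a)) * fps_X * fps_exp (of_nat a))"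
      using per' by (simp add: sum_distrib_left fps_exp_add_mult mult_ac)
    also have "\<dots> = fps_exp (of_nat (f * M)) * (?Q * (fps_exp (of_nat f) - 1))"
      by (simp only: bernoulli_fps_times[OF f])
    finally show ?case unfolding Suc.IH by (simp add: algebra_simps fps_exp_add_mult)
  qed simp
  \<comment> \<open>The degree is \<open>k + 1\<close> because of the factor \<open>fps_X\<close> in
    the numerator.\<close>
  have "(\<Sum>a = 1..f * M. \<theta> (int a) * of_nat a ^ k / fact k) =
        fps_nth (\<Sum>a = 1..f * M. fps_const (\<theta> (int a)) * fps_X * fps_exp (of_nat a)) (k + 1)"
    by (simp add: fps_sum_nth mult.assoc)
  also have "\<dots> = (\<Sum>i=0..k+1. fps_nth ?Q i * fps_nth (fps_exp (of_nat (f * M)) - 1) (k + 1 - i))"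
    unfolding T fps_mult_nth ..
  also have "\<dots> = (\<Sum>i\<le>k. fps_nth ?Q i * of_nat (f * M) ^ (k + 1 - i) / fact (k + 1 - i))"
    by (simp add: atMost_atLeast0 Suc_diff_le)
  finally show ?thesis by (simp add: sum_divide_distrib[symmetric] field_simps)
qed

text \<open>After division by \<open>p^N\<close> the term of index \<open>i\<close> still carries
  \<open>p^(N (k - i))\<close>, so only \<open>i = k\<close> survives in the limit.\<close>

lemma bernoulli_fps_limit:
  fixes \<theta> :: "int \<Rightarrow> 'p::prime_card padic"
  assumes f: "f = 1 \<or> f = CARD('p)" and per: "\<And>a. \<theta> (a + int f) = \<theta> a"
  shows "(\<lambda>N. (\<Sum>a = 1..CARD('p) ^ N. \<theta> (int a) * of_nat a ^ k) / of_nat CARD('p) ^ N)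
           \<longlonglongrightarrow> fact k * fps_nth (bernoulli_fps f \<theta>) k"
proof -
  define p where "p = CARD('p)"
  have p0: "p > 0" using prime_gt_0_nat[OF prime_card[where 'a='p]] by (simp add: p_def)
  let ?Q = "bernoulli_fps f \<theta>"
  have lim: "(\<lambda>N. fact k * (\<Sum>i\<le>k. fps_nth ?Q i * (of_nat p ^ N) ^ (k - i) / fact (k + 1 - i)))
          \<longlonglongrightarrow> fact k * (\<Sum>i\<le>k. fps_nth ?Q i * 0 ^ (k - i) / fact (k + 1 - i) :: 'p padic)"
    by (intro tendsto_mult_padic tendsto_sum tendsto_divide_padic tendsto_power_padic tendsto_const) 
       (use CARD_power_tendsto_0[where 'p='p] in \<open>auto simp: p_def\<close>)
  have "(\<Sum>i\<le>k. fps_nth ?Q i * 0 ^ (k - i) / fact (k + 1 - i) :: 'p padic) = (\<Sum>i\<in>{k}. fps_nth ?Q i)"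
    by (rule sum.mono_neutral_cong_right) auto
  hence lim': "(\<lambda>N. fact k * (\<Sum>i\<le>k. fps_nth ?Q i * (of_nat p ^ N) ^ (k - i) / fact (k + 1 - i)))
          \<longlonglongrightarrow> fact k * fps_nth ?Q k"
    using lim by simp
  show ?thesis unfolding p_def[symmetric]
  proof (rule Lim_transform_eventually[OF lim'])
    show "\<forall>\<^sub>F N in sequentially. fact k * (\<Sum>i\<le>k. fps_nth ?Q i * (of_nat p ^ N) ^ (k - i) / fact (k + 1 - i)) =
       (\<Sum>a = 1..p ^ N. \<theta> (int a) * of_nat a ^ k) / of_nat p ^ N"
      using eventually_ge_at_top[of 1]
    proof eventually_elim
      case (elim N)
      have "\<exists>M. p ^ N = f * M" using f elim by (cases N) (auto simp: p_def)
      then obtain M where M: "p ^ N = f * M" by blast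
      have f1: "f \<ge> 1" using f p0 by (auto simp: p_def)
      have nz: "(of_nat p ^ N :: 'p padic) \<noteq> 0" using p0 by simp
      have "(\<Sum>a = 1..p ^ N. \<theta> (int a) * of_nat a ^ k) =
         fact k * (\<Sum>i\<le>k. fps_nth ?Q i * of_nat (p ^ N) ^ (k + 1 - i) / fact (k + 1 - i))"
        using bernoulli_fps_power_sum[of f \<theta> k M] f1 per M by simp
      also have "\<dots> = of_nat p ^ N * (fact k * (\<Sum>i\<le>k. fps_nth ?Q i * (of_nat p ^ N) ^ (k - i) / fact (k + 1 - i)))"
        by (auto simp: sum_distrib_left Suc_diff_le intro!: sum.cong)
      finally show ?case using nz by simp
    qed
  qed
qed

lemma unit_lip_teich_char: "unit_lip (teich_char e :: int \<Rightarrow> 'p::prime_card padic)"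
  by (rule unit_lip_periodic) (use teich_char_norm teich_char_cong in \<open>auto intro: eq_refl\<close>)

text \<open>Multiplication by a unit \<open>b\<close> permutes the residues and multiplies the sum
  by a value different from 1.\<close>

lemma sum_teich_char_units:
  assumes "\<not> trivial_on_units (teich_char e :: int \<Rightarrow> 'p::prime_card padic)"
  shows "(\<Sum>a | a < CARD('p) \<and> coprime a CARD('p). teich_char e (int a) :: 'p padic) = 0" (is "?S = 0")
proof -
  define p where "p = CARD('p)"
  let ?\<theta> = "teich_char e :: int \<Rightarrow> 'p padic"
  let ?U = "{a. a < p \<and> coprime a p}"
  have p0: "p > 0" using prime_gt_0_nat[OF prime_card[where 'a='p]] by (simp add: p_def)
  have U: "a \<in> ?U \<longleftrightarrow> a < p \<and> \<not> int p dvd int a" for a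
    using coprime_CARD_iff[of a, where 'p='p] by (auto simp: p_def)
  obtain b where b: "\<not> int p dvd b" "?\<theta> b \<noteq> 1" using assms by (auto simp: trivial_on_units_def p_def)
  define f where "f = (\<lambda>a. nat ((b * int a) mod int p))"
  have f: "int (f a) = (b * int a) mod int p" for a using p0 by (simp add: f_def)
  have fc: "[int (f a) = b * int a] (mod int p)" for a by (simp add: f cong_def)
  have P: "prime (int p)" using prime_card[where 'a='p] by (simp add: p_def)
  have "f ` ?U \<subseteq> ?U"
  proof
    fix x assume "x \<in> f ` ?U"
    then obtain a where a: "x = f a" "a \<in> ?U" by blast
    have "int (f a) < int p" using p0 by (simp only: f) simp
    moreover have "\<not> int p dvd int (f a)"
      using a(2) b(1) P cong_dvd_iff[OF fc, of a] unfolding U by (simp add: prime_dvd_mult_iff)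
    ultimately show "x \<in> ?U" using a(1) U by simp
  qed
  moreover have "inj_on f ?U"
  proof (rule inj_onI)
    fix x y assume xy: "x \<in> ?U" "y \<in> ?U" "f x = f y"
    have "[b * int x = b * int y] (mod int p)" using fc xy(3) by (metis cong_sym cong_trans)
    moreover have "coprime b (int p)" using b(1) coprime_int_CARD_iff[of b, where 'p='p] by (simp add: p_def)
    ultimately have "[int x = int y] (mod int p)" by (simp add: cong_mult_lcancel)
    thus "x = y" using xy(1,2) by (simp add: cong_int_iff cong_less_modulus_unique_nat)
  qed
  ultimately have "f ` ?U = ?U" by (intro endo_inj_surj) auto
  hence "?S = (\<Sum>a\<in>?U. ?\<theta> (int (f a)))"
    using sum.reindex[OF \<open>inj_on f ?U\<close>, of "\<lambda>a. ?\<theta> (int a)"] by (simp add: p_def)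
  also have "\<dots> = (\<Sum>a\<in>?U. ?\<theta> b * ?\<theta> (int a))"
    using teich_char_cong[of "int (f _)" "b * int _" e, where 'p='p] fc
    by (intro sum.cong) (auto simp: teich_char_mult p_def)
  also have "\<dots> = ?\<theta> b * ?S" by (simp add: sum_distrib_left p_def)
  finally show ?thesis using b(2) by simp
qed

text \<open>The endpoint \<open>p^N\<close> of the longer range is itself a multiple of
  \<open>p\<close>, since \<open>N \<ge> 1\<close>.\<close>

lemma sum_units_all:
  fixes f :: "nat \<Rightarrow> 'a::comm_monoid_add"
  assumes p: "prime p" and N: "N \<ge> 1" and f: "\<And>a. p dvd a \<Longrightarrow> f a = 0"
  shows "(\<Sum>a = 1..p ^ N. f a) = (\<Sum>a | a < p ^ N \<and> coprime a p. f a)"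
proof (rule sum.mono_neutral_right)
  show "{a. a < p ^ N \<and> coprime a p} \<subseteq> {1..p ^ N}"
    using not_prime_1 p by (auto intro!: Suc_leI gr0I)
  show "\<forall>i\<in>{1..p ^ N} - {a. a < p ^ N \<and> coprime a p}. f i = 0"
  proof
    fix i assume i: "i \<in> {1..p ^ N} - {a. a < p ^ N \<and> coprime a p}"
    show "f i = 0"
    proof (cases "i = p ^ N")
      case True
      thus ?thesis using N by (intro f) (auto intro: dvd_power)
    next
      case False
      hence "\<not> coprime i p" using i by auto
      thus ?thesis using p by (metis coprime_commute f prime_imp_coprime)
    qed
  qed
qed auto

lemma sum_units_complement:
  fixes f :: "nat \<Rightarrow> 'a::ab_group_add"
  assumes p: "prime p" and N: "N \<ge> 1"
  shows "(\<Sum>a | a < p ^ N \<and> coprime a p. f a) = (\<Sum>a = 1..p ^ N. f a) - (\<Sum>b = 1..p ^ (N - 1). f (p * b))"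
proof -
  have p0: "p > 0" using prime_gt_0_nat[OF p] .
  have "(\<Sum>a = 1..p ^ N. f a) = (\<Sum>a\<in>{1..p ^ N} \<inter> {a. p dvd a}. f a) + (\<Sum>a\<in>{1..p ^ N} \<inter> - {a. p dvd a}. f a)"
    by (rule sum.Int_Diff[of _ _ "{a. p dvd a}", unfolded Diff_eq]) simp
  also have "(\<Sum>a\<in>{1..p ^ N} \<inter> {a. p dvd a}. f a) = (\<Sum>b = 1..p ^ (N - 1). f (p * b))"
  proof (rule sum.reindex_bij_witness[of _ "\<lambda>b. p * b" "\<lambda>a. a div p"])
    fix a assume "a \<in> {1..p ^ N} \<inter> {a. p dvd a}"
    then obtain c where c: "a = p * c" "1 \<le> a" "a \<le> p ^ N" by auto
    have "p * c \<le> p * p ^ (N - 1)" using c N by (simp add: power_eq_if)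
    thus "a div p \<in> {1..p ^ (N - 1)}" "p * (a div p) = a" using c p0 by auto
    thus "f (p * (a div p)) = f a" by simp
  next
    fix b assume b: "b \<in> {1..p ^ (N - 1)}"
    hence "p * b \<le> p * p ^ (N - 1)" by simp
    also have "\<dots> = p ^ N" using N by (simp add: power_eq_if)
    finally show "p * b \<in> {1..p ^ N} \<inter> {a. p dvd a}" using b p0 by auto
    show "p * b div p = b" using p0 by simp
  qed
  also have "{1..p ^ N} \<inter> - {a. p dvd a} = {a. a < p ^ N \<and> coprime a p}"
  proof (intro equalityI subsetI)
    fix a assume a: "a \<in> {1..p ^ N} \<inter> - {a. p dvd a}"
    hence "a \<noteq> p ^ N" using N by (auto intro: dvd_power)
    thus "a \<in> {a. a < p ^ N \<and> coprime a p}"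
      using a prime_imp_coprime[OF p, of a] by (auto simp: coprime_commute)
  next
    fix a assume a: "a \<in> {a. a < p ^ N \<and> coprime a p}"
    hence "\<not> p dvd a" using not_prime_unit p by (auto simp: coprime_absorb_right)
    moreover from this have "a > 0" by (intro gr0I) auto
    ultimately show "a \<in> {1..p ^ N} \<inter> - {a. p dvd a}" using a by (simp add: Suc_leI)
  qed
  finally show ?thesis by simp
qed

text \<open>A nonprincipal power vanishes at multiples of \<open>p\<close>, so the sum over all
  integers may be used. In the principal case the multiples must be subtracted, which produces the
  Euler factor; it is written with \<open>p^t / p\<close> to cover \<open>t = 0\<close>.\<close>

lemma has_volk_teich_char_power:
  assumes e: "e \<ge> 1"
  shows "has_volk (\<lambda>a. teich_char e a * of_int a ^ t :: 'p::prime_card padic)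
    (if trivial_on_units (teich_char e :: int \<Rightarrow> 'p padic)
     then fact t * fps_nth (bernoulli_fps 1 (\<lambda>_. 1)) t * (1 - of_nat CARD('p) ^ t / of_nat CARD('p))
     else fact t * fps_nth (bernoulli_fps CARD('p) (teich_char e)) t)"
proof -
  define p where "p = CARD('p)"
  let ?\<theta> = "teich_char e :: int \<Rightarrow> 'p padic"
  have p: "prime p" using prime_card[where 'a='p] by (simp add: p_def)
  have p0: "(of_nat p :: 'p padic) \<noteq> 0" using prime_gt_0_nat[OF p] by simp
  show ?thesis
  proof (cases "trivial_on_units ?\<theta>")
    case False
    let ?B = "fact t * fps_nth (bernoulli_fps p ?\<theta>) t"
    have "(\<lambda>N. (\<Sum>a = 1..p ^ N. ?\<theta> (int a) * of_nat a ^ t) / of_nat p ^ N) \<longlonglongrightarrow> ?B"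
      unfolding p_def by (rule bernoulli_fps_limit) (auto intro!: teich_char_cong simp: cong_def)
    moreover have "(\<Sum>a = 1..p ^ N. ?\<theta> (int a) * of_nat a ^ t) = unit_sum (\<lambda>a. ?\<theta> a * of_int a ^ t) N"
      if "N \<ge> 1" for N
      unfolding unit_sum_def p_def[symmetric]
      using sum_units_all[OF p that, of "\<lambda>a. ?\<theta> (int a) * of_nat a ^ t"] e by (simp add: teich_char_eq_0_iff p_def)
    ultimately have "has_volk (\<lambda>a. ?\<theta> a * of_int a ^ t) ?B"
      unfolding has_volk_def p_def[symmetric]
      by (elim Lim_transform_eventually) (auto simp: eventually_sequentially intro!: exI[of _ 1])
    thus ?thesis using False by (simp add: p_def)
  next
    case True
    let ?b = "fact t * fps_nth (bernoulli_fps 1 (\<lambda>_. 1)) t :: 'p padic"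
    let ?S = "\<lambda>N. (\<Sum>a = 1..p ^ N. of_nat a ^ t) / of_nat p ^ N :: 'p padic"
    have lim: "?S \<longlonglongrightarrow> ?b"
      using bernoulli_fps_limit[of 1 "\<lambda>_. 1 :: 'p padic" t] by (simp add: p_def)
    \<comment> \<open>Level \<open>N + 1\<close> for all integers is paired with level
      \<open>N\<close> for the multiples \<open>p b\<close>; the division by \<open>p\<close>
      reflects the different denominators.\<close>
    have lim': "(\<lambda>N. ?S (Suc N) - of_nat p ^ t / of_nat p * ?S N) \<longlonglongrightarrow> ?b - of_nat p ^ t / of_nat p * ?b"
      by (intro tendsto_diff tendsto_mult_padic tendsto_const lim LIMSEQ_Suc[OF lim])
    have "unit_sum (\<lambda>a. ?\<theta> a * of_int a ^ t) (Suc N) / of_nat p ^ Suc N = ?S (Suc N) - of_nat p ^ t / of_nat p * ?S N" for N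
    proof -
      have "unit_sum (\<lambda>a. ?\<theta> a * of_int a ^ t) (Suc N) = unit_sum (\<lambda>a. of_int a ^ t) (Suc N)"
        by (rule unit_sum_cong) (use True in \<open>simp add: trivial_on_units_def\<close>)
      also have "\<dots> = (\<Sum>a = 1..p ^ Suc N. of_nat a ^ t) - (\<Sum>b = 1..p ^ N. of_nat (p * b) ^ t)"
        unfolding unit_sum_def p_def[symmetric]
        using sum_units_complement[OF p, of "Suc N" "\<lambda>a. of_nat a ^ t :: 'p padic"] by simp
      also have "(\<Sum>b = 1..p ^ N. of_nat (p * b) ^ t) = of_nat p ^ t * (\<Sum>b = 1..p ^ N. of_nat b ^ t :: 'p padic)"
        by (simp add: sum_distrib_left power_mult_distrib)
      finally show ?thesis using p0 by (simp add: diff_divide_distrib)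
    qed
    hence "(\<lambda>N. unit_sum (\<lambda>a. ?\<theta> a * of_int a ^ t) (Suc N) / of_nat p ^ Suc N) \<longlonglongrightarrow> ?b - of_nat p ^ t / of_nat p * ?b"
      using lim' by simp
    hence "has_volk (\<lambda>a. ?\<theta> a * of_int a ^ t) (?b - of_nat p ^ t / of_nat p * ?b)"
      unfolding has_volk_def p_def[symmetric] by (rule LIMSEQ_imp_Suc)
    thus ?thesis using True by (simp add: p_def algebra_simps)
  qed
qed

text \<open>The primitive character has value 1 or 0 at \<open>p\<close>, so a single Euler factor
  describes both cases.\<close>

lemma has_volk_teich_char_bernoulli:
  fixes k :: nat
  assumes e: "e \<ge> 1" and k: "k \<ge> 1"
  defines "\<psi> \<equiv> primitive_character (teich_char e :: int \<Rightarrow> 'p::prime_card padic)"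
  shows "has_volk (\<lambda>a. teich_char e a * of_int a ^ k :: 'p padic)
    ((1 - \<psi> (int CARD('p)) * of_nat CARD('p) ^ (k - 1)) * generalized_bernoulli k \<psi>)"
proof -
  let ?\<theta> = "teich_char e :: int \<Rightarrow> 'p padic"
  have p0: "(of_nat CARD('p) :: 'p padic) \<noteq> 0" using prime_gt_0_nat[OF prime_card[where 'a='p]] by simp
  have pk: "of_nat CARD('p) ^ k / of_nat CARD('p) = (of_nat CARD('p) ^ (k - 1) :: 'p padic)"
    using k p0 by (simp add: power_eq_if)
  have gb: "generalized_bernoulli k \<psi>' = fact k * fps_nth (bernoulli_fps (conductor \<psi>') \<psi>') k" for \<psi>' :: "int \<Rightarrow> 'p padic"
    by (simp add: generalized_bernoulli_def bernoulli_fps_def Let_def)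
  show ?thesis
  proof (cases "trivial_on_units ?\<theta>")
    case True
    hence \<psi>: "\<psi> = (\<lambda>_. 1)" using e by (simp add: \<psi>_def primitive_teich_char)
    have "conductor \<psi> = 1" unfolding \<psi> by (rule conductor_eq_1) simp
    thus ?thesis using has_volk_teich_char_power[OF e, of k, where 'p='p] True unfolding gb pk
      by (simp add: \<psi> mult.commute)
  next
    case False
    hence \<psi>: "\<psi> = ?\<theta>" using e by (simp add: \<psi>_def primitive_teich_char)
    have "conductor \<psi> = CARD('p)" using False by (simp add: \<psi> conductor_teich_char[OF e])
    moreover have "\<psi> (int CARD('p)) = 0" using e by (simp add: \<psi> teich_char_eq_0_iff)
    ultimately show ?thesis using has_volk_teich_char_power[OF e, of k, where 'p='p] False unfolding gb
      by (simp add: \<psi>)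
  qed
qed

section \<open>Moments and the Kubota--Leopoldt function\<close>

text \<open>For \<open>a\<close> prime to \<open>p\<close> this is
  \<open>\<langle>a\<rangle> = a / \<omega>(a)\<close>, the projection to the units congruent to 1
  modulo \<open>p\<close>.\<close>

definition one_unit :: "int \<Rightarrow> 'p::prime_card padic" where
  "one_unit a = teich_char 1 a * of_int a"

definition moment :: "nat \<Rightarrow> nat \<Rightarrow> 'p::prime_card padic" where
  "moment e j = (THE v. has_volk (\<lambda>a. teich_char e a * (one_unit a - 1) ^ j) v)"

lemma teich_char_one_unit:
  "teich_char e a * one_unit a ^ t = (teich_char (e + t) a * of_int a ^ t :: 'p::prime_card padic)"
  by (simp add: one_unit_def teich_char_def power_add power_mult_distrib)

lemma one_unit_near_1:
  assumes a: "\<not> int CARD('p) dvd a"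
  shows "padic_norm (one_unit a - 1 :: 'p::prime_card padic) \<le> 1 / real CARD('p)"
proof -
  have "one_unit a - 1 = teich_char 1 a * (of_int a - teichmueller a :: 'p padic)"
    using a by (simp add: one_unit_def teich_char_def teichmueller_eq_0_iff right_diff_distrib)
  thus ?thesis using teichmueller(2)[OF a] teich_char_norm[OF a, of 1]
    by (simp add: padic_norm_mult padic_norm_minus_commute)
qed

lemma unit_lip_one_unit: "unit_lip (one_unit :: int \<Rightarrow> 'p::prime_card padic)"
  unfolding one_unit_def by (intro unit_lip_mult unit_lip_teich_char unit_lip_of_int)

text \<open>Dividing by \<open>p\<close> in \<open>b\<close> may spoil the Lipschitz constant 1,
  while \<open>P * b a ^ j\<close> keeps it. Of the factor \<open>p^j\<close> in
  \<open>(one_unit a - 1)^j\<close> one \<open>p\<close> is spent on this and another on the general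
  bound for Riemann sums, whence \<open>p^2 / p^j\<close>.\<close>

lemma unit_sum_moment_bound:
  "padic_norm (unit_sum (\<lambda>a. teich_char e a * (one_unit a - 1) ^ j) N / of_nat CARD('p) ^ N :: 'p::prime_card padic)
     \<le> real CARD('p) ^ 2 / real CARD('p) ^ j"
proof -
  define p where "p = CARD('p)"
  define P where "P = (of_nat p :: 'p padic)"
  have p1: "real p > 1" using CARD_gt_1[where 'p='p] by (simp add: p_def)
  have P0: "P \<noteq> 0" using p1 by (simp add: P_def)
  have nP: "padic_norm P = 1 / real p" by (simp add: P_def p_def)
  define b where "b = (\<lambda>a. (one_unit a - 1) / P)"
  have b1: "padic_norm (b a) \<le> 1" if "\<not> int CARD('p) dvd a" for a
    using one_unit_near_1[OF that] p1 by (simp add: b_def padic_norm_divide nP field_simps p_def)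
  have l: "unit_lip (\<lambda>a. P * b a ^ j)"
    unfolding unit_lip_def
  proof (intro conjI allI impI)
    fix a assume a: "\<not> int CARD('p) dvd a"
    have "padic_norm (b a ^ j) \<le> 1" using b1[OF a] by (simp add: padic_norm_power power_le_one)
    from padic_norm_mult_le[OF eq_refl[OF nP] this] have "padic_norm (P * b a ^ j) \<le> 1 / real p" by simp
    thus "padic_norm (P * b a ^ j) \<le> 1" using padic_norm_less_1I[of "P * b a ^ j"] by (simp add: p_def)
    fix c assume c: "\<not> int CARD('p) dvd c"
    have "padic_norm (P * b a ^ j - P * b c ^ j) = padic_norm P * padic_norm (b a ^ j - b c ^ j)"
      by (simp add: right_diff_distrib flip: padic_norm_mult)
    also have "\<dots> \<le> padic_norm P * padic_norm (b a - b c)"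
      by (intro mult_left_mono padic_norm_power_diff_le b1 a c) simp
    also have "\<dots> = padic_norm (P * (b a - b c))" by (rule padic_norm_mult[symmetric])
    also have "P * (b a - b c) = one_unit a - one_unit c" using P0 by (simp add: b_def field_simps)
    also have "padic_norm (one_unit a - one_unit c :: 'p padic) \<le> padic_norm (of_int (a - c) :: 'p padic)"
      by (rule unit_lipD(2)[OF unit_lip_one_unit a c])
    finally show "padic_norm (P * b a ^ j - P * b c ^ j) \<le> padic_norm (of_int (a - c) :: 'p padic)" .
  qed
  have eq: "teich_char e a * (one_unit a - 1) ^ j = (P ^ j / P) * (teich_char e a * (P * b a ^ j))" for a
    using P0 by (simp add: b_def power_divide)
  have nPj: "padic_norm (P ^ j / P) = real p / real p ^ j"
    using p1 by (simp add: padic_norm_divide padic_norm_power nP power_one_over)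
  have "padic_norm ((P ^ j / P) * (unit_sum (\<lambda>a. teich_char e a * (P * b a ^ j)) N / of_nat p ^ N))
        \<le> (real p / real p ^ j) * real p"
    using unit_sum_lip_le'[OF unit_lip_mult[OF unit_lip_teich_char l], of e N]
    by (intro padic_norm_mult_le eq_refl[OF nPj]) (simp add: p_def)
  thus ?thesis unfolding eq unit_sum_cmult times_divide_eq_right[symmetric] by (simp add: p_def power2_eq_square)
qed

text \<open>The binomial expansion of \<open>(one_unit a - 1)^j\<close> turns the integrand into a
  combination of \<open>\<omega>^(-(e+t))(a) a^t\<close>, whose integrals are known; so the
  description in \<open>moment\<close> denotes.\<close>

lemma has_volk_moment:
  assumes e: "e \<ge> 1"
  shows "has_volk (\<lambda>a. teich_char e a * (one_unit a - 1) ^ j) (moment e j :: 'p::prime_card padic)"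
proof -
  have ex: "\<exists>v. has_volk (\<lambda>a. teich_char (e + t) a * of_int a ^ t :: 'p padic) v" for t
    using has_volk_teich_char_power[of "e + t" t, where 'p='p] e by auto
  then obtain v where v: "\<And>t. has_volk (\<lambda>a. teich_char (e + t) a * of_int a ^ t :: 'p padic) (v t)" by metis
  have eq: "teich_char e a * (one_unit a - 1) ^ j =
      (\<Sum>t\<le>j. (of_nat (j choose t) * (- 1) ^ (j - t)) * (teich_char (e + t) a * of_int a ^ t) :: 'p padic)" for a
  proof -
    have "(one_unit a - 1 :: 'p padic) ^ j = (\<Sum>t\<le>j. of_nat (j choose t) * one_unit a ^ t * (- 1) ^ (j - t))"
      using binomial_ring[of "one_unit a :: 'p padic" "- 1" j] by simp
    thus ?thesis unfolding teich_char_one_unit[symmetric] by (simp add: sum_distrib_left mult_ac)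
  qed
  obtain w where w: "has_volk (\<lambda>a. teich_char e a * (one_unit a - 1 :: 'p padic) ^ j) w"
  proof
    show "has_volk (\<lambda>a. teich_char e a * (one_unit a - 1 :: 'p padic) ^ j)
      (\<Sum>t\<le>j. of_nat (j choose t) * (- 1) ^ (j - t) * v t)"
      unfolding eq by (rule has_volk_sum, rule has_volk_cmult, rule v)
  qed
  have "moment e j = w"
    unfolding moment_def using w by (rule the_equality) (rule has_volk_unique[OF _ w])
  thus ?thesis using w by simp
qed

lemma moment_bound: "e \<ge> 1 \<Longrightarrow> padic_norm (moment e j :: 'p::prime_card padic) \<le> real CARD('p) ^ 2 / real CARD('p) ^ j"
  by (rule has_volk_bound[OF has_volk_moment unit_sum_moment_bound])

text \<open>This moment is the Bernoulli coefficient of degree 0, the average of the character over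
  a period. Its vanishing removes the pole of the series below.\<close>

lemma moment_0_not_principal:
  assumes e: "e \<ge> 1" and np: "\<not> trivial_on_units (teich_char e :: int \<Rightarrow> 'p::prime_card padic)"
  shows "moment e 0 = (0 :: 'p padic)"
proof -
  define p where "p = CARD('p)"
  let ?\<theta> = "teich_char e :: int \<Rightarrow> 'p padic"
  have p: "prime p" using prime_card[where 'a='p] by (simp add: p_def)
  have "(\<Sum>a = 1..p * 1. ?\<theta> (int a) * of_nat a ^ 0) =
      fact 0 * (\<Sum>i\<le>0. fps_nth (bernoulli_fps p ?\<theta>) i * of_nat (p * 1) ^ (0 + 1 - i) / fact (0 + 1 - i))"
    by (rule bernoulli_fps_power_sum) (auto intro!: teich_char_cong simp: cong_def p_def prime_gt_0_nat[OF p, unfolded p_def] Suc_leI)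
  hence "(\<Sum>a = 1..p ^ 1. ?\<theta> (int a)) = fps_nth (bernoulli_fps p ?\<theta>) 0 * of_nat p" by simp
  also have "(\<Sum>a = 1..p ^ 1. ?\<theta> (int a)) = (\<Sum>a | a < p ^ 1 \<and> coprime a p. ?\<theta> (int a))"
    using e by (intro sum_units_all p) (auto simp: teich_char_eq_0_iff p_def)
  also have "\<dots> = 0" using sum_teich_char_units[OF np] by (simp add: p_def)
  finally have "fps_nth (bernoulli_fps p ?\<theta>) 0 = 0" using prime_gt_0_nat[OF p] by simp
  moreover have "has_volk (\<lambda>a. ?\<theta> a * of_int a ^ 0) (fact 0 * fps_nth (bernoulli_fps p ?\<theta>) 0)"
    using has_volk_teich_char_power[OF e, of 0, where 'p='p] np by (simp add: p_def)
  ultimately have "has_volk (\<lambda>a. ?\<theta> a * (one_unit a - 1) ^ 0) 0" by simp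
  thus ?thesis using has_volk_moment[OF e, of 0] has_volk_unique by blast
qed

text \<open>\<open>H a\<close> stands for \<open>\<langle>a\<rangle>^c\<close>. It is left abstract,
  and each use supplies a closed form of the binomial series, for \<open>c = k\<close> or
  \<open>c = -n\<close>.\<close>

lemma has_volk_binomial_one_unit:
  fixes c :: "'p::prime_card padic"
  assumes e: "e \<ge> 1" and c: "c \<in> padic_integers"
    and H: "\<And>a. \<not> int CARD('p) dvd a \<Longrightarrow> ((\<lambda>j. (c gchoose j) * (one_unit a - 1) ^ j) has_sum H a) UNIV"
  shows "((\<lambda>j. (c gchoose j) * moment e j) has_sum infsum (\<lambda>j. (c gchoose j) * moment e j) UNIV) UNIV"
    and "has_volk (\<lambda>a. teich_char e a * H a) (infsum (\<lambda>j. (c gchoose j) * moment e j) UNIV)"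
proof -
  let ?g = "\<lambda>j a. (c gchoose j) * (teich_char e a * (one_unit a - 1) ^ j)"
  let ?B = "\<lambda>j. real CARD('p) ^ 2 / real CARD('p) ^ j"
  have 1: "((\<lambda>j. ?g j a) has_sum teich_char e a * H a) UNIV" if "\<not> int CARD('p) dvd a" for a
    using has_sum_cmult_right[OF H[OF that], of "teich_char e a"] by (simp add: mult_ac)
  have 2: "has_volk (?g j) ((c gchoose j) * moment e j)" for j
    by (intro has_volk_cmult has_volk_moment e)
  have 3: "padic_norm (unit_sum (?g j) N / of_nat CARD('p) ^ N) \<le> ?B j" for j N
    unfolding unit_sum_cmult times_divide_eq_right[symmetric]
    using padic_norm_mult_le[OF padic_norm_gbinomial_le_1[OF c] unit_sum_moment_bound] by simp
  have 4: "?B \<longlonglongrightarrow> 0"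
    using tendsto_mult_right_zero[OF one_over_CARD_power_tendsto_0[where 'p='p], of "real CARD('p) ^ 2"] by simp
  show "((\<lambda>j. (c gchoose j) * moment e j) has_sum infsum (\<lambda>j. (c gchoose j) * moment e j) UNIV) UNIV"
    "has_volk (\<lambda>a. teich_char e a * H a) (infsum (\<lambda>j. (c gchoose j) * moment e j) UNIV)"
    using has_volk_has_sum[of "\<lambda>j a. ?g j a" "\<lambda>a. teich_char e a * H a" "\<lambda>j. (c gchoose j) * moment e j" ?B] 1 2 3 4
    by blast+
qed

text \<open>The possible pole at 1 is isolated in the term with the zeroth moment. The other
  coefficients still tend to zero after division by \<open>Suc j\<close>, so the remaining series
  makes sense at every \<open>p\<close>-adic integer, 1 included.\<close>

definition L_series :: "nat \<Rightarrow> 'p::prime_card padic \<Rightarrow> 'p padic" where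
  "L_series e s = moment e 0 / (s - 1) - (\<Sum>\<^sub>\<infinity>j. ((- s) gchoose j) * (moment e (Suc j) / of_nat (Suc j)))"

text \<open>The power of \<open>p\<close> dividing \<open>n\<close> is at most \<open>n\<close>.
  Division by an index therefore costs a linear factor, harmless against geometric decay.\<close>

lemma padic_norm_of_nat_ge: "n \<ge> 1 \<Longrightarrow> 1 / real n \<le> padic_norm (of_nat n :: 'p::prime_card padic)"
proof -
  assume n: "n \<ge> 1"
  let ?m = "multiplicity (int CARD('p)) (int n)"
  have "int CARD('p) ^ ?m dvd int n" by (rule multiplicity_dvd)
  hence "CARD('p) ^ ?m dvd n" by (metis int_dvd_int_iff of_nat_power)
  hence "CARD('p) ^ ?m \<le> n" using n by (intro dvd_imp_le) auto
  hence "real CARD('p) ^ ?m \<le> real n" by (metis of_nat_le_iff of_nat_power)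
  thus ?thesis using padic_norm_of_int[of "int n", where 'p='p] n CARD_pos[where 'p='p]
    by (simp add: frac_le)
qed

lemma moment_divide_bound:
  assumes "e \<ge> 1"
  shows "padic_norm (moment e (Suc j) / of_nat (Suc j) :: 'p::prime_card padic)
     \<le> real CARD('p) * (real (Suc j) * (1 / real CARD('p)) ^ j)"
proof -
  have p: "real CARD('p) > 0" by (rule CARD_pos)
  have "padic_norm (moment e (Suc j) / of_nat (Suc j) :: 'p padic) =
     padic_norm (moment e (Suc j) :: 'p padic) / padic_norm (of_nat (Suc j) :: 'p padic)" by (rule padic_norm_divide)
  also have "\<dots> \<le> (real CARD('p) ^ 2 / real CARD('p) ^ Suc j) / (1 / real (Suc j))"
    using p by (intro frac_le moment_bound assms padic_norm_of_nat_ge) auto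
  also have "\<dots> = real CARD('p) * (real (Suc j) * (1 / real CARD('p)) ^ j)"
    using p by (simp add: power2_eq_square power_one_over field_simps)
  finally show ?thesis .
qed

lemma moment_divide_bound_tendsto:
  "(\<lambda>j. real CARD('p::prime_card) * (real (Suc j) * (1 / real CARD('p)) ^ j)) \<longlonglongrightarrow> 0"
proof -
  have n: "norm (1 / real CARD('p)) < 1" using CARD_gt_1[where 'p='p] by simp
  have "(\<lambda>j. real j * (1 / real CARD('p)) ^ j + (1 / real CARD('p)) ^ j) \<longlonglongrightarrow> 0 + 0"
    using n by (intro tendsto_add powser_times_n_limit_0 LIMSEQ_power_zero)
  hence "(\<lambda>j. real (Suc j) * (1 / real CARD('p)) ^ j) \<longlonglongrightarrow> 0" by (simp add: algebra_simps)
  thus ?thesis by (rule tendsto_mult_right_zero)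
qed

lemma padic_L_domain_teich_char:
  assumes "e \<ge> 1"
  shows "padic_L_domain (teich_char e :: int \<Rightarrow> 'p::prime_card padic) =
    (if trivial_on_units (teich_char e :: int \<Rightarrow> 'p padic) then padic_integers - {1} else padic_integers)"
proof -
  have "CARD('p) \<noteq> 1" using prime_gt_1_nat[OF prime_card[where 'a='p]] by simp
  thus ?thesis using conductor_teich_char[OF assms, where 'p='p] by (simp add: padic_L_domain_def)
qed

text \<open>The series is dominated uniformly in the variable; the pole term either lives on a
  domain without 1 or has numerator 0.\<close>

lemma continuous_on_L_series:
  assumes e: "e \<ge> 1"
  shows "continuous_on (padic_L_domain (teich_char e)) (L_series e :: 'p::prime_card padic \<Rightarrow> 'p padic)"
  unfolding continuous_on_def
proof
  let ?D = "padic_L_domain (teich_char e :: int \<Rightarrow> 'p padic)"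
  let ?c = "\<lambda>j. moment e (Suc j) / of_nat (Suc j) :: 'p padic"
  let ?B = "\<lambda>j. real CARD('p) * (real (Suc j) * (1 / real CARD('p)) ^ j)"
  fix s assume s: "s \<in> ?D"
  have "((\<lambda>x. \<Sum>\<^sub>\<infinity>j. ((- x) gchoose j) * ?c j) \<longlongrightarrow> (\<Sum>\<^sub>\<infinity>j. ((- s) gchoose j) * ?c j)) (at s within ?D)"
  proof (rule tendsto_padic_infsum[where B = ?B])
    show "((\<lambda>x. ((- x) gchoose j) * ?c j) \<longlongrightarrow> ((- s) gchoose j) * ?c j) (at s within ?D)" for j
      unfolding gbinomial_prod_rev by (intro tendsto_intros tendsto_prod_padic) auto
    show "\<forall>\<^sub>F x in at s within ?D. \<forall>j\<in>UNIV. padic_norm (((- x) gchoose j) * ?c j) \<le> ?B j"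
      unfolding eventually_at_filter
    proof (rule always_eventually, intro allI impI ballI)
      fix x j assume "x \<in> ?D"
      hence "- x \<in> padic_integers" using e by (auto simp: padic_L_domain_teich_char padic_integers_def split: if_splits)
      from padic_norm_mult_le[OF padic_norm_gbinomial_le_1[OF this] moment_divide_bound[OF e]]
      show "padic_norm (((- x) gchoose j) * ?c j) \<le> ?B j" by simp
    qed
    show "finite {j \<in> UNIV. ?B j \<ge> r}" if "r > 0" for r
      by (rule finite_nat_ge_of_tendsto_0[OF moment_divide_bound_tendsto that])
  qed
  moreover have "((\<lambda>x. moment e 0 / (x - 1)) \<longlongrightarrow> moment e 0 / (s - 1)) (at s within ?D)"
  proof (cases "trivial_on_units (teich_char e :: int \<Rightarrow> 'p padic)")
    case True
    hence "s - 1 \<noteq> 0" using s e by (auto simp: padic_L_domain_teich_char)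
    thus ?thesis by (intro tendsto_intros)
  next
    case False
    thus ?thesis by (simp add: moment_0_not_principal[OF e])
  qed
  ultimately show "(L_series e \<longlongrightarrow> L_series e s) (at s within ?D)"
    unfolding L_series_def by (intro tendsto_diff)
qed

lemma has_sum_Suc_shift:
  fixes f :: "nat \<Rightarrow> 'p::prime_card padic"
  assumes "(f has_sum S) UNIV"
  shows "((\<lambda>j. f (Suc j)) has_sum S - f 0) UNIV"
proof -
  define g where "g = (\<lambda>x. f x + (if x = 0 then - f 0 else 0))"
  have "(g has_sum S + - f 0) UNIV"
    unfolding g_def by (intro has_sum_add assms has_sum_finite_neutralI[of "{0}"]) auto
  moreover have "(g has_sum S - f 0) UNIV \<longleftrightarrow> (f has_sum S - f 0) (range Suc)"
  proof (rule has_sum_cong_neutral)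
    fix x :: nat assume "x \<in> UNIV - range Suc"
    thus "g x = 0" by (cases x) (auto simp: g_def)
  qed (auto simp: g_def)
  ultimately show ?thesis using has_sum_reindex[of Suc UNIV f "S - f 0"] by (simp add: o_def)
qed

text \<open>
  By absorption of binomial coefficients, dividing \<open>\<Sum>j. (c gchoose j) M j\<close> by \<open>c\<close> gives the series defining \<open>L\<close> at \<open>1 - c\<close>.
\<close>

lemma L_series_eq:
  fixes c :: "'p::prime_card padic"
  assumes e: "e \<ge> 1" and c: "c \<noteq> 0"
    and S: "((\<lambda>j. (c gchoose j) * moment e j) has_sum S) UNIV"
  shows "L_series e (1 - c) = - S / c"
proof -
  have eq: "(c gchoose Suc j) * moment e (Suc j) =
        c * (((- (1 - c)) gchoose j) * (moment e (Suc j) / of_nat (Suc j)))" for j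
  proof -
    have "of_nat (Suc j) * (c gchoose Suc j) = c * ((c - 1) gchoose j)" by (rule gbinomial_absorption)
    hence "c gchoose Suc j = c * ((- (1 - c)) gchoose j) / of_nat (Suc j)"
      by (simp add: field_simps del: of_nat_Suc)
    thus ?thesis by simp
  qed
  have "((\<lambda>j. (c gchoose Suc j) * moment e (Suc j)) has_sum S - moment e 0) UNIV"
    using has_sum_Suc_shift[OF S] by simp
  hence "((\<lambda>j. inverse c * (c * (((- (1 - c)) gchoose j) * (moment e (Suc j) / of_nat (Suc j))))) has_sum
      inverse c * (S - moment e 0)) UNIV"
    unfolding eq by (rule has_sum_cmult_right)
  hence X: "(\<Sum>\<^sub>\<infinity>j. ((- (1 - c)) gchoose j) * (moment e (Suc j) / of_nat (Suc j))) = inverse c * (S - moment e 0)"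
    using c by (simp add: mult.assoc[symmetric] infsumI)
  have "L_series e (1 - c) = moment e 0 / (- c) - inverse c * (S - moment e 0)"
    unfolding L_series_def X by simp
  thus ?thesis using c by (simp add: field_simps)
qed

lemma binomial_series_one_unit_nat:
  "((\<lambda>j. ((of_nat k) gchoose j) * (one_unit a - 1 :: 'p::prime_card padic) ^ j) has_sum one_unit a ^ k) UNIV"
proof -
  have "((\<lambda>j. ((of_nat k) gchoose j) * (one_unit a - 1 :: 'p padic) ^ j) has_sum
      (\<Sum>j\<le>k. ((of_nat k) gchoose j) * (one_unit a - 1) ^ j)) UNIV"
    by (rule has_sum_finite_neutralI[of "{..k}"]) (auto simp: binomial_gbinomial[symmetric])
  also have "(\<Sum>j\<le>k. ((of_nat k) gchoose j) * (one_unit a - 1) ^ j) = ((one_unit a - 1) + 1 :: 'p padic) ^ k"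
    by (subst binomial_ring) (simp add: binomial_gbinomial)
  finally show ?thesis by simp
qed

text \<open>For \<open>c = k\<close> the integrand is \<open>\<omega>^(-e)(a) \<langle>a\<rangle>^k
  = \<omega>^(-(e+k))(a) a^k\<close>: the twist demanded by the interpolation property arises from
  the power of \<open>\<langle>a\<rangle>\<close>.\<close>

lemma L_series_interpolation:
  fixes k :: nat
  assumes e: "e \<ge> 1" and k: "k \<ge> 1"
  defines "\<psi> \<equiv> primitive_character (teich_char (e + k) :: int \<Rightarrow> 'p::prime_card padic)"
  shows "L_series e (1 - of_nat k :: 'p padic) =
     - (1 - \<psi> (int CARD('p)) * of_nat CARD('p) ^ (k - 1)) * generalized_bernoulli k \<psi> / of_nat k"
proof -
  note * = has_volk_binomial_one_unit[OF e padic_integers_of_nat binomial_series_one_unit_nat[of k, where 'p='p]]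
  have "has_volk (\<lambda>a. teich_char e a * one_unit a ^ k :: 'p padic)
      ((1 - \<psi> (int CARD('p)) * of_nat CARD('p) ^ (k - 1)) * generalized_bernoulli k \<psi>)"
    unfolding \<psi>_def teich_char_one_unit using k by (intro has_volk_teich_char_bernoulli) auto
  from has_volk_unique[OF *(2) this] show ?thesis
    using L_series_eq[OF e _ *(1)] k by (simp only: minus_mult_left of_nat_eq_0_iff not_one_le_zero)
qed

text \<open>Continuity and density of the integers \<open>1 - k\<close> leave no other function.
  These integers differ from 1, so they lie in the domain in the principal case too.\<close>

lemma padic_L_teich_char:
  assumes e: "e \<ge> 1" and s: "s \<in> padic_L_domain (teich_char e)"
  shows "padic_L (teich_char e) s = (L_series e s :: 'p::prime_card padic)"
proof -
  let ?\<theta> = "teich_char e :: int \<Rightarrow> 'p padic"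
  let ?D = "padic_L_domain ?\<theta>"
  define L where "L = (\<lambda>s. if s \<in> ?D then L_series e s else 0)"
  let ?I = "\<lambda>k. - (1 - teichmueller_twist ?\<theta> k (int CARD('p)) * of_nat CARD('p) ^ (k - 1)) *
          generalized_bernoulli k (teichmueller_twist ?\<theta> k) / of_nat k :: 'p padic"
  have tw: "teichmueller_twist ?\<theta> k = primitive_character (teich_char (e + k))" for k
    by (simp add: teichmueller_twist_def teich_char_def[abs_def] power_add)
  have D: "1 - of_nat k \<in> ?D" if "k \<ge> 1" for k
    using e that by (auto simp: padic_L_domain_teich_char intro!: padic_integers_closed)
  have "padic_L ?\<theta> = L"
    unfolding padic_L_def
  proof (rule the_equality)
    have "continuous_on ?D L = continuous_on ?D (L_series e)" by (rule continuous_on_cong) (auto simp: L_def)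
    moreover have "L (1 - of_nat k) = ?I k" if "k \<ge> 1" for k
      using D[OF that] L_series_interpolation[OF e that, where 'p='p] by (simp add: L_def tw)
    ultimately show "continuous_on ?D L \<and> (\<forall>k\<ge>1. L (1 - of_nat k) = ?I k) \<and> (\<forall>s. s \<notin> ?D \<longrightarrow> L s = 0)"
      using continuous_on_L_series[OF e] by (auto simp: L_def)
    fix L' assume L': "continuous_on ?D L' \<and> (\<forall>k\<ge>1. L' (1 - of_nat k) = ?I k) \<and> (\<forall>s. s \<notin> ?D \<longrightarrow> L' s = 0)"
    show "L' = L"
    proof
      fix s show "L' s = L s"
      proof (cases "s \<in> ?D")
        case True
        hence "1 - s \<in> padic_integers"
          using e by (auto simp: padic_L_domain_teich_char split: if_splits intro!: padic_integers_closed)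
        hence "\<exists>n. padic_norm (1 - s - of_nat n) \<le> 1 / real CARD('p) ^ i" for i
          using padic_integers_nat_dense by metis
        then obtain n where n: "\<And>i. padic_norm (1 - s - of_nat (n i)) \<le> 1 / real CARD('p) ^ i" by metis
        \<comment> \<open>Adding \<open>p^i\<close> makes \<open>k i\<close> positive without
          disturbing the limit.\<close>
        define k where "k = (\<lambda>i. n i + CARD('p) ^ i)"
        have k1: "k i \<ge> 1" for i using prime_gt_0_nat[OF prime_card[where 'a='p]] by (simp add: k_def Suc_leI)
        have "padic_norm ((1 - of_nat (k i)) - s) \<le> 1 / real CARD('p) ^ i" for i
          using padic_norm_diff_le[OF n[of i], of "of_nat CARD('p) ^ i"] by (simp add: k_def algebra_simps)
        hence lim: "(\<lambda>i. 1 - of_nat (k i)) \<longlonglongrightarrow> s"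
          unfolding tendsto_padic_iff
          by (intro tendsto_sandwich[OF _ _ tendsto_const one_over_CARD_power_tendsto_0[where 'p='p]]) auto
        have "(\<lambda>i. L' (1 - of_nat (k i))) \<longlonglongrightarrow> L' s" "(\<lambda>i. L (1 - of_nat (k i))) \<longlonglongrightarrow> L s"
          using L' \<open>continuous_on ?D L \<and> _\<close> D[OF k1] True
          by (auto intro!: continuous_on_tendsto_compose[OF _ lim])
        moreover have "L' (1 - of_nat (k i)) = L (1 - of_nat (k i))" for i
          using L' k1[of i] D[OF k1[of i]] L_series_interpolation[OF e k1, of i, where 'p='p] by (simp add: L_def tw)
        ultimately show ?thesis by (simp add: LIMSEQ_unique)
      qed (use L' in \<open>auto simp: L_def\<close>)
    qed
  qed
  thus ?thesis using s by (simp add: L_def)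
qed

text \<open>With \<open>e = n\<close> and \<open>c = -n\<close> the character cancels:
  \<open>\<omega>^(-n)(a) \<langle>a\<rangle>^(-n) = a^(-n)\<close>.\<close>

lemma has_volk_inverse_power:
  assumes n: "n \<ge> 1"
  shows "has_volk (\<lambda>a. inverse (of_int a) ^ n) (of_nat n * padic_L (teich_char n) (of_nat (1 + n)) :: 'p::prime_card padic)"
proof -
  let ?c = "- of_nat n :: 'p padic"
  have c: "?c \<in> padic_integers" by (simp add: padic_integers_def)
  have c0: "?c \<noteq> 0" using n by simp
  have H: "((\<lambda>j. (?c gchoose j) * (one_unit a - 1) ^ j) has_sum inverse (one_unit a) ^ n) UNIV"
    if "\<not> int CARD('p) dvd a" for a
    using binomial_series_neg[OF padic_norm_less_1I[OF one_unit_near_1[OF that]], of n] by simp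
  note * = has_volk_binomial_one_unit[OF n c H]
  have "(of_nat (1 + n) :: 'p padic) \<noteq> 1" using n by (metis add_cancel_left_right not_one_le_zero of_nat_1 of_nat_eq_iff)
  hence "of_nat (1 + n) \<in> padic_L_domain (teich_char n :: int \<Rightarrow> 'p padic)"
    using n padic_integers_of_nat[of "1 + n", where 'p='p] by (simp only: padic_L_domain_teich_char) auto
  hence "padic_L (teich_char n) (of_nat (1 + n)) = L_series n (1 - ?c)"
    using padic_L_teich_char[OF n] by simp
  hence "infsum (\<lambda>j. (?c gchoose j) * moment n j) UNIV = of_nat n * padic_L (teich_char n) (of_nat (1 + n))"
    using L_series_eq[OF n c0 *(1)] n by simp
  moreover have "teich_char n a * inverse (one_unit a) ^ n = (inverse (of_int a) ^ n :: 'p padic)" if "\<not> int CARD('p) dvd a" for a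
    using that by (simp add: one_unit_def teich_char_def power_mult_distrib teichmueller_eq_0_iff power_inverse)
  ultimately show ?thesis using *(2) has_volk_cong[of "\<lambda>a. teich_char n a * inverse (one_unit a) ^ n" "\<lambda>a. inverse (of_int a) ^ n :: 'p padic"]
    by simp
qed

section \<open>Power sums over units\<close>

text \<open>This is \<open>V n\<close> for \<open>n \<ge> 1\<close>. At \<open>n = 0\<close> the
  formula gives 0, not the integral of 1, so index 0 is treated apart.\<close>

definition volk_inverse_power :: "nat \<Rightarrow> 'p::prime_card padic" where
  "volk_inverse_power n = of_nat n * padic_L (teich_char n) (of_nat (1 + n))"

lemma has_volk_volk_inverse_power:
  "n \<ge> 1 \<Longrightarrow> has_volk (\<lambda>a. inverse (of_int a) ^ n) (volk_inverse_power n :: 'p::prime_card padic)"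
  unfolding volk_inverse_power_def by (rule has_volk_inverse_power)

text \<open>One integral computed twice, by interpolation and by pairing.\<close>

lemma volk_inverse_power_odd:
  "odd n \<Longrightarrow> CARD('p::prime_card) \<noteq> 2 \<Longrightarrow> volk_inverse_power n = (0 :: 'p padic)"
  using has_volk_inverse_power_odd[of n, where 'p='p] has_volk_volk_inverse_power[of n, where 'p='p]
  by (auto intro: has_volk_unique simp: odd_pos Suc_leI)

lemma sum_lessThan_add:
  "sum f {..<(A::nat) + B} = sum f {..<A} + (\<Sum>u<B. f (u + A))" for f :: "nat \<Rightarrow> 'a::comm_monoid_add"
  by (induction B) (auto simp: add_ac)

text \<open>The interval \<open>{..<A + B}\<close> is cut once at \<open>A\<close> and once at
  \<open>B\<close>; shifts by multiples of \<open>p\<close> preserve coprimality.\<close>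

lemma sum_coprime_shift:
  fixes f :: "nat \<Rightarrow> 'a::ab_group_add"
  assumes A: "p dvd A" and B: "p dvd B"
  shows "(\<Sum>a | a < A \<and> coprime a p. f (a + B) - f a) = (\<Sum>u | u < B \<and> coprime u p. f (u + A) - f u)"
proof -
  \<comment> \<open>Extension by zero to the non-units, so that full intervals can be
    shifted.\<close>
  define F where "F = (\<lambda>a. if coprime a p then f a else 0)"
  have cop: "coprime (a + C) p \<longleftrightarrow> coprime a p" if C: "p dvd C" for a C
  proof -
    obtain M where "C = p * M" using C by blast
    thus ?thesis by (metis coprime_commute coprime_iff_gcd_eq_1 gcd_add_mult add.commute mult.commute)
  qed
  have F: "(\<Sum>a | a < D \<and> coprime a p. f (a + C) - f a) = (\<Sum>a<D. F (a + C)) - (\<Sum>a<D. F a)" if "p dvd C" for C D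
  proof -
    have "(\<Sum>a<D. F (a + C)) - (\<Sum>a<D. F a) = (\<Sum>a<D. F (a + C) - F a)" by (simp add: sum_subtractf)
    also have "\<dots> = (\<Sum>a\<in>{a. a < D \<and> coprime a p}. f (a + C) - f a)"
      by (rule sum.mono_neutral_cong_right) (auto simp: F_def cop[OF that])
    finally show ?thesis by simp
  qed
  have "(\<Sum>a<A. F a) + (\<Sum>u<B. F (u + A)) = (\<Sum>a<B. F a) + (\<Sum>u<A. F (u + B))"
    using sum_lessThan_add[of F A B] sum_lessThan_add[of F B A] by (simp add: add.commute)
  thus ?thesis unfolding F[OF A] F[OF B] by (simp add: algebra_simps)
qed

lemma coprime_power_sum_eq:
  assumes "k \<ge> 1"
  shows "coprime_power_sum l k = (\<Sum>i | i < k \<and> coprime i CARD('p). inverse (of_nat i) ^ l :: 'p::prime_card padic)"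
proof -
  have "CARD('p) \<noteq> 1" using prime_gt_1_nat[OF prime_card[where 'a='p]] by simp
  hence "coprime i CARD('p) \<Longrightarrow> i > 0" for i by (intro gr0I) auto
  hence "{i. 1 \<le> i \<and> i \<le> k - 1 \<and> coprime i CARD('p)} = {i. i < k \<and> coprime i CARD('p)}"
    using assms by fastforce
  thus ?thesis unfolding coprime_power_sum_def by (simp add: power_inverse divide_inverse)
qed

text \<open>
  The integral of the difference of \<open>f\<close> and its translate by \<open>B\<close> is the sum over \<open>u < B\<close> of the derivatives of \<open>f\<close>:
  at finite level both are sums over overlapping intervals.
\<close>

lemma has_volk_shift:
  fixes f :: "int \<Rightarrow> 'p::prime_card padic"
  assumes B: "CARD('p) dvd B" and v: "has_volk (\<lambda>a. f (a + int B) - f a) v"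
    and lim: "\<And>u. coprime u CARD('p) \<Longrightarrow>
      (\<lambda>N. (f (int (u + CARD('p) ^ N)) - f (int u)) / of_nat CARD('p) ^ N) \<longlonglongrightarrow> d u"
  shows "v = (\<Sum>u | u < B \<and> coprime u CARD('p). d u)"
proof -
  have "(\<lambda>N. \<Sum>u | u < B \<and> coprime u CARD('p). (f (int (u + CARD('p) ^ N)) - f (int u)) / of_nat CARD('p) ^ N)
      \<longlonglongrightarrow> (\<Sum>u | u < B \<and> coprime u CARD('p). d u)"
    by (intro tendsto_sum lim) auto
  moreover have "(\<lambda>N. \<Sum>u | u < B \<and> coprime u CARD('p). (f (int (u + CARD('p) ^ N)) - f (int u)) / of_nat CARD('p) ^ N)
      \<longlonglongrightarrow> v"
  proof (rule Lim_transform_eventually[OF v[unfolded has_volk_def]])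
    show "\<forall>\<^sub>F N in sequentially. unit_sum (\<lambda>a. f (a + int B) - f a) N / of_nat CARD('p) ^ N =
      (\<Sum>u | u < B \<and> coprime u CARD('p). (f (int (u + CARD('p) ^ N)) - f (int u)) / of_nat CARD('p) ^ N)"
      using eventually_ge_at_top[of 1]
    proof eventually_elim
      case (elim N)
      hence "CARD('p) dvd CARD('p) ^ N" by (intro dvd_power) auto
      from sum_coprime_shift[OF this B, of "\<lambda>a. f (int a)"] show ?case
        unfolding unit_sum_def by (simp add: sum_divide_distrib)
    qed
  qed
  ultimately show ?thesis by (simp add: LIMSEQ_unique)
qed

lemma of_int_nonzero_of_not_dvd: "\<not> int CARD('p::prime_card) dvd a \<Longrightarrow> (of_int a :: 'p padic) \<noteq> 0"
  by auto

lemma padic_norm_unit_of_int: "\<not> int CARD('p) dvd a \<Longrightarrow> padic_norm (of_int a :: 'p::prime_card padic) = 1"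
  by (simp only: padic_norm_of_int_eq_1_iff not_False_eq_True)

lemma unit_sum_inverse_power_bound:
  fixes c :: "'p::prime_card padic"
  assumes "padic_norm c \<le> B"
  shows "padic_norm (unit_sum (\<lambda>a. c * inverse (of_int a) ^ j) N / of_nat CARD('p) ^ N) \<le> B * real CARD('p)"
  unfolding unit_sum_cmult times_divide_eq_right[symmetric]
  by (intro padic_norm_mult_le assms unit_sum_lip_le' unit_lip_inverse_power)

text \<open>The integrand is \<open>f u = u^(-j)\<close>. Its translate is expanded by the binomial
  series in \<open>x / a\<close>, which has norm at most \<open>1 / p\<close>, and its derivative
  \<open>-j u^(-j-1)\<close> produces the power sum of exponent \<open>j + 1\<close>.\<close>

lemma power_sum_series_ge_2:
  fixes n j :: nat
  assumes j: "j \<ge> 1" and n: "n \<ge> 1"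
  defines "x \<equiv> of_nat (n * CARD('p)) :: 'p::prime_card padic"
  shows "((\<lambda>k. ((- of_nat j) gchoose k) * x ^ k * volk_inverse_power (j + k)) has_sum
      volk_inverse_power j - of_nat j * coprime_power_sum (Suc j) (n * CARD('p))) UNIV"
proof -
  define p where "p = CARD('p)"
  define P where "P = (of_nat p :: 'p padic)"
  have p0: "p > 0" using prime_gt_0_nat[OF prime_card[where 'a='p]] by (simp add: p_def)
  have P0: "P \<noteq> 0" using p0 by (simp add: P_def)
  let ?c = "- of_nat j :: 'p padic"
  have cZ: "?c \<in> padic_integers" by (simp add: padic_integers_def)
  have nx: "padic_norm x \<le> 1 / real p"
    using padic_norm_mult_le[OF padic_norm_of_nat_le_1[of n, where 'p='p] eq_refl[OF padic_norm_CARD]]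
    by (simp add: x_def p_def)
  let ?f = "\<lambda>a. inverse (of_int a) ^ j :: 'p padic"
  let ?g = "\<lambda>k a. ((?c gchoose k) * x ^ k) * inverse (of_int a) ^ (j + k) :: 'p padic"
  let ?v = "\<lambda>k. (?c gchoose k) * x ^ k * volk_inverse_power (j + k) :: 'p padic"
  have H: "((\<lambda>k. ?g k a) has_sum ?f (a + int (n * p))) UNIV" if a: "\<not> int CARD('p) dvd a" for a
  proof -
    have a1: "padic_norm (of_int a :: 'p padic) = 1" by (rule padic_norm_unit_of_int[OF a])
    have a0: "(of_int a :: 'p padic) \<noteq> 0" by (rule of_int_nonzero_of_not_dvd[OF a])
    have "padic_norm (x / of_int a) < 1"
      using nx a1 by (intro padic_norm_less_1I) (simp add: padic_norm_divide p_def)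
    from has_sum_cmult_left[OF binomial_series_neg[OF this, of j], of "inverse (of_int a) ^ j"]
    have "((\<lambda>k. ?g k a) has_sum inverse (1 + x / of_int a) ^ j * inverse (of_int a) ^ j) UNIV"
      by (simp add: power_divide power_add divide_inverse power_inverse power_mult_distrib mult_ac)
    also have "inverse (1 + x / of_int a) ^ j * inverse (of_int a) ^ j = inverse ((1 + x / of_int a) * of_int a) ^ j"
      by (simp add: power_mult_distrib)
    also have "(1 + x / of_int a) * of_int a = of_int (a + int (n * p))"
      using a0 by (simp add: x_def p_def field_simps)
    finally show ?thesis .
  qed
  have v: "has_volk (?g k) (?v k)" for k
    using j by (intro has_volk_cmult has_volk_volk_inverse_power) auto
  have b: "padic_norm (unit_sum (?g k) N / of_nat CARD('p) ^ N) \<le> (1 / real p) ^ k * real p" for k N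
    unfolding p_def
  proof (rule unit_sum_inverse_power_bound)
    have "padic_norm (x ^ k) \<le> (1 / real p) ^ k" unfolding padic_norm_power by (intro power_mono nx) simp
    from padic_norm_mult_le[OF padic_norm_gbinomial_le_1[OF cZ] this, of k]
    show "padic_norm ((?c gchoose k) * x ^ k) \<le> (1 / real CARD('p)) ^ k" by (simp add: p_def)
  qed
  have B: "(\<lambda>k. (1 / real p) ^ k * real p) \<longlonglongrightarrow> 0"
    using tendsto_mult_left_zero[OF one_over_CARD_power_tendsto_0[where 'p='p]] by (simp add: p_def power_one_over)
  note * = has_volk_has_sum[OF H v b B]
  have vj: "has_volk ?f (volk_inverse_power j)" by (rule has_volk_volk_inverse_power[OF j])
  have "has_volk (\<lambda>a. ?f (a + int (n * p)) - ?f a) (infsum ?v UNIV - volk_inverse_power j)"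
    using tendsto_diff[OF *(2)[unfolded has_volk_def] vj[unfolded has_volk_def]]
    by (simp add: has_volk_def unit_sum_def sum_subtractf diff_divide_distrib)
  hence "infsum ?v UNIV - volk_inverse_power j =
      (\<Sum>u | u < n * p \<and> coprime u CARD('p). - of_nat j * inverse (of_nat u) ^ Suc j)"
  proof (rule has_volk_shift[rotated])
    show "CARD('p) dvd n * p" by (simp add: p_def)
    fix u assume u: "coprime u CARD('p)"
    hence u0: "(of_nat u :: 'p padic) \<noteq> 0"
      using padic_norm_of_nat_eq_1_iff[of u, where 'p='p] by (metis padic_norm_0 zero_neq_one)
    let ?y = "\<lambda>N. inverse (of_nat u + P ^ N)"
    let ?z = "inverse (of_nat u) :: 'p padic"
    have "(\<lambda>N. of_nat u + P ^ N) \<longlonglongrightarrow> of_nat u + 0"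
      unfolding P_def p_def by (intro tendsto_add tendsto_const CARD_power_tendsto_0)
    hence y: "?y \<longlonglongrightarrow> ?z" using u0 by (intro tendsto_inverse_padic) auto
    \<comment> \<open>The difference quotient of \<open>u^(-j)\<close> with \<open>p^N\<close>
      already cancelled: \<open>y^j - z^j\<close> contains the factor
      \<open>y - z = - y z p^N\<close>.\<close>
    have "(\<lambda>N. - (?y N * ?z) * (\<Sum>i<j. ?z ^ (j - Suc i) * ?y N ^ i)) \<longlonglongrightarrow> - (?z * ?z) * (\<Sum>i<j. ?z ^ (j - Suc i) * ?z ^ i)"
      by (intro tendsto_mult_padic tendsto_minus tendsto_sum tendsto_power_padic tendsto_const y)
    also have "(\<Sum>i<j. ?z ^ (j - Suc i) * ?z ^ i) = of_nat j * ?z ^ (j - 1)"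
      by (simp flip: power_add)
    also have "- (?z * ?z) * (of_nat j * ?z ^ (j - 1)) = - of_nat j * ?z ^ Suc j"
      using j by (cases j) (simp_all add: algebra_simps)
    finally have L: "(\<lambda>N. - (?y N * ?z) * (\<Sum>i<j. ?z ^ (j - Suc i) * ?y N ^ i)) \<longlonglongrightarrow> - of_nat j * ?z ^ Suc j" .
    show "(\<lambda>N. (?f (int (u + CARD('p) ^ N)) - ?f (int u)) / of_nat CARD('p) ^ N) \<longlonglongrightarrow> - of_nat j * ?z ^ Suc j"
    proof (rule Lim_transform_eventually[OF L], rule always_eventually, rule allI)
      fix N
      have "(of_nat (u + p ^ N) :: 'p padic) \<noteq> 0" using p0 by (simp only: of_nat_eq_0_iff) simp
      hence n0: "of_nat u + P ^ N \<noteq> 0" by (simp add: P_def)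
      have "?f (int (u + CARD('p) ^ N)) - ?f (int u) = ?y N ^ j - ?z ^ j" by (simp add: P_def p_def)
      also have "\<dots> = (?y N - ?z) * (\<Sum>i<j. ?z ^ (j - Suc i) * ?y N ^ i)" by (rule power_diff_sumr2)
      also have "?y N - ?z = - (?y N * ?z) * P ^ N" using n0 u0 by (simp add: field_simps)
      finally show "- (?y N * ?z) * (\<Sum>i<j. ?z ^ (j - Suc i) * ?y N ^ i) =
          (?f (int (u + CARD('p) ^ N)) - ?f (int u)) / of_nat CARD('p) ^ N"
        using P0 by (simp add: P_def p_def)
    qed
  qed
  also have "\<dots> = - (of_nat j * coprime_power_sum (Suc j) (n * p))"
    using n p0 by (subst coprime_power_sum_eq) (auto simp: sum_distrib_left sum_negf[symmetric] Suc_leI)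
  finally have "infsum ?v UNIV = volk_inverse_power j - of_nat j * coprime_power_sum (Suc j) (n * CARD('p))"
    by (simp add: p_def algebra_simps)
  thus ?thesis using *(1) by simp
qed

section \<open>The logarithm\<close>

definition log_coeff :: "nat \<Rightarrow> 'p::prime_card padic" where
  "log_coeff k = (if k = 0 then 0 else (- 1) ^ (k - 1) / of_nat k)"

definition padic_log :: "'p::prime_card padic \<Rightarrow> 'p padic" where
  "padic_log w = (\<Sum>\<^sub>\<infinity>k. log_coeff k * (w - 1) ^ k)"

lemma padic_norm_inverse_of_nat_le: "padic_norm (1 / of_nat k :: 'p::prime_card padic) \<le> real k"
proof (cases "k = 0")
  case False
  have "1 / padic_norm (of_nat k :: 'p padic) \<le> 1 / (1 / real k)"
    using False by (intro frac_le padic_norm_of_nat_ge) auto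
  thus ?thesis by (simp add: padic_norm_divide)
qed simp

lemma padic_norm_log_coeff_le: "padic_norm (log_coeff k :: 'p::prime_card padic) \<le> real k"
proof (cases "k = 0")
  case False
  have "(log_coeff k :: 'p padic) = (- 1) ^ (k - 1) * (1 / of_nat k)" using False by (simp add: log_coeff_def)
  thus ?thesis using padic_norm_inverse_of_nat_le[of k, where 'p='p]
    by (simp only: padic_norm_mult padic_norm_power padic_norm_minus padic_norm_1 power_one mult_1)
qed (simp add: log_coeff_def)

lemma log_bound_tendsto: "(\<lambda>k. real k * (1 / real CARD('p::prime_card)) ^ k) \<longlonglongrightarrow> 0"
  using CARD_gt_1[where 'p='p] by (intro powser_times_n_limit_0) simp

lemma padic_norm_coeff_power_le:
  fixes y :: "'p::prime_card padic"
  assumes "padic_norm c \<le> real k" "padic_norm y \<le> 1 / real CARD('p)"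
  shows "padic_norm (c * y ^ k) \<le> real k * (1 / real CARD('p)) ^ k"
  by (intro padic_norm_mult_le assms(1)) (auto simp: padic_norm_power intro!: power_mono assms(2))

lemma padic_log_has_sum:
  fixes w :: "'p::prime_card padic"
  assumes w: "padic_norm (w - 1) \<le> 1 / real CARD('p)"
  shows "((\<lambda>k. log_coeff k * (w - 1) ^ k) has_sum padic_log w) UNIV"
  unfolding padic_log_def
proof (intro has_sum_infsum padic_summable_on_natI tendsto_0_padicI)
  show "\<forall>\<^sub>F k in sequentially. padic_norm (log_coeff k * (w - 1) ^ k) \<le> real k * (1 / real CARD('p)) ^ k"
    using padic_norm_coeff_power_le[OF padic_norm_log_coeff_le w] by simp
qed (rule log_bound_tendsto)

text \<open>The binomial coefficients of \<open>p^t\<close> divided by \<open>p^t\<close> tend to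
  the logarithm coefficients. This description makes the functional equation a matter of limits of
  powers.\<close>

lemma padic_log_limit:
  fixes w :: "'p::prime_card padic"
  assumes w: "padic_norm (w - 1) \<le> 1 / real CARD('p)"
  shows "(\<lambda>t. (w ^ (CARD('p) ^ t) - 1) / of_nat CARD('p) ^ t) \<longlonglongrightarrow> padic_log w"
proof -
  define y where "y = w - 1"
  let ?K = "\<lambda>t. CARD('p) ^ t"
  \<comment> \<open>This is the binomial coefficient of \<open>p^t\<close> over \<open>k\<close>
    divided by \<open>p^t\<close>, after absorption, which exhibits a bound \<open>k\<close>
    independent of \<open>t\<close>. The term \<open>k = 0\<close> is what the \<open>- 1\<close>
    removes.\<close>
  let ?d = "\<lambda>t k. if k = 0 then 0 else ((of_nat (?K t) - 1) gchoose (k - 1)) * (1 / of_nat k) :: 'p padic"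
  have K0: "(of_nat (?K t) :: 'p padic) \<noteq> 0" for t
    using prime_gt_0_nat[OF prime_card[where 'a='p]] by simp
  have eq: "(w ^ ?K t - 1) / of_nat CARD('p) ^ t = (\<Sum>\<^sub>\<infinity>k. ?d t k * y ^ k)" for t
  proof -
    have "((\<lambda>k. (of_nat (?K t) gchoose k) * y ^ k) has_sum (\<Sum>k\<le>?K t. (of_nat (?K t) gchoose k) * y ^ k)) UNIV"
      by (rule has_sum_finite_neutralI[of "{..?K t}"]) (auto simp: binomial_gbinomial[symmetric] simp del: of_nat_power)
    also have "(\<Sum>k\<le>?K t. (of_nat (?K t) gchoose k) * y ^ k) = w ^ ?K t"
      using binomial_ring[of y 1 "?K t"] by (simp add: y_def binomial_gbinomial)
    finally have "((\<lambda>k. (of_nat (?K t) gchoose k) * y ^ k + (if k = 0 then - 1 else 0)) has_sum w ^ ?K t + - 1) UNIV"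
      by (rule has_sum_add) (rule has_sum_finite_neutralI[of "{0}"], auto)
    hence "((\<lambda>k. inverse (of_nat (?K t)) * ((of_nat (?K t) gchoose k) * y ^ k + (if k = 0 then - 1 else 0))) has_sum
        inverse (of_nat (?K t)) * (w ^ ?K t + - 1)) UNIV"
      by (rule has_sum_cmult_right)
    also have "(\<lambda>k. inverse (of_nat (?K t)) * ((of_nat (?K t) gchoose k) * y ^ k + (if k = 0 then - 1 else 0))) = (\<lambda>k. ?d t k * y ^ k)"
    proof
      fix k
      show "inverse (of_nat (?K t)) * ((of_nat (?K t) gchoose k) * y ^ k + (if k = 0 then - 1 else 0)) = ?d t k * y ^ k"
      proof (cases k)
        case (Suc i)
        have "of_nat (Suc i) * (of_nat (?K t) gchoose Suc i) = of_nat (?K t) * ((of_nat (?K t) - 1) gchoose i :: 'p padic)"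
          by (rule gbinomial_absorption)
        hence "of_nat (?K t) gchoose Suc i = of_nat (?K t) * ((of_nat (?K t) - 1) gchoose i :: 'p padic) / of_nat (Suc i)"
          by (simp add: field_simps del: of_nat_Suc)
        thus ?thesis using Suc K0[of t] by (simp del: of_nat_Suc of_nat_power)
      qed simp
    qed
    finally show ?thesis by (simp add: infsumI divide_inverse mult.commute)
  qed
  have "(\<lambda>t. \<Sum>\<^sub>\<infinity>k. ?d t k * y ^ k) \<longlonglongrightarrow> (\<Sum>\<^sub>\<infinity>k. log_coeff k * y ^ k)"
  proof (rule tendsto_padic_infsum[where B = "\<lambda>k. real k * (1 / real CARD('p)) ^ k"])
    fix k :: nat
    show "(\<lambda>t. ?d t k * y ^ k) \<longlonglongrightarrow> log_coeff k * y ^ k"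
    proof (cases "k = 0")
      case False
      have "(\<lambda>t. of_nat (?K t) - 1 :: 'p padic) \<longlonglongrightarrow> 0 - 1"
        using CARD_power_tendsto_0[where 'p='p] by (intro tendsto_diff) simp_all
      hence "(\<lambda>t. (of_nat (?K t) - 1) gchoose (k - 1) :: 'p padic) \<longlonglongrightarrow> (- 1) gchoose (k - 1)"
        unfolding gbinomial_prod_rev by (intro tendsto_intros tendsto_prod_padic) simp_all
      also have "(- 1 :: 'p padic) gchoose (k - 1) = (- 1) ^ (k - 1)"
        using gbinomial_minus[of "1 :: 'p padic" "k - 1"] by (simp flip: binomial_gbinomial)
      finally have "(\<lambda>t. ((of_nat (?K t) - 1) gchoose (k - 1)) * (1 / of_nat k) * y ^ k) \<longlonglongrightarrow> (- 1) ^ (k - 1) * (1 / of_nat k) * y ^ k"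
        by (intro tendsto_mult_padic tendsto_const)
      thus ?thesis using False by (simp add: log_coeff_def)
    qed (simp add: log_coeff_def)
  next
    show "\<forall>\<^sub>F t in sequentially. \<forall>k\<in>UNIV. padic_norm (?d t k * y ^ k) \<le> real k * (1 / real CARD('p)) ^ k"
    proof (intro always_eventually allI ballI padic_norm_coeff_power_le)
      fix t k
      have "(of_nat (?K t) - 1 :: 'p padic) \<in> padic_integers"
        by (intro padic_integers_closed(2) padic_integers_of_nat padic_integers_0_1)
      from padic_norm_mult_le[OF padic_norm_gbinomial_le_1[OF this] padic_norm_inverse_of_nat_le]
      show "padic_norm (?d t k) \<le> real k" by simp
    qed (use w in \<open>simp add: y_def\<close>)
    show "finite {k \<in> UNIV. real k * (1 / real CARD('p)) ^ k \<ge> e}" if "e > 0" for e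
      by (rule finite_nat_ge_of_tendsto_0[OF log_bound_tendsto that])
  qed
  thus ?thesis unfolding eq padic_log_def y_def .
qed

text \<open>With \<open>K = p^t\<close>, split
  \<open>(w z)^K - 1 = (w^K - 1) z^K + (z^K - 1)\<close> and divide by \<open>p^t\<close>.\<close>

lemma padic_log_mult:
  fixes w z :: "'p::prime_card padic"
  assumes w: "padic_norm (w - 1) \<le> 1 / real CARD('p)" and z: "padic_norm (z - 1) \<le> 1 / real CARD('p)"
  shows "padic_log (w * z) = padic_log w + padic_log z"
proof -
  let ?K = "\<lambda>t. CARD('p) ^ t"
  let ?P = "\<lambda>t. of_nat CARD('p) ^ t :: 'p padic"
  have P0: "?P t \<noteq> 0" for t using prime_gt_0_nat[OF prime_card[where 'a='p]] by simp
  have nz: "padic_norm z = 1" using padic_norm_add_eq[of "z - 1" 1] padic_norm_less_1I[OF z] by simp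
  have "padic_norm (w * z - 1) \<le> 1 / real CARD('p)"
  proof -
    have "padic_norm ((w - 1) * z) \<le> 1 / real CARD('p)" using w nz by (simp add: padic_norm_mult)
    from padic_norm_add_le[OF this z] show ?thesis by (simp add: algebra_simps)
  qed
  note l = padic_log_limit[OF this]
  \<comment> \<open>The quotient converges and \<open>p^t\<close> tends to zero, so the powers of
    \<open>z\<close> tend to 1.\<close>
  have "(\<lambda>t. (z ^ ?K t - 1) / ?P t * ?P t + 1) \<longlonglongrightarrow> padic_log z * 0 + 1"
    by (intro tendsto_add tendsto_mult_padic padic_log_limit z CARD_power_tendsto_0 tendsto_const)
  hence z1: "(\<lambda>t. z ^ ?K t) \<longlonglongrightarrow> 1" using P0 by simp
  have "(\<lambda>t. (w ^ ?K t - 1) / ?P t * z ^ ?K t + (z ^ ?K t - 1) / ?P t) \<longlonglongrightarrow> padic_log w * 1 + padic_log z"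
    by (intro tendsto_add tendsto_mult_padic padic_log_limit w z z1)
  also have "(\<lambda>t. (w ^ ?K t - 1) / ?P t * z ^ ?K t + (z ^ ?K t - 1) / ?P t) = (\<lambda>t. ((w * z) ^ ?K t - 1) / ?P t)"
    using P0 by (auto simp: fun_eq_iff power_mult_distrib field_simps)
  finally show ?thesis using l LIMSEQ_unique by fastforce
qed

text \<open>The derivative of the logarithm at 1 along the steps \<open>p^N y\<close>: the term of
  degree \<open>k\<close> keeps a factor \<open>p^(N (k - 1))\<close>, so only the linear one
  survives.\<close>

lemma padic_log_near_1:
  fixes y :: "'p::prime_card padic"
  assumes y: "padic_norm y \<le> 1"
  shows "(\<lambda>N. padic_log (1 + of_nat CARD('p) ^ N * y) / of_nat CARD('p) ^ N) \<longlonglongrightarrow> y"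
proof -
  let ?P = "\<lambda>t. of_nat CARD('p) ^ t :: 'p padic"
  have P0: "?P t \<noteq> 0" for t using prime_gt_0_nat[OF prime_card[where 'a='p]] by simp
  let ?t = "\<lambda>N k. log_coeff k * (?P N * y) ^ k / ?P N"
  let ?B = "\<lambda>k. real CARD('p) * (real k * (1 / real CARD('p)) ^ k)"
  let ?g = "\<lambda>k::nat. if k = 1 then y else 0"
  have "(\<lambda>N. infsum (?t N) UNIV) \<longlonglongrightarrow> infsum ?g UNIV"
  proof (rule tendsto_padic_infsum[where B = ?B and f = ?t and g = ?g])
    fix k :: nat
    consider "k = 0" | "k = 1" | "k \<ge> 2" by linarith
    thus "(\<lambda>N. ?t N k) \<longlonglongrightarrow> ?g k"
    proof cases
      case 3
      have "?t N k = (log_coeff k * y ^ k) * ?P N ^ (k - 1)" for N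
        using P0[of N] 3 by (cases k) (auto simp: power_mult_distrib)
      moreover have "(\<lambda>N. (log_coeff k * y ^ k) * ?P N ^ (k - 1)) \<longlonglongrightarrow> (log_coeff k * y ^ k) * 0 ^ (k - 1)"
        by (intro tendsto_mult_padic tendsto_power_padic CARD_power_tendsto_0 tendsto_const)
      moreover have "(log_coeff k * y ^ k) * 0 ^ (k - 1) = 0" using 3 by simp
      ultimately have "(\<lambda>N. ?t N k) \<longlonglongrightarrow> 0" by (simp only:)
      thus ?thesis using 3 by simp
    qed (use P0 in \<open>auto simp: log_coeff_def\<close>)
  next
    show "\<forall>\<^sub>F N in sequentially. \<forall>k\<in>UNIV. padic_norm (?t N k) \<le> ?B k"
      using eventually_ge_at_top[of 1]
    proof eventually_elim
      case (elim N)
      show ?case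
      proof
        fix k
        have p1: "real CARD('p) > 1" by (rule CARD_gt_1)
        show "padic_norm (?t N k) \<le> ?B k"
        proof (cases "k = 0")
          case False
          have "?t N k = (log_coeff k * y ^ k) * ?P N ^ (k - 1)"
            using P0[of N] False by (cases k) (auto simp: power_mult_distrib)
          also have "padic_norm \<dots> \<le> (real k * 1) * (1 / real CARD('p)) ^ (k - 1)"
          proof (intro padic_norm_mult_le padic_norm_log_coeff_le)
            show "padic_norm (y ^ k) \<le> 1" using y by (simp add: padic_norm_power power_le_one)
            have "1 / real CARD('p) ^ N \<le> 1 / real CARD('p)"
              using p1 elim power_increasing[of 1 N "real CARD('p)"] by (intro frac_le) auto
            thus "padic_norm (?P N ^ (k - 1)) \<le> (1 / real CARD('p)) ^ (k - 1)"
              unfolding padic_norm_power[of _ "k - 1"] padic_norm_CARD_power using p1 by (intro power_mono) auto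
          qed
          also have "\<dots> = ?B k" using False p1 by (cases k) auto
          finally show ?thesis .
        qed (simp add: log_coeff_def)
      qed
    qed
    show "finite {k \<in> UNIV. ?B k \<ge> e}" if "e > 0" for e
      by (rule finite_nat_ge_of_tendsto_0[OF tendsto_mult_right_zero[OF log_bound_tendsto] that])
  qed
  moreover have "infsum ?g UNIV = y"
    using has_sum_finite_neutralI[of "{1::nat}" UNIV ?g] by (simp add: infsumI)
  moreover have "infsum (?t N) UNIV = padic_log (1 + ?P N * y) / ?P N" for N
    by (simp add: padic_log_def divide_inverse infsum_cmult_left')
  ultimately show ?thesis by simp
qed

text \<open>The logarithm series needs arguments near 1, hence
  \<open>log \<langle>a\<rangle>\<close> replaces \<open>log a\<close>. Translation by a multiple
  \<open>h\<close> of \<open>p\<close> leaves \<open>\<omega>(a)\<close> unchanged, so the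
  difference is still \<open>log (1 + h / a)\<close>.\<close>

lemma power_sum_series_1:
  fixes n :: nat
  assumes n: "n \<ge> 1"
  defines "x \<equiv> of_nat (n * CARD('p)) :: 'p::prime_card padic"
  shows "((\<lambda>k. log_coeff k * x ^ k * volk_inverse_power k) has_sum coprime_power_sum 1 (n * CARD('p))) UNIV"
proof -
  define p where "p = CARD('p)"
  have p0: "p > 0" using prime_gt_0_nat[OF prime_card[where 'a='p]] by (simp add: p_def)
  have nx: "padic_norm x \<le> 1 / real p"
    using padic_norm_mult_le[OF padic_norm_of_nat_le_1[of n, where 'p='p] eq_refl[OF padic_norm_CARD]]
    by (simp add: x_def p_def)
  let ?f = "\<lambda>a. padic_log (one_unit a) :: 'p padic"
  let ?g = "\<lambda>k a. (log_coeff k * x ^ k) * inverse (of_int a) ^ k :: 'p padic"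
  let ?v = "\<lambda>k. log_coeff k * x ^ k * volk_inverse_power k :: 'p padic"
  have diff: "?f (a + h) - ?f a = padic_log (1 + of_int h * inverse (of_int a))"
    if a: "\<not> int CARD('p) dvd a" and h: "int CARD('p) dvd h" for a h
  proof -
    have a1: "padic_norm (of_int a :: 'p padic) = 1" by (rule padic_norm_unit_of_int[OF a])
    have a0: "(of_int a :: 'p padic) \<noteq> 0" by (rule of_int_nonzero_of_not_dvd[OF a])
    have nh: "padic_norm (of_int h :: 'p padic) \<le> 1 / real CARD('p)" using h by (simp only: padic_norm_of_int_le_inverse_iff)
    have "one_unit (a + h) = (one_unit a * (1 + of_int h * inverse (of_int a)) :: 'p padic)"
    proof -
      have "teich_char 1 (a + h) = (teich_char 1 a :: 'p padic)"
        by (rule teich_char_cong) (use h in \<open>simp add: cong_iff_dvd_diff\<close>)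
      thus ?thesis using a0 by (simp add: one_unit_def field_simps)
    qed
    moreover have "padic_norm ((1 + of_int h * inverse (of_int a)) - 1 :: 'p padic) \<le> 1 / real CARD('p)"
      using nh a1 by (simp add: padic_norm_mult padic_norm_inverse)
    ultimately show ?thesis using padic_log_mult[OF one_unit_near_1[OF a]] by simp
  qed
  have dp: "int CARD('p) dvd int (n * p)" by (simp add: p_def)
  have H: "((\<lambda>k. ?g k a) has_sum ?f (a + int (n * p)) - ?f a) UNIV" if a: "\<not> int CARD('p) dvd a" for a
  proof -
    have a1: "padic_norm (of_int a :: 'p padic) = 1" by (rule padic_norm_unit_of_int[OF a])
    let ?w = "1 + of_int (int (n * p)) * inverse (of_int a) :: 'p padic"
    have w: "?w - 1 = x * inverse (of_int a)" by (simp add: x_def p_def)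
    have "padic_norm (?w - 1) \<le> 1 / real CARD('p)"
      unfolding w using nx a1 by (simp add: padic_norm_mult padic_norm_inverse p_def)
    from padic_log_has_sum[OF this] show ?thesis
      unfolding w diff[OF a dp] by (simp add: power_mult_distrib mult.assoc)
  qed
  have v: "has_volk (?g k) (?v k)" for k
  proof (cases "k = 0")
    case True
    thus ?thesis by (simp add: log_coeff_def has_volk_def unit_sum_def)
  next
    case False
    thus ?thesis by (intro has_volk_cmult has_volk_volk_inverse_power) auto
  qed
  have b: "padic_norm (unit_sum (?g k) N / of_nat CARD('p) ^ N) \<le> real k * (1 / real CARD('p)) ^ k * real CARD('p)" for k N
    by (intro unit_sum_inverse_power_bound padic_norm_coeff_power_le padic_norm_log_coeff_le) (use nx in \<open>simp add: p_def\<close>)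
  have B: "(\<lambda>k. real k * (1 / real CARD('p)) ^ k * real CARD('p)) \<longlonglongrightarrow> 0"
    by (rule tendsto_mult_left_zero[OF log_bound_tendsto])
  note * = has_volk_has_sum[OF H v b B]
  have "infsum ?v UNIV = (\<Sum>u | u < n * p \<and> coprime u CARD('p). inverse (of_nat u))"
  proof (rule has_volk_shift[OF _ *(2)])
    show "CARD('p) dvd n * p" by (simp add: p_def)
    fix u assume u: "coprime u CARD('p)"
    hence u1: "padic_norm (inverse (of_nat u) :: 'p padic) = 1"
      by (simp add: padic_norm_inverse padic_norm_of_nat_eq_1_iff[THEN iffD2])
    have "?f (int (u + CARD('p) ^ N)) - ?f (int u) = padic_log (1 + of_nat CARD('p) ^ N * inverse (of_nat u))" if "N \<ge> 1" for N
    proof -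
      have "int CARD('p) dvd int CARD('p) ^ N" using that by (intro dvd_power) auto
      thus ?thesis using diff[of "int u" "int CARD('p) ^ N"] u by (simp add: coprime_CARD_iff)
    qed
    thus "(\<lambda>N. (?f (int (u + CARD('p) ^ N)) - ?f (int u)) / of_nat CARD('p) ^ N) \<longlonglongrightarrow> inverse (of_nat u)"
      using padic_log_near_1[OF eq_refl[OF u1]]
      by (elim Lim_transform_eventually) (auto simp: eventually_sequentially intro!: exI[of _ 1])
  qed
  also have "\<dots> = coprime_power_sum 1 (n * CARD('p))"
    using n p0 by (subst coprime_power_sum_eq) (auto simp: p_def Suc_leI)
  finally show ?thesis using *(1) by simp
qed

section \<open>Reindexing by even integrals and the final form of the series\<close>

lemma has_sum_from_1:
  fixes f :: "nat \<Rightarrow> 'p::prime_card padic"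
  assumes "(f has_sum S) UNIV"
  shows "(f has_sum S - f 0) {1..}"
proof -
  have "{1..} = range Suc" by (auto simp: image_iff) (metis Suc_le_D)
  thus ?thesis using has_sum_Suc_shift[OF assms] has_sum_reindex[of Suc UNIV f "S - f 0"] by (simp add: o_def)
qed

text \<open>The term of degree \<open>k\<close> contains the integral with index
  \<open>l - 1 + k\<close>. Only even indices \<open>2 m\<close> survive, that is
  \<open>k = 1 + 2 m - l\<close>.\<close>

lemma has_sum_even_reindex:
  fixes F :: "nat \<Rightarrow> 'p::prime_card padic"
  assumes F: "(F has_sum S) {1..}" and odd: "\<And>k. k \<ge> 1 \<Longrightarrow> odd (l - 1 + k) \<Longrightarrow> F k = 0" and l: "l \<ge> 1"
  shows "((\<lambda>m. F (1 + 2 * m - l)) has_sum S) {m. real m \<ge> real l / 2}"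
proof -
  let ?M = "{m. real m \<ge> real l / 2}"
  have M: "m \<in> ?M \<longleftrightarrow> l \<le> 2 * m" for m by auto
  have "(F has_sum S) ((\<lambda>m. 1 + 2 * m - l) ` ?M) \<longleftrightarrow> (F has_sum S) {1..}"
  proof (rule has_sum_cong_neutral)
    fix k assume k: "k \<in> {1..} - (\<lambda>m. 1 + 2 * m - l) ` ?M"
    have "odd (l - 1 + k)"
    proof
      assume "even (l - 1 + k)"
      then obtain m where m: "l - 1 + k = 2 * m" by blast
      hence "m \<in> ?M" "k = 1 + 2 * m - l" using k l unfolding M by auto
      thus False using k by blast
    qed
    thus "F k = 0" using k by (intro odd) auto
  next
    fix k assume k: "k \<in> (\<lambda>m. 1 + 2 * m - l) ` ?M - {1..}"
    then obtain m where "m \<in> ?M" "k = 1 + 2 * m - l" by blast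
    hence "k \<ge> 1" unfolding M by linarith
    thus "F k = 0" using k by auto
  qed auto
  moreover have "inj_on (\<lambda>m. 1 + 2 * m - l) ?M" unfolding inj_on_def M by auto
  ultimately show ?thesis using F has_sum_reindex[of "\<lambda>m. 1 + 2 * m - l" ?M F S] by (simp add: o_def)
qed

lemma coprime_power_sum_series:
  fixes n l :: nat
  assumes n: "n \<ge> 1" and l: "l \<ge> 1" and p2: "CARD('p::prime_card) \<noteq> 2"
  defines "x \<equiv> of_nat (n * CARD('p)) :: 'p padic"
  shows "((\<lambda>m. - (of_nat ((1 + 2 * m) choose l) * x ^ (1 + 2 * m - l) *
      (padic_L (teich_char (2 * m)) (of_nat (1 + 2 * m)) / of_nat (1 + 2 * m)))) has_sum
      (- 1) ^ (l - 1) / of_nat l * coprime_power_sum l (n * CARD('p))) {m. real m \<ge> real l / 2}"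
    (is "(?T has_sum ?S) ?M")
proof -
  let ?V = "volk_inverse_power :: nat \<Rightarrow> 'p padic"
  have M: "m \<in> ?M \<longleftrightarrow> l \<le> 2 * m" for m by auto
  \<comment> \<open>Both integrands are brought to one form: a series in the degree
    \<open>k \<ge> 1\<close> of \<open>x\<close>, supported where \<open>l - 1 + k\<close> is
    even.\<close>
  have ex: "\<exists>F. (F has_sum ?S) {1..} \<and> (\<forall>k\<ge>1. odd (l - 1 + k) \<longrightarrow> F k = 0) \<and>
      (\<forall>m\<in>?M. F (1 + 2 * m - l) = ?T m)"
  proof (cases "l = 1")
    case True
    let ?F = "\<lambda>k. log_coeff k * x ^ k * ?V k"
    have "(?F has_sum ?S) {1..}"
      using has_sum_from_1[OF power_sum_series_1[OF n, where 'p='p]] True by (simp add: x_def log_coeff_def)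
    moreover have "?F k = 0" if "odd (l - 1 + k)" for k
      using volk_inverse_power_odd[of k, where 'p='p] that True p2 by simp
    moreover have "?F (1 + 2 * m - l) = ?T m" if m: "m \<in> ?M" for m
    proof -
      have m1: "m \<ge> 1" using m True unfolding M by linarith
      define L where "L = padic_L (teich_char (2 * m)) (of_nat (1 + 2 * m) :: 'p padic)"
      have "of_nat (2 * m) \<noteq> (0 :: 'p padic)" "of_nat (1 + 2 * m) \<noteq> (0 :: 'p padic)" using m1 by (simp_all only: of_nat_eq_0_iff)
      moreover have "odd (2 * m - 1)" using m1 by (simp add: even_diff_nat)
      ultimately have "log_coeff (2 * m) * ?V (2 * m) = - L"
        using m1 by (simp add: log_coeff_def volk_inverse_power_def L_def del: of_nat_mult of_nat_add)
      moreover have "?F (2 * m) = x ^ (2 * m) * (log_coeff (2 * m) * ?V (2 * m))" by (simp only: mult_ac)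
      ultimately have Feq: "?F (2 * m) = - (x ^ (2 * m) * L)" by (simp only: mult_minus_right)
      have "?T m = - (of_nat (1 + 2 * m) * x ^ (2 * m) * (L / of_nat (1 + 2 * m)))"
        unfolding True L_def by (simp only: choose_one add_diff_cancel_left')
      also have "of_nat (1 + 2 * m) * x ^ (2 * m) * (L / of_nat (1 + 2 * m)) = x ^ (2 * m) * L"
      proof -
        have "w * y * (L / w) = y * L" if "w \<noteq> 0" for w y using that by simp
        thus ?thesis using \<open>of_nat (1 + 2 * m) \<noteq> 0\<close> by blast
      qed
      finally have Teq: "?T m = - (x ^ (2 * m) * L)" .
      have e: "1 + 2 * m - l = 2 * m" using True by simp
      show ?thesis unfolding Teq unfolding e by (rule Feq)
    qed
    ultimately show ?thesis by (intro exI[of _ ?F]) blast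
  next
    case False
    define j where "j = l - 1"
    have j: "j \<ge> 1" "l = Suc j" using False l by (auto simp: j_def)
    \<comment> \<open>Cancels the factor \<open>- j\<close> coming from the derivative of
      \<open>u^(-j)\<close> and installs \<open>(-1)^(l-1) / l\<close>.\<close>
    define c :: "'p padic" where "c = (- 1) ^ j / of_nat l * (- inverse (of_nat j))"
    have j0: "(of_nat j :: 'p padic) \<noteq> 0" and l0: "(of_nat l :: 'p padic) \<noteq> 0" using j(1) l by (simp_all only: of_nat_eq_0_iff)
    let ?F = "\<lambda>k. c * (((- of_nat j) gchoose k) * x ^ k * ?V (j + k))"
    \<comment> \<open>The term of degree 0 is the integral of \<open>u^(-j)\<close> and cancels the
      same quantity in the sum.\<close>
    have "((\<lambda>k. ((- of_nat j) gchoose k) * x ^ k * ?V (j + k)) has_sum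
        - (of_nat j * coprime_power_sum l (n * CARD('p)))) {1..}"
      using has_sum_from_1[OF power_sum_series_ge_2[OF j(1) n, where 'p='p]] by (simp add: x_def j(2))
    from has_sum_cmult_right[OF this, of c]
    have "(?F has_sum c * - (of_nat j * coprime_power_sum l (n * CARD('p)))) {1..}" .
    moreover have "c * - (of_nat j * coprime_power_sum l (n * CARD('p))) = ?S"
      unfolding c_def j_def[symmetric] using j0 by simp
    ultimately have "(?F has_sum ?S) {1..}" by (simp only:)
    moreover have "?F k = 0" if "odd (l - 1 + k)" for k
      using volk_inverse_power_odd[of "j + k", where 'p='p] that p2 by (simp add: j_def)
    moreover have "?F (1 + 2 * m - l) = ?T m" if m: "m \<in> ?M" for m
    proof -
      define k where "k = 1 + 2 * m - l"
      define L where "L = padic_L (teich_char (2 * m)) (of_nat (1 + 2 * m) :: 'p padic)"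
      have m1: "m \<ge> 1" "l \<le> 2 * m" using m l unfolding M by auto
      have k1: "k \<ge> 1" "j + k = 2 * m" using m1 j by (auto simp: k_def)
      have V: "?V (j + k) = of_nat (2 * m) * L" unfolding k1(2) volk_inverse_power_def L_def by simp
      have "(- of_nat j :: 'p padic) gchoose k = (- 1) ^ k * ((of_nat j + of_nat k - 1) gchoose k)"
        by (rule gbinomial_minus)
      also have "(of_nat j + of_nat k - 1 :: 'p padic) = of_nat (2 * m - 1)"
        unfolding of_nat_add[symmetric] k1(2) using m1 of_nat_diff[of 1 "2 * m"] by simp
      also have "(of_nat (2 * m - 1) :: 'p padic) gchoose k = of_nat ((2 * m - 1) choose k)"
        by (simp add: binomial_gbinomial)
      also have "(2 * m - 1) choose k = (2 * m - 1) choose (j - 1)"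
      proof -
        have "2 * m - 1 - k = j - 1" "k \<le> 2 * m - 1" using k1 j by auto
        thus ?thesis by (metis binomial_symmetric)
      qed
      finally have g: "(- of_nat j :: 'p padic) gchoose k = (- 1) ^ k * of_nat ((2 * m - 1) choose (j - 1))" .
      \<comment> \<open>Two absorptions lower the binomial coefficient of \<open>1 + 2 m\<close>
        over \<open>l\<close> to that of \<open>2 m - 1\<close> over \<open>j - 1\<close>, which the
        expansion produces.\<close>
      have e1: "l * ((1 + 2 * m) choose l) = (1 + 2 * m) * ((2 * m) choose j)"
        using binomial_absorption[of j "1 + 2 * m"] by (simp add: j(2))
      have e2: "j * ((2 * m) choose j) = 2 * m * ((2 * m - 1) choose (j - 1))"
        using binomial_absorption[of "j - 1" "2 * m"] j(1) by simp
      have "of_nat (l * ((1 + 2 * m) choose l)) * of_nat j = (of_nat (1 + 2 * m) * of_nat (2 * m * ((2 * m - 1) choose (j - 1))) :: 'p padic)"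
        unfolding e1 e2[symmetric] by (simp only: of_nat_mult mult_ac)
      hence E: "of_nat ((1 + 2 * m) choose l) / of_nat (1 + 2 * m) =
          (of_nat (2 * m) * of_nat ((2 * m - 1) choose (j - 1)) / (of_nat l * of_nat j) :: 'p padic)"
        using l0 j0 of_nat_neq_0[of "2 * m", where 'a = "'p padic"] unfolding of_nat_mult by (simp add: field_simps del: of_nat_Suc)
      have "(- 1) ^ j * (- 1) ^ k = (1 :: 'p padic)" unfolding power_add[symmetric] k1(2) by simp
      hence s: "c * ((- 1) ^ k * y) = - (y / (of_nat l * of_nat j))" for y
        by (simp add: c_def divide_inverse mult_ac)
      have "?F k = (c * ((- 1) ^ k * (of_nat (2 * m) * of_nat ((2 * m - 1) choose (j - 1))))) * (x ^ k * L)"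
        unfolding V g by (simp only: mult_ac)
      also have "\<dots> = - (of_nat ((1 + 2 * m) choose l) / of_nat (1 + 2 * m)) * (x ^ k * L)"
        unfolding s E ..
      also have "\<dots> = ?T m" unfolding k_def L_def by (simp only: divide_inverse mult_ac mult_minus_left mult_minus_right)
      finally show ?thesis by (simp only: k_def)
    qed
    ultimately show ?thesis by (intro exI[of _ ?F]) blast
  qed
  then obtain F where F: "(F has_sum ?S) {1..}" "\<And>k. k \<ge> 1 \<Longrightarrow> odd (l - 1 + k) \<Longrightarrow> F k = 0"
    "\<And>m. m \<in> ?M \<Longrightarrow> F (1 + 2 * m - l) = ?T m" by blast
  have "((\<lambda>m. F (1 + 2 * m - l)) has_sum ?S) ?M" by (rule has_sum_even_reindex[OF F(1,2) l])
  thus ?thesis by (rule has_sum_cong[THEN iffD1, rotated]) (use F(3) in auto)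
qed

section \<open>Morita's Gamma function on the natural numbers\<close>

definition gamma_int :: "nat \<Rightarrow> nat \<Rightarrow> int" where
  "gamma_int p n = (- 1) ^ n * (\<Prod>i | i < n \<and> coprime i p. int i)"

text \<open>For \<open>y\<close> divisible by \<open>p\<close> this is the quotient
  \<open>Gamma_p (y + A) / Gamma_p y\<close>, a polynomial in \<open>y\<close>. The ring is generic
  because it is formed over integers, integer polynomials, \<open>p\<close>-adic numbers and power
  series.\<close>

definition gamma_shift :: "nat \<Rightarrow> nat \<Rightarrow> 'a::comm_ring_1 \<Rightarrow> 'a" where
  "gamma_shift p A y = (- 1) ^ A * (\<Prod>i | i < A \<and> coprime i p. y + of_nat i)"

lemma coprime_less_Suc:
  "{i. i < Suc n \<and> coprime i p} = (if coprime n p then insert n {i. i < n \<and> coprime i p} else {i. i < n \<and> coprime i p})"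
  by (auto simp: less_Suc_eq)

lemma gamma_int_0 [simp]: "gamma_int p 0 = 1"
  by (simp add: gamma_int_def)

lemma gamma_int_Suc: "gamma_int p (Suc n) = (if coprime n p then - int n * gamma_int p n else - gamma_int p n)"
  by (simp add: gamma_int_def coprime_less_Suc)

lemma gamma_shift_0 [simp]: "gamma_shift p 0 y = 1"
  by (simp add: gamma_shift_def)

lemma gamma_shift_Suc:
  "gamma_shift p (Suc A) y = (if coprime A p then - (y + of_nat A) * gamma_shift p A y else - gamma_shift p A y)"
  by (simp add: gamma_shift_def coprime_less_Suc algebra_simps)

lemma gamma_int_eq_shift: "gamma_int p n = gamma_shift p n 0"
  by (simp add: gamma_int_def gamma_shift_def)

lemma gamma_int_add:
  assumes "p dvd n"
  shows "gamma_int p (n + A) = gamma_int p n * gamma_shift p A (int n)"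
proof -
  obtain M where M: "n = p * M" using assms by blast
  have "coprime (n + A) p \<longleftrightarrow> coprime A p" for A
    unfolding M by (metis coprime_commute coprime_iff_gcd_eq_1 gcd_add_mult add.commute mult.commute)
  thus ?thesis by (induction A) (auto simp: gamma_int_Suc gamma_shift_Suc algebra_simps)
qed

text \<open>Expansion at 0 to first order, one factor at a time. It describes a block of factors
  modulo any number dividing the square of its offset.\<close>

lemma gamma_shift_linear:
  fixes p A :: nat
  obtains b where "\<And>y :: int. y ^ 2 dvd gamma_shift p A y - (gamma_int p A + b * y)"
proof -
  have "\<exists>b. \<forall>y :: int. y ^ 2 dvd gamma_shift p A y - (gamma_int p A + b * y)"
  proof (induction A)
    case 0
    show ?case by (intro exI[of _ 0]) simp
  next
    case (Suc A)
    then obtain b where b: "\<And>y :: int. y ^ 2 dvd gamma_shift p A y - (gamma_int p A + b * y)" by blast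
    show ?case
    proof (cases "coprime A p")
      case True
      have "y ^ 2 dvd gamma_shift p (Suc A) y - (gamma_int p (Suc A) + (- gamma_int p A - int A * b) * y)" for y :: int
      proof -
        have "gamma_shift p (Suc A) y - (gamma_int p (Suc A) + (- gamma_int p A - int A * b) * y) =
          - (y + int A) * (gamma_shift p A y - (gamma_int p A + b * y)) - y ^ 2 * b"
          using True by (simp add: gamma_shift_Suc gamma_int_Suc algebra_simps power2_eq_square)
        thus ?thesis using b[of y] by (simp add: dvd_diff)
      qed
      thus ?thesis by blast
    next
      case False
      have "y ^ 2 dvd gamma_shift p (Suc A) y - (gamma_int p (Suc A) + (- b) * y)" for y :: int
      proof -
        have "gamma_shift p (Suc A) y - (gamma_int p (Suc A) + (- b) * y) = - (gamma_shift p A y - (gamma_int p A + b * y))"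
          using False by (simp add: gamma_shift_Suc gamma_int_Suc)
        thus ?thesis using b[of y] by (simp only: dvd_minus_iff)
      qed
      thus ?thesis by blast
    qed
  qed
  thus ?thesis using that by blast
qed

text \<open>Terms of second order in \<open>w\<close> vanish modulo \<open>M\<close>, so constant
  and linear parts are all that accumulates.\<close>

lemma prod_linear_cong:
  fixes u w :: int
  assumes "M dvd w ^ 2"
  shows "[(\<Prod>c<n. u + int c * w) = u ^ n + u ^ (n - 1) * w * (\<Sum>c<n. int c)] (mod M)"
proof (induction n)
  case (Suc n)
  let ?s = "\<Sum>c<n. int c"
  have "[(\<Prod>c<Suc n. u + int c * w) = (u ^ n + u ^ (n - 1) * w * ?s) * (u + int n * w)] (mod M)"
    using cong_mult[OF Suc.IH cong_refl] by simp
  also have "(u ^ n + u ^ (n - 1) * w * ?s) * (u + int n * w) =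
      (u ^ Suc n + u ^ n * w * (\<Sum>c<Suc n. int c)) + w ^ 2 * (u ^ (n - 1) * int n * ?s)"
    by (cases n) (simp_all add: algebra_simps power2_eq_square)
  also have "[\<dots> = u ^ Suc n + u ^ n * w * (\<Sum>c<Suc n. int c)] (mod M)"
    using assms by (simp add: cong_iff_dvd_diff)
  finally show ?case by simp
qed simp

lemma sum_lessThan_odd_dvd:
  assumes "odd p" shows "int p dvd (\<Sum>c<p. int c)"
proof -
  have "2 * (\<Sum>c<p. int c) = int p * (int p - 1)"
    by (induction p) (auto simp: algebra_simps)
  also have "\<dots> = 2 * (int p * ((int p - 1) div 2))"
    using assms by (auto elim!: oddE)
  finally show ?thesis by simp
qed

lemma gamma_int_mult:
  assumes "p dvd A"
  shows "gamma_int p (n * A) = (\<Prod>c<n. gamma_shift p A (int (c * A)))"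
proof (induction n)
  case (Suc n)
  have "gamma_int p (n * A + A) = gamma_int p (n * A) * gamma_shift p A (int (n * A))"
    using assms by (intro gamma_int_add) simp
  thus ?case using Suc by (simp add: add.commute mult.commute)
qed simp

text \<open>Wilson's theorem modulo powers of \<open>p\<close>.\<close>

lemma gamma_int_CARD_power:
  assumes p2: "CARD('p::prime_card) \<noteq> 2"
  shows "padic_norm (of_int (gamma_int CARD('p) (CARD('p) ^ Suc k)) - 1 :: 'p padic) \<le> 1 / real CARD('p) ^ Suc k"
proof (induction k)
  case 0
  define p where "p = CARD('p)"
  have p: "prime p" "odd p" using prime_card[where 'a='p] p2 prime_odd_nat[of p] prime_ge_2_nat[of p]
    by (simp_all add: p_def)
  have "{i. i < p \<and> coprime i p} = {1..p - 1}"
  proof (intro equalityI subsetI)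
    fix i assume i: "i \<in> {i. i < p \<and> coprime i p}"
    hence "i \<noteq> 0" using p by (metis coprime_0_left_iff mem_Collect_eq not_prime_unit)
    thus "i \<in> {1..p - 1}" using i by auto
  next
    fix i assume i: "i \<in> {1..p - 1}"
    hence "\<not> p dvd i" by (auto dest: dvd_imp_le)
    thus "i \<in> {i. i < p \<and> coprime i p}" using i prime_imp_coprime[OF p(1), of i] by (auto simp: coprime_commute)
  qed
  \<comment> \<open>For odd \<open>p\<close> the sign \<open>(-1)^p\<close> cancels the
    \<open>-1\<close> of Wilson's theorem.\<close>
  hence "gamma_int p p = - fact (p - 1)" using p by (simp add: gamma_int_def fact_prod)
  moreover have "[fact (p - 1) = - 1 :: int] (mod int p)" by (rule wilson_theorem[OF p(1)])
  ultimately have "int p dvd gamma_int p p - 1" 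
    by (simp add: cong_iff_dvd_diff) (metis dvd_minus_iff minus_add_distrib uminus_add_conv_diff add.commute)
  thus ?case using padic_norm_of_int_le_iff[of "gamma_int p p - 1" 1, where 'p='p] by (simp add: p_def)
next
  case (Suc k)
  define p where "p = CARD('p)"
  have p: "prime p" "odd p" using prime_card[where 'a='p] p2 prime_odd_nat[of p] prime_ge_2_nat[of p]
    by (simp_all add: p_def)
  define A where "A = p ^ Suc k"
  define u where "u = gamma_int p A"
  let ?M = "int p ^ Suc (Suc k)"
  have M: "?M dvd int A ^ 2"
    unfolding A_def of_nat_power power_mult[symmetric] by (intro le_imp_power_dvd) simp
  obtain b where b: "\<And>y :: int. y ^ 2 dvd gamma_shift p A y - (u + b * y)"
    unfolding u_def using gamma_shift_linear[of p A] by blast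
  \<comment> \<open>Cut the product into \<open>p\<close> blocks of length \<open>A\<close>. Modulo
    \<open>p^(k+2)\<close> the block with offset \<open>c A\<close> is \<open>u + c b A\<close>; the
    linear terms sum to a multiple of \<open>p A\<close>, leaving \<open>u^p\<close>, and the
    \<open>p\<close>-th power improves the congruence of \<open>u\<close> to 1 by a digit.\<close>
  have "gamma_int p (p ^ Suc (Suc k)) = gamma_int p (p * A)" by (simp add: A_def)
  also have "\<dots> = (\<Prod>c<p. gamma_shift p A (int (c * A)))" by (rule gamma_int_mult) (simp add: A_def)
  also have "[\<dots> = (\<Prod>c<p. u + int c * (b * int A))] (mod ?M)"
  proof (rule cong_prod)
    fix c
    have "?M dvd int (c * A) ^ 2" using M by (simp add: power_mult_distrib)
    hence "?M dvd gamma_shift p A (int (c * A)) - (u + b * int (c * A))" using b dvd_trans by blast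
    thus "[gamma_shift p A (int (c * A)) = u + int c * (b * int A)] (mod ?M)"
      by (simp add: cong_iff_dvd_diff mult_ac)
  qed
  also have "[(\<Prod>c<p. u + int c * (b * int A)) = u ^ p + u ^ (p - 1) * (b * int A) * (\<Sum>c<p. int c)] (mod ?M)"
    using M by (intro prod_linear_cong) (simp add: power_mult_distrib)
  also have "[u ^ p + u ^ (p - 1) * (b * int A) * (\<Sum>c<p. int c) = u ^ p] (mod ?M)"
  proof -
    have "?M = int A * int p" by (simp add: A_def mult_ac)
    also have "\<dots> dvd (int A * (\<Sum>c<p. int c)) * (u ^ (p - 1) * b)"
      using sum_lessThan_odd_dvd[OF p(2)] by (intro dvd_mult2 mult_dvd_mono) auto
    finally show ?thesis by (simp add: cong_iff_dvd_diff mult_ac)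
  qed
  finally have "?M dvd gamma_int p (p ^ Suc (Suc k)) - u ^ p" by (simp only: cong_iff_dvd_diff)
  hence 1: "padic_norm (of_int (gamma_int p (p ^ Suc (Suc k)) - u ^ p) :: 'p padic) \<le> 1 / real p ^ Suc (Suc k)"
    unfolding p_def by (simp only: padic_norm_of_int_le_iff)
  have "padic_norm (of_int u - 1 :: 'p padic) \<le> 1 / real p ^ Suc k"
    using Suc.IH by (simp only: u_def A_def p_def)
  hence 2: "padic_norm (of_int u ^ p - 1 ^ p :: 'p padic) \<le> 1 / real p ^ Suc (Suc k)"
    unfolding p_def by (intro padic_norm_power_CARD_diff) auto
  from padic_norm_add_le[OF 1 2] show ?case by (simp add: p_def)
qed

lemma gamma_shift_cong:
  fixes x y :: "'p::prime_card padic"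
  assumes "x \<in> padic_integers" "y \<in> padic_integers"
  shows "padic_norm (gamma_shift p A x) \<le> 1" "padic_norm (gamma_shift p A x - gamma_shift p A y) \<le> padic_norm (x - y)"
proof -
  have s1: "padic_norm (z + of_nat A) \<le> 1" if "z \<in> padic_integers" for z :: "'p padic" and A
    using that by (intro padic_norm_add_le) (auto simp: padic_integers_def)
  have n1: "padic_norm (gamma_shift p A z) \<le> 1" if "z \<in> padic_integers" for z :: "'p padic"
    using s1[OF that] by (induction A) (auto simp: gamma_shift_Suc padic_norm_mult simp del: minus_add_distrib intro!: mult_le_one)
  show "padic_norm (gamma_shift p A x) \<le> 1" by (rule n1[OF assms(1)])
  have gs1: "padic_norm (gamma_shift p A y) \<le> 1" for A
    using s1[OF assms(2)] by (induction A) (auto simp: gamma_shift_Suc padic_norm_mult simp del: minus_add_distrib intro!: mult_le_one)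
  show "padic_norm (gamma_shift p A x - gamma_shift p A y) \<le> padic_norm (x - y)"
  proof (induction A)
    case (Suc A)
    show ?case
    proof (cases "coprime A p")
      case True
      have "gamma_shift p (Suc A) x - gamma_shift p (Suc A) y =
         - ((x + of_nat A) * (gamma_shift p A x - gamma_shift p A y)) - (x - y) * gamma_shift p A y"
        using True by (simp add: gamma_shift_Suc algebra_simps)
      also have "padic_norm \<dots> \<le> padic_norm (x - y)"
        using padic_norm_mult_le[OF s1[OF assms(1)] Suc.IH, of A]
          padic_norm_mult_le[OF order.refl[of "padic_norm (x - y)"], of "gamma_shift p A y" 1]
          gs1[of A] by (intro padic_norm_diff_le) simp_all
      finally show ?thesis .
    next
      case False
      thus ?thesis using Suc.IH by (simp add: gamma_shift_Suc padic_norm_minus_commute)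
    qed
  qed simp
qed

section \<open>Morita's Gamma function\<close>

lemma gamma_int_norm_le: "padic_norm (of_int (gamma_int p n) :: 'p::prime_card padic) \<le> 1"
  by (rule padic_norm_of_int_le_1)

lemma of_int_gamma_shift: "of_int (gamma_shift p A y) = gamma_shift p A (of_int y)"
  by (simp add: gamma_shift_def)

text \<open>The first \<open>p^k\<close> factors contribute 1 modulo \<open>p^k\<close> by the
  Wilson congruence. The remaining ones form the shift polynomial at \<open>p^k\<close>, which
  agrees modulo \<open>p^k\<close> with its value at 0.\<close>

lemma gamma_int_add_CARD_power:
  assumes p2: "CARD('p::prime_card) \<noteq> 2"
  shows "padic_norm (of_int (gamma_int CARD('p) (CARD('p) ^ k + n)) - of_int (gamma_int CARD('p) n) :: 'p padic)
    \<le> 1 / real CARD('p) ^ k"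
proof (cases k)
  case 0
  thus ?thesis by (intro order.trans[OF padic_norm_diff_le[of _ 1]]) auto
next
  case (Suc j)
  let ?p = "CARD('p)"
  let ?h = "of_nat (?p ^ k) :: 'p padic"
  have "of_int (gamma_int ?p (?p ^ k + n)) = (of_int (gamma_int ?p (?p ^ k)) * gamma_shift ?p n ?h :: 'p padic)"
    using Suc gamma_int_add[of ?p "?p ^ k" n] by (simp add: of_int_gamma_shift)
  hence "of_int (gamma_int ?p (?p ^ k + n)) - of_int (gamma_int ?p n) =
      (of_int (gamma_int ?p (?p ^ k)) - 1) * gamma_shift ?p n ?h + (gamma_shift ?p n ?h - gamma_shift ?p n 0 :: 'p padic)"
    unfolding gamma_int_eq_shift[of ?p n] by (simp add: of_int_gamma_shift algebra_simps)
  also have "padic_norm \<dots> \<le> 1 / real ?p ^ k"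
  proof (intro padic_norm_add_le)
    have h: "?h \<in> padic_integers" by (rule padic_integers_of_nat)
    show "padic_norm ((of_int (gamma_int ?p (?p ^ k)) - 1) * gamma_shift ?p n ?h) \<le> 1 / real ?p ^ k"
      using padic_norm_mult_le[OF gamma_int_CARD_power[OF p2, of j] gamma_shift_cong(1)[OF h h, of ?p n]] Suc by simp
    show "padic_norm (gamma_shift ?p n ?h - gamma_shift ?p n 0) \<le> 1 / real ?p ^ k"
      using gamma_shift_cong(2)[OF h padic_integers_0_1(1), of ?p n] by simp
  qed
  finally show ?thesis .
qed

lemma gamma_int_diff_le:
  assumes p2: "CARD('p::prime_card) \<noteq> 2"
    and mn: "padic_norm (of_nat m - of_nat n :: 'p padic) \<le> 1 / real CARD('p) ^ k"
  shows "padic_norm (of_int (gamma_int CARD('p) m) - of_int (gamma_int CARD('p) n) :: 'p padic) \<le> 1 / real CARD('p) ^ k"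
proof -
  let ?G = "\<lambda>n. of_int (gamma_int CARD('p) n) :: 'p padic"
  have step: "padic_norm (?G (n + c * CARD('p) ^ k) - ?G n) \<le> 1 / real CARD('p) ^ k" for n c
  proof (induction c)
    case (Suc c)
    have "padic_norm (?G (CARD('p) ^ k + (n + c * CARD('p) ^ k)) - ?G (n + c * CARD('p) ^ k)) \<le> 1 / real CARD('p) ^ k"
      by (rule gamma_int_add_CARD_power[OF p2])
    from padic_norm_add_le[OF this Suc.IH] show ?case by (simp add: add_ac)
  qed simp
  have ge: "padic_norm (?G m - ?G n) \<le> 1 / real CARD('p) ^ k"
    if "padic_norm (of_nat m - of_nat n :: 'p padic) \<le> 1 / real CARD('p) ^ k" "n \<le> m" for m n
  proof -
    have "padic_norm (of_int (int m - int n) :: 'p padic) \<le> 1 / real CARD('p) ^ k" using that(1) by simp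
    hence "int CARD('p) ^ k dvd int (m - n)"
      unfolding padic_norm_of_int_le_iff using that(2) by (simp add: of_nat_diff)
    hence "CARD('p) ^ k dvd m - n" by (metis int_dvd_int_iff of_nat_power)
    then obtain c where "m - n = c * CARD('p) ^ k" by (metis dvdE mult.commute)
    hence "m = n + c * CARD('p) ^ k" using that(2) by simp
    thus ?thesis using step[of n c] by simp
  qed
  show ?thesis
  proof (cases "n \<le> m")
    case False
    thus ?thesis using ge[of n m] mn by (simp add: padic_norm_minus_commute)
  qed (use ge mn in blast)
qed

lemma padic_eqI:
  fixes a b :: "'p::prime_card padic"
  assumes "\<And>k. padic_norm (a - b) \<le> C * (1 / real CARD('p) ^ k)"
  shows "a = b"
proof -
  have "(\<lambda>k. C * (1 / real CARD('p) ^ k)) \<longlonglongrightarrow> 0"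
    by (rule tendsto_mult_right_zero[OF one_over_CARD_power_tendsto_0])
  hence "padic_norm (a - b) \<le> 0" by (rule LIMSEQ_le_const) (use assms in auto)
  thus ?thesis using padic_norm_nonneg[of "a - b"] by (metis antisym eq_iff_diff_eq_0 padic_norm_eq_0_iff)
qed

text \<open>Extension by uniform continuity. The estimate is recorded for every approximation
  \<open>n\<close> and every precision \<open>k\<close>, so that continuity, integrality and the
  functional equation can all be read off.\<close>

lemma padic_Gamma_ex:
  assumes p2: "CARD('p::prime_card) \<noteq> 2"
  shows "\<exists>G :: 'p padic \<Rightarrow> 'p padic. \<forall>x\<in>padic_integers. \<forall>n k. padic_norm (x - of_nat n) \<le> 1 / real CARD('p) ^ k \<longrightarrow>
     padic_norm (G x - of_int (gamma_int CARD('p) n)) \<le> 1 / real CARD('p) ^ k"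
proof -
  let ?q = "\<lambda>k. 1 / real CARD('p) ^ k"
  let ?g = "\<lambda>n. of_int (gamma_int CARD('p) n) :: 'p padic"
  have mono: "?q j \<le> ?q i" if "i \<le> j" for i j
    using that CARD_gt_1[where 'p='p] by (intro frac_le power_increasing) auto
  have "\<exists>y. \<forall>n k. padic_norm (x - of_nat n) \<le> ?q k \<longrightarrow> padic_norm (y - ?g n) \<le> ?q k"
    if x: "x \<in> padic_integers" for x :: "'p padic"
  proof -
    have "\<exists>n. padic_norm (x - of_nat n) \<le> ?q k" for k using padic_integers_nat_dense[OF x] by metis
    then obtain a where a: "\<And>k. padic_norm (x - of_nat (a k)) \<le> ?q k" by metis
    have near: "padic_norm (?g (a j) - ?g n) \<le> ?q k" if "padic_norm (x - of_nat n) \<le> ?q k" "k \<le> j" for n k j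
    proof (rule gamma_int_diff_le[OF p2])
      have "padic_norm (x - of_nat (a j)) \<le> ?q k" using a[of j] mono[OF that(2)] by linarith
      from padic_norm_diff_le[OF that(1) this] show "padic_norm (of_nat (a j) - of_nat n :: 'p padic) \<le> ?q k" by simp
    qed
    have "(\<lambda>k. ?g (a (Suc k)) - ?g (a k)) \<longlonglongrightarrow> 0"
      by (rule tendsto_0_padicI[OF _ one_over_CARD_power_tendsto_0[where 'p='p]]) (use near[OF a] in auto)
    then obtain y where y: "(\<lambda>k. ?g (a k)) \<longlonglongrightarrow> y"
      using convergent_padicI[of "\<lambda>k. ?g (a k)"] by (auto simp: convergent_def)
    have "padic_norm (y - ?g n) \<le> ?q k" if "padic_norm (x - of_nat n) \<le> ?q k" for n k
      by (rule padic_norm_limit_le[OF tendsto_diff[OF y tendsto_const]])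
         (use near[OF that] in \<open>auto simp: eventually_sequentially\<close>)
    thus ?thesis by blast
  qed
  thus ?thesis by metis
qed

lemma continuous_on_padic_integersI:
  fixes f :: "'p::prime_card padic \<Rightarrow> 'p padic"
  assumes "\<And>x y k. x \<in> padic_integers \<Longrightarrow> y \<in> padic_integers \<Longrightarrow> padic_norm (x - y) \<le> 1 / real CARD('p) ^ k \<Longrightarrow>
     padic_norm (f x - f y) \<le> 1 / real CARD('p) ^ k"
  shows "continuous_on padic_integers f"
  unfolding continuous_on_iff
proof (intro ballI allI impI)
  fix x :: "'p padic" and e :: real assume x: "x \<in> padic_integers" and e: "e > 0"
  obtain k where k: "1 / real CARD('p) ^ k < e" using one_over_CARD_power_less[OF e] .
  have "dist (f y) (f x) < e" if "y \<in> padic_integers" "dist y x < 1 / real CARD('p) ^ k" for y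
    using assms[OF that(1) x, of k] that(2) k by (simp add: dist_padic_def)
  thus "\<exists>d>0. \<forall>y\<in>padic_integers. dist y x < d \<longrightarrow> dist (f y) (f x) < e"
    using CARD_pos[where 'p='p] by (intro exI[of _ "1 / real CARD('p) ^ k"]) auto
qed

lemma padic_continuous_eqI:
  fixes f g :: "'p::prime_card padic \<Rightarrow> 'p padic"
  assumes "continuous_on padic_integers f" "continuous_on padic_integers g" "\<And>n. f (of_nat n) = g (of_nat n)"
    and x: "x \<in> padic_integers"
  shows "f x = g x"
proof -
  have "\<exists>n. padic_norm (x - of_nat n) \<le> 1 / real CARD('p) ^ k" for k using padic_integers_nat_dense[OF x] by metis
  then obtain a where a: "\<And>k. padic_norm (x - of_nat (a k)) \<le> 1 / real CARD('p) ^ k" by metis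
  have lim: "(\<lambda>k. of_nat (a k)) \<longlonglongrightarrow> x"
    unfolding tendsto_padic_iff
    by (rule tendsto_sandwich[OF _ _ tendsto_const one_over_CARD_power_tendsto_0[where 'p='p]])
       (use a in \<open>auto simp: padic_norm_minus_commute\<close>)
  have "(\<lambda>k. f (of_nat (a k))) \<longlonglongrightarrow> f x" "(\<lambda>k. g (of_nat (a k))) \<longlonglongrightarrow> g x"
    by (intro continuous_on_tendsto_compose[OF assms(1) lim] continuous_on_tendsto_compose[OF assms(2) lim] x; simp)+
  thus ?thesis using assms(3) by (simp add: LIMSEQ_unique)
qed

text \<open>The extension satisfies the functional equation up to every power of \<open>p\<close>,
  and a competitor has the same values at the natural numbers, which are dense; so the definite
  description denotes.\<close>

lemma padic_Gamma_props:
  assumes p2: "CARD('p::prime_card) \<noteq> 2"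
  shows "continuous_on padic_integers (padic_Gamma :: 'p padic \<Rightarrow> 'p padic)"
    and "padic_Gamma (of_nat n) = (of_int (gamma_int CARD('p) n) :: 'p padic)"
proof -
  let ?q = "\<lambda>k. 1 / real CARD('p) ^ k"
  let ?g = "\<lambda>n. of_int (gamma_int CARD('p) n) :: 'p padic"
  obtain H :: "'p padic \<Rightarrow> 'p padic" where H: "\<And>x n k. x \<in> padic_integers \<Longrightarrow> padic_norm (x - of_nat n) \<le> ?q k \<Longrightarrow>
     padic_norm (H x - ?g n) \<le> ?q k"
    using padic_Gamma_ex[OF p2] by blast
  define G where "G = (\<lambda>x. if x \<in> padic_integers then H x else 0)"
  have G: "padic_norm (G x - ?g n) \<le> ?q k" if "x \<in> padic_integers" "padic_norm (x - of_nat n) \<le> ?q k" for x n k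
    using H[OF that] that(1) by (simp add: G_def)
  have Gn: "G (of_nat n) = ?g n" for n
    by (rule padic_eqI[of _ _ 1]) (use G[of "of_nat n" n] in simp)
  have lip: "padic_norm (G x - G y) \<le> ?q k"
    if xy: "x \<in> padic_integers" "y \<in> padic_integers" "padic_norm (x - y) \<le> ?q k" for x y k
  proof -
    obtain n where n: "padic_norm (x - of_nat n) \<le> ?q k" using padic_integers_nat_dense[OF xy(1)] .
    have "padic_norm (y - of_nat n) \<le> ?q k" using padic_norm_diff_le[OF n xy(3)] by simp
    from padic_norm_diff_le[OF G[OF xy(1) n] G[OF xy(2) this]] show ?thesis by simp
  qed
  have cont: "continuous_on padic_integers G" by (rule continuous_on_padic_integersI[OF lip])
  have int: "G x \<in> padic_integers" if x: "x \<in> padic_integers" for x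
  proof -
    obtain n where "padic_norm (x - of_nat n) \<le> ?q 0" using padic_integers_nat_dense[OF x] .
    from padic_norm_add_le[OF G[OF x this, unfolded power_0 div_by_1] gamma_int_norm_le[of "CARD('p)" n]]
    show ?thesis by (simp add: padic_integers_def)
  qed
  have unit_iff: "padic_norm (of_nat n :: 'p padic) = 1 \<longleftrightarrow> coprime n CARD('p)" for n by (rule padic_norm_of_nat_eq_1_iff)
  have fe: "G (x + 1) = (if padic_norm x = 1 then - x * G x else - G x)" if x: "x \<in> padic_integers" for x
  proof (rule padic_eqI[of _ _ 1])
    fix k0
    \<comment> \<open>One digit more than requested: \<open>x\<close> and \<open>n\<close> then
      agree modulo \<open>p\<close>, and the same branch of the functional equation applies to
      both.\<close>
    define k where "k = Suc k0"
    obtain n where n: "padic_norm (x - of_nat n) \<le> ?q k" using padic_integers_nat_dense[OF x] .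
    have "?q k \<le> 1 / real CARD('p)" using CARD_gt_1[where 'p='p] by (simp add: k_def field_simps)
    hence lt: "padic_norm (x - of_nat n) < 1" using n by (intro padic_norm_less_1I) auto
    have nx: "padic_norm x = 1 \<longleftrightarrow> coprime n CARD('p)"
    proof -
      have "padic_norm x = 1" if "padic_norm (of_nat n :: 'p padic) = 1"
        using padic_norm_add_eq[of "x - of_nat n" "of_nat n"] lt that by simp
      moreover have "padic_norm (of_nat n :: 'p padic) = 1" if "padic_norm x = 1"
        using padic_norm_add_eq[of "of_nat n - x" x] lt that by (simp add: padic_norm_minus_commute)
      ultimately show ?thesis using unit_iff by blast
    qed
    have 1: "padic_norm (G (x + 1) - ?g (Suc n)) \<le> ?q k"
      using n x by (intro G padic_integers_closed) (simp_all add: algebra_simps)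
    have 2: "padic_norm (G x - ?g n) \<le> ?q k" by (rule G[OF x n])
    have x1: "padic_norm x \<le> 1" using x by (simp add: padic_integers_def)
    have 3: "padic_norm ((if padic_norm x = 1 then - x * G x else - G x) - ?g (Suc n)) \<le> ?q k"
    proof (cases "coprime n CARD('p)")
      case True
      have "- x * G x - ?g (Suc n) = - (x * (G x - ?g n) + (x - of_nat n) * ?g n)"
        using True by (simp add: gamma_int_Suc algebra_simps)
      also have "padic_norm \<dots> \<le> ?q k" unfolding padic_norm_minus
        using padic_norm_mult_le[OF x1 2] padic_norm_mult_le[OF n gamma_int_norm_le[of "CARD('p)" n]]
        by (intro padic_norm_add_le) simp_all
      finally show ?thesis using nx True by simp
    next
      case False
      have "- G x - ?g (Suc n) = - (G x - ?g n)" using False by (simp add: gamma_int_Suc)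
      hence "padic_norm (- G x - ?g (Suc n)) = padic_norm (G x - ?g n)" by (simp only: padic_norm_minus)
      thus ?thesis using nx False 2 by simp
    qed
    have "padic_norm (G (x + 1) - (if padic_norm x = 1 then - x * G x else - G x)) \<le> ?q k"
      using padic_norm_diff_le[OF 1 3] by (simp only: diff_diff_eq2 diff_add_cancel)
    also have "?q k \<le> 1 * ?q k0" using CARD_gt_1[where 'p='p] by (simp add: k_def field_simps)
    finally show "padic_norm (G (x + 1) - (if padic_norm x = 1 then - x * G x else - G x)) \<le> 1 * ?q k0" .
  qed
  have eq: "padic_Gamma = G"
    unfolding padic_Gamma_def
  proof (rule the_equality, intro conjI ballI allI impI)
    show "continuous_on padic_integers G" by (rule cont)
    show "G ` padic_integers \<subseteq> padic_integers" using int by auto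
    show "G 0 = 1" using Gn[of 0] by simp
    show "G (x + 1) = (if padic_norm x = 1 then - x * G x else - G x)" if "x \<in> padic_integers" for x by (rule fe[OF that])
    show "G x = 0" if "x \<notin> padic_integers" for x using that by (simp add: G_def)
  next
    fix G' :: "'p padic \<Rightarrow> 'p padic"
    assume G': "continuous_on padic_integers G' \<and> G' ` padic_integers \<subseteq> padic_integers \<and> G' 0 = 1 \<and>
      (\<forall>x\<in>padic_integers. G' (x + 1) = (if padic_norm x = 1 then - x * G' x else - G' x)) \<and>
      (\<forall>x. x \<notin> padic_integers \<longrightarrow> G' x = 0)"
    have n: "G' (of_nat n) = ?g n" for n
    proof (induction n)
      case (Suc n)
      have "G' (of_nat n + 1) = (if coprime n CARD('p) then - of_nat n * G' (of_nat n) else - G' (of_nat n))"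
        using G' unit_iff[of n] by simp
      thus ?case using Suc by (simp add: gamma_int_Suc add.commute)
    qed (use G' in simp)
    have "G' x = G x" if "x \<in> padic_integers" for x
      by (rule padic_continuous_eqI[OF _ cont _ that]) (use G' n Gn in auto)
    thus "G' = G" using G' by (auto simp: fun_eq_iff G_def)
  qed
  show "continuous_on padic_integers (padic_Gamma :: 'p padic \<Rightarrow> 'p padic)" unfolding eq by (rule cont)
  show "padic_Gamma (of_nat n) = (of_int (gamma_int CARD('p) n) :: 'p padic)" unfolding eq by (rule Gn)
qed

section \<open>Newton series and local analyticity\<close>

lemma prod_multiples:
  fixes f :: "nat \<Rightarrow> 'a::comm_monoid_mult"
  assumes p0: "p > 0"
  shows "(\<Prod>i\<in>{1..n} \<inter> {i. p dvd i}. f i) = (\<Prod>b = 1..n div p. f (p * b))"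
proof (rule prod.reindex_bij_witness[of _ "\<lambda>b. p * b" "\<lambda>a. a div p"])
  fix a assume "a \<in> {1..n} \<inter> {i. p dvd i}"
  then obtain c where c: "a = p * c" "1 \<le> a" "a \<le> n" by auto
  thus "a div p \<in> {1..n div p}" "p * (a div p) = a"
    using p0 div_le_mono[of a n p] by (auto intro!: Suc_leI)
  thus "f (p * (a div p)) = f a" by simp
next
  fix b assume b: "b \<in> {1..n div p}"
  have "p * b \<le> p * (n div p)" using b by simp
  also have "\<dots> \<le> n" by simp
  finally show "p * b \<in> {1..n} \<inter> {i. p dvd i}" using b p0 by auto
  show "p * b div p = b" using p0 by simp
qed

text \<open>Only multiples of \<open>p\<close> contribute, namely \<open>p^d d!\<close> with
  \<open>d = n div p\<close>. Since \<open>2 d \<le> n\<close>, induction gives a crude bound that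
  is good enough against \<open>p^(2k)\<close>.\<close>

lemma padic_norm_fact_ge: "1 / real CARD('p::prime_card) ^ n \<le> padic_norm (fact n :: 'p padic)"
proof (induction n rule: less_induct)
  case (less n)
  define p where "p = CARD('p)"
  have p: "p \<ge> 2" using prime_ge_2_nat[OF prime_card[where 'a='p]] by (simp add: p_def)
  show ?case
  proof (cases "n = 0")
    case False
    define d where "d = n div p"
    have d: "d < n" "2 * d \<le> n" using p False div_le_mono2[of 2 p n] by (auto simp: d_def)
    let ?M = "{1..n} \<inter> {i. p dvd i}"
    have "(fact n :: 'p padic) = (\<Prod>i\<in>{1..n}. of_nat i)" by (simp add: fact_prod)
    also have "\<dots> = (\<Prod>i\<in>?M. of_nat i) * (\<Prod>i\<in>{1..n} - {i. p dvd i}. of_nat i)"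
      by (rule prod.Int_Diff) simp
    also have "(\<Prod>i\<in>?M. of_nat i) = (\<Prod>b = 1..d. of_nat (p * b) :: 'p padic)"
      unfolding d_def using p by (intro prod_multiples) simp
    also have "\<dots> = of_nat p ^ d * fact d" by (simp add: prod.distrib fact_prod)
    finally have "padic_norm (fact n :: 'p padic) =
        (1 / real p ^ d) * padic_norm (fact d :: 'p padic) * (\<Prod>i\<in>{1..n} - {i. p dvd i}. padic_norm (of_nat i :: 'p padic))"
      by (simp add: padic_norm_mult padic_norm_prod p_def)
    also have "(\<Prod>i\<in>{1..n} - {i. p dvd i}. padic_norm (of_nat i :: 'p padic)) = 1"
    proof (rule prod.neutral, rule ballI)
      fix i assume "i \<in> {1..n} - {i. p dvd i}"
      hence "\<not> int p dvd int i" by simp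
      thus "padic_norm (of_nat i :: 'p padic) = 1" using padic_norm_unit_of_int[of "int i", where 'p='p] by (simp add: p_def)
    qed
    finally have eq: "padic_norm (fact n :: 'p padic) = (1 / real p ^ d) * padic_norm (fact d :: 'p padic)" by simp
    have "1 / real p ^ n \<le> 1 / real p ^ (d + d)"
      using p d by (intro frac_le power_increasing) auto
    also have "\<dots> = (1 / real p ^ d) * (1 / real p ^ d)" by (simp add: power_add)
    also have "\<dots> \<le> (1 / real p ^ d) * padic_norm (fact d :: 'p padic)"
      using less.IH[OF d(1)] by (intro mult_left_mono) (auto simp: p_def)
    finally show ?thesis unfolding eq by (simp add: p_def)
  qed simp
qed

text \<open>A bound by the row index alone together with the triangular shape leaves finitely many
  large entries, so the array may be summed by rows or by columns.\<close>

lemma padic_triangular_swap: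
  fixes T :: "nat \<Rightarrow> nat \<Rightarrow> 'p::prime_card padic"
  assumes B: "B \<longlonglongrightarrow> 0" and T: "\<And>i j. padic_norm (T i j) \<le> B i" and T0: "\<And>i j. i < j \<Longrightarrow> T i j = 0"
  shows "((\<lambda>j. \<Sum>\<^sub>\<infinity>i. T i j) has_sum (\<Sum>\<^sub>\<infinity>i. \<Sum>j\<le>i. T i j)) UNIV"
proof -
  define h where "h = (\<lambda>(i,j). T i j)"
  have "h summable_on (UNIV \<times> UNIV)"
  proof (rule padic_summable_onI)
    fix e :: real assume e: "e > 0"
    have "{x \<in> UNIV \<times> UNIV. e \<le> padic_norm (h x)} \<subseteq> Sigma {i\<in>UNIV. B i \<ge> e} (\<lambda>i. {..i})"
    proof
      fix x assume x: "x \<in> {x \<in> UNIV \<times> UNIV. e \<le> padic_norm (h x)}"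
      obtain i j where ij: "x = (i, j)" by fastforce
      have "e \<le> padic_norm (T i j)" using x by (simp add: h_def ij)
      moreover from this have "\<not> i < j" using T0[of i j] e by auto
      ultimately show "x \<in> Sigma {i\<in>UNIV. B i \<ge> e} (\<lambda>i. {..i})" using T[of i j] by (auto simp: ij)
    qed
    thus "finite {x \<in> UNIV \<times> UNIV. e \<le> padic_norm (h x)}"
      by (rule finite_subset) (intro finite_SigmaI finite_nat_ge_of_tendsto_0[OF B e]; simp)
  qed
  then obtain S where S: "(h has_sum S) (UNIV \<times> UNIV)" by (auto simp: summable_on_def)
  have "((\<lambda>i. \<Sum>j\<le>i. T i j) has_sum S) UNIV"
  proof (rule has_sum_SigmaD[OF S])
    fix i
    show "((\<lambda>j. h (i, j)) has_sum (\<Sum>j\<le>i. T i j)) UNIV"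
      by (rule has_sum_finite_neutralI[of "{..i}"]) (auto simp: h_def T0)
  qed
  hence 1: "(\<Sum>\<^sub>\<infinity>i. \<Sum>j\<le>i. T i j) = S" by (rule infsumI)
  have S': "((\<lambda>(x,y). h (y,x)) has_sum S) (UNIV \<times> UNIV)" by (rule has_sum_swap[THEN iffD1, OF S])
  have "((\<lambda>j. \<Sum>\<^sub>\<infinity>i. T i j) has_sum S) UNIV"
  proof (rule has_sum_SigmaD[OF S'])
    fix j
    have "(\<lambda>i. T i j) summable_on UNIV"
      by (intro padic_summable_on_natI tendsto_0_padicI[OF _ B]) (use T in auto)
    thus "((\<lambda>y. case (j, y) of (x, y) \<Rightarrow> h (y, x)) has_sum (\<Sum>\<^sub>\<infinity>i. T i j)) UNIV"
      by (simp add: h_def)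
  qed
  thus ?thesis using 1 by simp
qed

section \<open>Finite differences of the Gamma function along multiples of
  \<open>p^4\<close>\<close>

definition fdiff :: "(nat \<Rightarrow> 'a::comm_ring_1) \<Rightarrow> nat \<Rightarrow> nat \<Rightarrow> 'a" where
  "fdiff f k = ((\<lambda>g m. g (Suc m) - g m) ^^ k) f"

lemma fdiff_0 [simp]: "fdiff f 0 = f"
  by (simp add: fdiff_def)

lemma fdiff_Suc: "fdiff f (Suc k) m = fdiff f k (Suc m) - fdiff f k m"
  by (simp add: fdiff_def)

lemma newton_forward: "f (n + m) = (\<Sum>k\<le>n. of_nat (n choose k) * fdiff f k m)"
proof (induction n arbitrary: m)
  case (Suc n)
  let ?S = "\<Sum>k\<le>n. of_nat (n choose Suc k) * fdiff f (Suc k) m"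
  let ?T = "\<Sum>k\<le>n. of_nat (n choose k) * fdiff f (Suc k) m"
  have "f (Suc n + m) = (\<Sum>k\<le>n. of_nat (n choose k) * fdiff f k (Suc m))" using Suc.IH[of "Suc m"] by simp
  also have "\<dots> = (\<Sum>k\<le>n. of_nat (n choose k) * fdiff f k m) + ?T"
    by (simp add: fdiff_Suc algebra_simps sum_subtractf flip: sum.distrib)
  also have "(\<Sum>k\<le>n. of_nat (n choose k) * fdiff f k m) = (\<Sum>k\<le>Suc n. of_nat (n choose k) * fdiff f k m)"
    by (simp add: binomial_eq_0)
  also have "\<dots> = f m + ?S" by (subst sum.atMost_Suc_shift) simp
  also have "f m + ?S + ?T = (\<Sum>k\<le>Suc n. of_nat (Suc n choose k) * fdiff f k m)"
    by (subst sum.atMost_Suc_shift) (simp add: sum.distrib algebra_simps)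
  finally show ?case .
qed simp

lemma pcompose_diff_dvd:
  fixes S g h :: "'a::comm_ring_1 poly"
  assumes "c dvd g - h"
  shows "c dvd pcompose S g - pcompose S h"
proof (induction S)
  case (pCons a S)
  have "pcompose (pCons a S) g - pcompose (pCons a S) h =
      g * (pcompose S g - pcompose S h) + (g - h) * pcompose S h"
    by (simp add: pcompose_pCons algebra_simps)
  thus ?case using pCons assms by simp
qed simp

text \<open>Modulo \<open>q\<close>, \<open>S (z + q)\<close> is \<open>S z\<close> and
  \<open>P (q z)\<close> is \<open>P 0\<close>, hence 1. The division takes place in the polynomial
  ring, so the quotient is again available for the next difference.\<close>

lemma poly_shift_quotient:
  fixes S P :: "int poly"
  assumes P: "q dvd poly P 0 - 1"
  obtains Q where "\<And>z. poly S (z + q) * poly P (q * z) - poly S z = q * poly Q z"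
proof -
  let ?R = "pcompose S [:q, 1:] * pcompose P [:0, q:] - S"
  have "[:q:] dvd pcompose S [:q, 1:] - pcompose S [:0, 1:]"
    by (rule pcompose_diff_dvd) simp
  moreover have "[:q:] dvd pcompose P [:0, q:] - pcompose P 0"
  proof (rule pcompose_diff_dvd)
    have "[:0, q:] - 0 = [:q:] * [:0, 1:]" by simp
    thus "[:q:] dvd [:0, q:] - 0" by (metis dvd_triv_left)
  qed
  moreover have "[:q:] dvd pcompose P 0 - 1"
  proof -
    obtain r where "poly P 0 - 1 = q * r" using P by blast
    hence "pcompose P 0 - 1 = [:q:] * [:r:]" by (simp add: pcompose_0' poly_0_coeff_0 one_pCons)
    thus ?thesis by (metis dvd_triv_left)
  qed
  moreover have "?R = (pcompose S [:q, 1:] - pcompose S [:0, 1:]) * pcompose P [:0, q:] +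
     S * (pcompose P [:0, q:] - pcompose P 0) + S * (pcompose P 0 - 1)"
    by (simp add: algebra_simps)
  ultimately have "[:q:] dvd ?R" by (metis dvd_add dvd_mult dvd_mult2)
  then obtain Q where Q: "?R = [:q:] * Q" by blast
  have "poly S (z + q) * poly P (q * z) - poly S z = q * poly Q z" for z
    using arg_cong[OF Q, of "\<lambda>p. poly p z"] by (simp add: poly_pcompose add.commute mult.commute)
  thus ?thesis using that by blast
qed

text \<open>In the variable \<open>z = q n\<close> consecutive values differ by the factor
  \<open>P (q z)\<close>. Differencing preserves the shape \<open>q^k\<close> times a polynomial in
  \<open>z\<close> times the function, and raises \<open>k\<close> by one.\<close>

lemma gamma_int_fdiff:
  assumes p2: "CARD('p::prime_card) \<noteq> 2"
  defines "p \<equiv> CARD('p)"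
  obtains d where "\<And>k. fdiff (\<lambda>n. gamma_int p (p ^ 4 * n)) k 0 = int p ^ (2 * k) * d k"
proof -
  define q where "q = int p ^ 2"
  define A where "A = p ^ 4"
  define P :: "int poly" where "P = gamma_shift p A [:0, 1:]"
  have P: "poly P y = gamma_shift p A y" for y
    by (simp add: P_def gamma_shift_def poly_prod)
  let ?f = "\<lambda>n. gamma_int p (A * n)"
  have f: "?f (Suc n) = ?f n * poly P (q * (q * int n))" for n
  proof -
    have "p dvd A" by (simp add: A_def)
    hence "gamma_int p (A * n + A) = gamma_int p (A * n) * gamma_shift p A (int (A * n))" by (intro gamma_int_add) simp
    moreover have "int (A * n) = q * (q * int n)" by (simp add: A_def q_def power2_eq_square power4_eq_xxxx)
    ultimately show ?thesis unfolding P by (simp only: mult_Suc_right add.commute)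
  qed
  \<comment> \<open>\<open>P 0\<close> is the value at \<open>A = p^4\<close>, to which the Wilson
    congruence applies.\<close>
  have "int p ^ 4 dvd gamma_int p A - 1"
    using gamma_int_CARD_power[OF p2, of 3] padic_norm_of_int_le_iff[of "gamma_int p A - 1" 4, where 'p='p]
    by (simp add: p_def A_def numeral_eq_Suc)
  moreover have "q dvd int p ^ 4" unfolding q_def by (intro le_imp_power_dvd) simp
  ultimately have P1: "q dvd poly P 0 - 1"
    unfolding P gamma_int_eq_shift[symmetric] by (metis dvd_trans)
  have "\<exists>Q. \<forall>n. fdiff ?f k n = q ^ k * poly Q (q * int n) * ?f n" for k
  proof (induction k)
    case 0
    show ?case by (rule exI[of _ 1]) simp
  next
    case (Suc k)
    then obtain S where S: "\<And>n. fdiff ?f k n = q ^ k * poly S (q * int n) * ?f n" by blast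
    obtain Q where Q: "\<And>z. poly S (z + q) * poly P (q * z) - poly S z = q * poly Q z"
      using poly_shift_quotient[OF P1] by blast
    have "fdiff ?f (Suc k) n = q ^ Suc k * poly Q (q * int n) * ?f n" for n
    proof -
      have "fdiff ?f (Suc k) n = q ^ k * (poly S (q * int n + q) * poly P (q * (q * int n)) - poly S (q * int n)) * ?f n"
        unfolding fdiff_Suc S f by (simp add: algebra_simps)
      thus ?thesis unfolding Q by (simp add: mult_ac)
    qed
    thus ?case by blast
  qed
  then obtain Q where Q: "\<And>k n. fdiff ?f k n = q ^ k * poly (Q k) (q * int n) * ?f n" by metis
  have "fdiff ?f k 0 = int p ^ (2 * k) * poly (Q k) 0" for k
    using Q[of k 0] by (simp add: q_def power_mult)
  thus ?thesis unfolding A_def by (rule that)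
qed

text \<open>At a natural number the series is the finite forward-difference formula; both sides are
  continuous, so the identity extends by density.\<close>

lemma padic_Gamma_newton:
  assumes p2: "CARD('p::prime_card) \<noteq> 2"
  obtains d :: "nat \<Rightarrow> int" where "\<And>x. x \<in> padic_integers \<Longrightarrow>
    padic_Gamma (of_nat CARD('p) ^ 4 * x :: 'p padic) = (\<Sum>\<^sub>\<infinity>k. (x gchoose k) * (of_nat CARD('p) ^ (2 * k) * of_int (d k)))"
proof -
  define p where "p = CARD('p)"
  let ?P = "of_nat CARD('p) :: 'p padic"
  obtain d where d: "\<And>k. fdiff (\<lambda>n. gamma_int p (p ^ 4 * n)) k 0 = int p ^ (2 * k) * d k"
    unfolding p_def using gamma_int_fdiff[OF p2] by blast
  let ?c = "\<lambda>k. ?P ^ (2 * k) * of_int (d k)"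
  let ?B = "\<lambda>k. 1 / real p ^ k"
  have c: "padic_norm (?c k) \<le> ?B k" for k
  proof -
    have "padic_norm (?c k) \<le> 1 / real p ^ (2 * k) * 1"
      by (intro padic_norm_mult_le) (simp_all add: p_def)
    also have "\<dots> \<le> ?B k" using CARD_gt_1[where 'p='p] by (simp add: p_def frac_le power_increasing)
    finally show ?thesis .
  qed
  have B: "?B \<longlonglongrightarrow> 0" unfolding p_def by (rule one_over_CARD_power_tendsto_0)
  have "padic_Gamma (?P ^ 4 * x) = (\<Sum>\<^sub>\<infinity>k. (x gchoose k) * ?c k)" if x: "x \<in> padic_integers" for x
  proof (rule padic_continuous_eqI[OF _ _ _ x, where f = "\<lambda>x. padic_Gamma (?P ^ 4 * x)" and g = "\<lambda>x. \<Sum>\<^sub>\<infinity>k. (x gchoose k) * ?c k"])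
    have P4: "?P ^ 4 \<in> padic_integers" unfolding of_nat_power[symmetric] by (rule padic_integers_of_nat)
    show "continuous_on padic_integers (\<lambda>x. padic_Gamma (?P ^ 4 * x))"
    proof (rule continuous_on_compose2[OF padic_Gamma_props(1)[OF p2]])
      show "continuous_on padic_integers (\<lambda>x. ?P ^ 4 * x)"
        unfolding continuous_on_def by (auto intro!: tendsto_mult_padic tendsto_ident_at)
      show "(\<lambda>x. ?P ^ 4 * x) ` padic_integers \<subseteq> padic_integers" using padic_integers_closed(3)[OF P4] by auto
    qed
    show "continuous_on padic_integers (\<lambda>x. \<Sum>\<^sub>\<infinity>k. (x gchoose k) * ?c k)"
      unfolding continuous_on_def
    proof
      fix s :: "'p padic" assume s: "s \<in> padic_integers"
      show "((\<lambda>x. \<Sum>\<^sub>\<infinity>k. (x gchoose k) * ?c k) \<longlongrightarrow> (\<Sum>\<^sub>\<infinity>k. (s gchoose k) * ?c k)) (at s within padic_integers)"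
      proof (rule tendsto_padic_infsum[where B = ?B])
        show "((\<lambda>x. (x gchoose k) * ?c k) \<longlongrightarrow> (s gchoose k) * ?c k) (at s within padic_integers)" for k
          unfolding gbinomial_prod_rev by (intro tendsto_intros tendsto_prod_padic) auto
        show "\<forall>\<^sub>F x in at s within padic_integers. \<forall>k\<in>UNIV. padic_norm ((x gchoose k) * ?c k) \<le> ?B k"
          unfolding eventually_at_filter
        proof (rule always_eventually, intro allI impI ballI)
          fix x :: "'p padic" and k assume "x \<in> padic_integers"
          from padic_norm_mult_le[OF padic_norm_gbinomial_le_1[OF this] c]
          show "padic_norm ((x gchoose k) * ?c k) \<le> ?B k" by simp
        qed
        show "finite {k \<in> UNIV. ?B k \<ge> r}" if "r > 0" for r by (rule finite_nat_ge_of_tendsto_0[OF B that])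
      qed
    qed
    fix n
    have "padic_Gamma (?P ^ 4 * of_nat n) = of_int (gamma_int p (p ^ 4 * n))"
      using padic_Gamma_props(2)[OF p2, of "CARD('p) ^ 4 * n"] by (simp add: p_def)
    also have "gamma_int p (p ^ 4 * n) = (\<Sum>k\<le>n. int (n choose k) * (int p ^ (2 * k) * d k))"
      using newton_forward[of "\<lambda>n. gamma_int p (p ^ 4 * n)" n 0] by (simp add: d)
    also have "of_int \<dots> = (\<Sum>k\<le>n. (of_nat n gchoose k) * ?c k)"
      by (simp add: p_def binomial_gbinomial[symmetric])
    also have "\<dots> = (\<Sum>\<^sub>\<infinity>k. (of_nat n gchoose k) * ?c k)"
      by (rule infsumI[symmetric], rule has_sum_finite_neutralI[of "{..n}"]) (auto simp: binomial_gbinomial[symmetric])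
    finally show "padic_Gamma (?P ^ 4 * of_nat n) = (\<Sum>\<^sub>\<infinity>k. (of_nat n gchoose k) * ?c k)" .
  qed
  thus ?thesis using that by blast
qed

text \<open>Stirling numbers are integers, so \<open>k!\<close> is the only denominator among the
  coefficients.\<close>

lemma gbinomial_stirling:
  fixes x :: "'a::field_char_0"
  shows "x gchoose k = (\<Sum>j\<le>k. (- 1) ^ k * of_nat (stirling k j) * (- 1) ^ j / fact k * x ^ j)"
proof -
  have "x gchoose k = (- 1) ^ k * pochhammer (- x) k / fact k" by (rule gbinomial_pochhammer)
  also have "pochhammer (- x) k = (\<Sum>j\<le>k. of_nat (stirling k j) * (- x) ^ j)" by (rule stirling_pochhammer[symmetric])
  finally show ?thesis
    by (simp add: sum_distrib_left sum_divide_distrib power_minus[of x] mult_ac)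
qed

text \<open>Expanding the binomials gives a triangular array in which \<open>p^(2k) / k!\<close> has
  norm at most \<open>p^(-k)\<close>. Row \<open>k\<close> stops at degree \<open>k\<close>, so
  degree \<open>j\<close> only sees rows \<open>k \<ge> j\<close> and inherits the bound
  \<open>p^(-j)\<close>.\<close>

lemma padic_Gamma_local_series:
  assumes p2: "CARD('p::prime_card) \<noteq> 2"
  obtains \<Phi> :: "'p::prime_card padic fps" where "\<And>j. padic_norm (fps_nth \<Phi> j) \<le> 1 / real CARD('p) ^ j"
    "\<And>x. x \<in> padic_integers \<Longrightarrow> ((\<lambda>j. fps_nth \<Phi> j * x ^ j) has_sum padic_Gamma (of_nat CARD('p) ^ 4 * x)) UNIV"
proof -
  define p where "p = CARD('p)"
  let ?P = "of_nat CARD('p) :: 'p padic"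
  let ?B = "\<lambda>k. 1 / real p ^ k"
  obtain d :: "nat \<Rightarrow> int" where d: "\<And>x. x \<in> padic_integers \<Longrightarrow>
    padic_Gamma (?P ^ 4 * x) = (\<Sum>\<^sub>\<infinity>k. (x gchoose k) * (?P ^ (2 * k) * of_int (d k)))"
    using padic_Gamma_newton[OF p2] by blast
  define T where "T = (\<lambda>k j. (?P ^ (2 * k) / fact k) * (of_int (d k) * ((- 1) ^ k * of_nat (stirling k j) * (- 1) ^ j)))"
  have B: "?B \<longlonglongrightarrow> 0" unfolding p_def by (rule one_over_CARD_power_tendsto_0)
  have Tb: "padic_norm (T k j) \<le> ?B k" for k j
  proof -
    have p0: "real p > 0" using CARD_pos[where 'p='p] by (simp add: p_def)
    have "padic_norm (?P ^ (2 * k) / fact k) \<le> (1 / real p ^ (2 * k)) / (1 / real p ^ k)"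
      unfolding padic_norm_divide using p0 padic_norm_fact_ge[where 'p='p, of k]
      by (intro frac_le) (simp_all add: p_def)
    also have "\<dots> = ?B k" using p0 by (simp add: power_mult power2_eq_square power_mult_distrib mult_2 power_add)
    finally have 1: "padic_norm (?P ^ (2 * k) / fact k) \<le> ?B k" .
    have "padic_norm (of_int (d k) * ((- 1) ^ k * of_nat (stirling k j) * (- 1) ^ j) :: 'p padic) \<le> 1"
      by (simp add: padic_norm_mult padic_norm_power mult_le_one)
    from padic_norm_mult_le[OF 1 this] show ?thesis by (simp add: T_def)
  qed
  define \<Phi> where "\<Phi> = Abs_fps (\<lambda>j. \<Sum>\<^sub>\<infinity>k. T k j)"
  have "padic_norm (fps_nth \<Phi> j) \<le> ?B j" for j
    unfolding \<Phi>_def fps_nth_Abs_fps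
  proof (rule padic_norm_infsum_le)
    fix k
    show "padic_norm (T k j) \<le> ?B j"
    proof (cases "k < j")
      case True
      thus ?thesis by (simp add: T_def)
    next
      case False
      have "?B k \<le> ?B j" using False CARD_gt_1[where 'p='p] by (intro frac_le power_increasing) (auto simp: p_def)
      thus ?thesis using Tb[of k j] by linarith
    qed
  qed simp
  moreover have "((\<lambda>j. fps_nth \<Phi> j * x ^ j) has_sum padic_Gamma (?P ^ 4 * x)) UNIV" if x: "x \<in> padic_integers" for x
  proof -
    have x1: "padic_norm (x ^ j) \<le> 1" for j using x by (simp add: padic_norm_power power_le_one padic_integers_def)
    have "((\<lambda>j. \<Sum>\<^sub>\<infinity>k. T k j * x ^ j) has_sum (\<Sum>\<^sub>\<infinity>k. \<Sum>j\<le>k. T k j * x ^ j)) UNIV"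
    proof (rule padic_triangular_swap[OF B])
      show "padic_norm (T k j * x ^ j) \<le> ?B k" for k j
        using padic_norm_mult_le[OF Tb x1, of k j j] by simp
      show "T k j * x ^ j = 0" if "k < j" for k j using that by (simp add: T_def)
    qed
    also have "(\<lambda>j. \<Sum>\<^sub>\<infinity>k. T k j * x ^ j) = (\<lambda>j. fps_nth \<Phi> j * x ^ j)"
      by (simp add: \<Phi>_def infsum_cmult_left')
    also have "(\<Sum>\<^sub>\<infinity>k. \<Sum>j\<le>k. T k j * x ^ j) = (\<Sum>\<^sub>\<infinity>k. (x gchoose k) * (?P ^ (2 * k) * of_int (d k)))"
      unfolding gbinomial_stirling sum_distrib_right
      by (intro infsum_cong sum.cong) (simp_all add: T_def mult_ac)
    finally show ?thesis using d[OF x] by simp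
  qed
  ultimately show ?thesis using that unfolding p_def by blast
qed

section \<open>The identity theorem\<close>

lemma sums_terms_tendsto_0:
  fixes f :: "nat \<Rightarrow> 'p::prime_card padic"
  assumes "f sums s" shows "f \<longlonglongrightarrow> 0"
proof -
  have "(\<lambda>n. sum f {..<Suc n} - sum f {..<n}) \<longlonglongrightarrow> s - s"
    using assms unfolding sums_def by (intro tendsto_diff LIMSEQ_Suc)
  thus ?thesis by simp
qed

lemma padic_sums_has_sum:
  fixes f :: "nat \<Rightarrow> 'p::prime_card padic"
  assumes "f sums s" shows "(f has_sum s) UNIV"
proof -
  have "(f has_sum infsum f UNIV) UNIV"
    by (intro has_sum_infsum padic_summable_on_natI sums_terms_tendsto_0[OF assms])
  moreover from this have "infsum f UNIV = s" using has_sum_imp_sums sums_unique2 assms by blast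
  ultimately show ?thesis by simp
qed

text \<open>Let \<open>N\<close> be the lowest index of a nonzero coefficient. Evaluated at
  \<open>p^(s+t)\<close> with \<open>t\<close> large, the term of degree \<open>N\<close> would
  dominate all later ones.\<close>

lemma padic_series_identity_0:
  fixes a :: "nat \<Rightarrow> 'p::prime_card padic"
  assumes r: "r > 0" and a: "\<And>x. padic_norm x < r \<Longrightarrow> (\<lambda>n. a n * x ^ n) sums 0"
  shows "a n = 0"
proof (rule ccontr)
  assume "a n \<noteq> 0"
  define N where "N = (LEAST n. a n \<noteq> 0)"
  have N: "a N \<noteq> 0" unfolding N_def by (rule LeastI[of _ n]) fact
  have N0: "a i = 0" if "i < N" for i using not_less_Least[of i "\<lambda>n. a n \<noteq> 0"] that by (auto simp: N_def)
  let ?P = "of_nat CARD('p) :: 'p padic"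
  have P0: "?P \<noteq> 0" using CARD_gt_1[where 'p='p] by auto
  obtain s where s: "1 / real CARD('p) ^ s < r" using one_over_CARD_power_less[OF r] .
  \<comment> \<open>Rescaling by a fixed point of the disc makes the coefficients bounded, as the
    tail estimate requires.\<close>
  define b where "b = (\<lambda>n. a n * (?P ^ s) ^ n)"
  have "b \<longlonglongrightarrow> 0" unfolding b_def using s by (intro sums_terms_tendsto_0[of _ 0] a) simp
  hence b0: "(\<lambda>n. padic_norm (b n)) \<longlonglongrightarrow> 0" using tendsto_padic_norm by fastforce
  obtain C where C: "C > 0" "\<And>n. padic_norm (b n) \<le> C"
    using convergent_imp_Bseq[OF convergentI[OF b0]] by (auto simp: Bseq_def)
  have "b N = 0"
  proof (rule padic_eqI[of _ _ C])
    fix t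
    let ?x = "?P ^ t"
    have t1: "padic_norm ?x \<le> 1" using CARD_gt_1[where 'p='p] by simp
    have lt: "padic_norm (?P ^ s * ?x) < r"
      using padic_norm_mult_le[OF order.refl[of "padic_norm (?P ^ s)"] t1] s by simp
    have "((\<lambda>n. b n * ?x ^ n) has_sum 0) UNIV"
      using padic_sums_has_sum[OF a[OF lt]] by (simp add: b_def power_mult_distrib mult.assoc)
    hence "((\<lambda>n. b n * ?x ^ n + (if n = N then - (b N * ?x ^ N) else 0)) has_sum 0 + - (b N * ?x ^ N)) UNIV"
      by (rule has_sum_add) (rule has_sum_finite_neutralI[of "{N}"], auto)
    hence "- (b N * ?x ^ N) = (\<Sum>\<^sub>\<infinity>n. b n * ?x ^ n + (if n = N then - (b N * ?x ^ N) else 0))"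
      by (simp add: infsumI)
    also have "padic_norm \<dots> \<le> C * padic_norm ?x ^ Suc N"
    proof (rule padic_norm_infsum_le)
      fix n
      show "padic_norm (b n * ?x ^ n + (if n = N then - (b N * ?x ^ N) else 0)) \<le> C * padic_norm ?x ^ Suc N"
      proof (cases "n > N")
        case True
        have "padic_norm (?x ^ n) \<le> padic_norm ?x ^ Suc N"
          unfolding padic_norm_power[of ?x] using True t1 by (intro power_decreasing) auto
        from padic_norm_mult_le[OF C(2) this] show ?thesis using True by simp
      next
        case False
        hence "b n * ?x ^ n + (if n = N then - (b N * ?x ^ N) else 0) = 0"
          using N0[of n] by (cases "n = N") (auto simp: b_def)
        thus ?thesis using C(1) by (simp only: padic_norm_0) simp
      qed
    qed (use C(1) in simp)
    finally have "padic_norm (b N) * padic_norm ?x ^ N \<le> (C * padic_norm ?x) * padic_norm ?x ^ N"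
      by (simp add: padic_norm_mult padic_norm_power mult_ac)
    hence "padic_norm (b N) \<le> C * padic_norm ?x"
      using CARD_pos[where 'p='p] by (subst (asm) mult_le_cancel_right_pos) auto
    thus "padic_norm (b N - 0) \<le> C * (1 / real CARD('p) ^ t)" by simp
  qed
  thus False using N P0 by (simp add: b_def)
qed

lemma fps_eqI_of_sums:
  fixes F G :: "'p::prime_card padic fps"
  assumes "r > 0" "\<And>x. padic_norm x < r \<Longrightarrow> (\<lambda>n. fps_nth F n * x ^ n) sums v x"
    "\<And>x. padic_norm x < r \<Longrightarrow> (\<lambda>n. fps_nth G n * x ^ n) sums v x"
  shows "F = G"
proof (rule fps_ext)
  fix n
  have "(\<lambda>n. (fps_nth F n - fps_nth G n) * x ^ n) sums 0" if "padic_norm x < r" for x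
    using tendsto_diff[OF assms(2,3)[OF that, unfolded sums_def]]
    by (simp add: sums_def sum_subtractf left_diff_distrib)
  from padic_series_identity_0[OF assms(1) this] show "fps_nth F n = fps_nth G n" by simp
qed

text \<open>Undoes the substitution \<open>p^4 x\<close>; uniqueness is the identity theorem on the
  smaller of two discs.\<close>

lemma padic_Gamma_fps_eq:
  fixes \<Phi> :: "'p::prime_card padic fps"
  assumes "\<And>x. x \<in> padic_integers \<Longrightarrow> ((\<lambda>j. fps_nth \<Phi> j * x ^ j) has_sum padic_Gamma (of_nat CARD('p) ^ 4 * x)) UNIV"
  shows "padic_Gamma_fps = Abs_fps (\<lambda>n. fps_nth \<Phi> n / (of_nat CARD('p) ^ 4) ^ n)"
proof -
  let ?c = "of_nat CARD('p) ^ 4 :: 'p padic"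
  let ?F = "Abs_fps (\<lambda>n. fps_nth \<Phi> n / ?c ^ n)"
  let ?r = "1 / real CARD('p) ^ 4"
  have c0: "?c \<noteq> 0" using CARD_gt_1[where 'p='p] by auto
  have r0: "?r > 0" using CARD_pos[where 'p='p] by simp
  have F: "(\<lambda>n. fps_nth ?F n * x ^ n) sums padic_Gamma x" if "padic_norm x < ?r" for x
  proof -
    have "padic_norm (x / ?c) = padic_norm x / ?r" by (simp only: padic_norm_divide padic_norm_CARD_power)
    also have "\<dots> \<le> 1" using that r0 by (simp only: divide_le_eq_1) auto
    finally have "x / ?c \<in> padic_integers" by (simp add: padic_integers_def)
    from has_sum_imp_sums[OF assms[OF this]] show ?thesis using c0 by (simp add: power_divide)
  qed
  show ?thesis
    unfolding padic_Gamma_fps_def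
  proof (rule the_equality)
    show "\<exists>r>0. \<forall>x. padic_norm x < r \<longrightarrow> (\<lambda>n. fps_nth ?F n * x ^ n) sums padic_Gamma x"
      using F r0 by blast
    fix G :: "'p padic fps" assume "\<exists>r>0. \<forall>x. padic_norm x < r \<longrightarrow> (\<lambda>n. fps_nth G n * x ^ n) sums padic_Gamma x"
    then obtain r where r: "r > 0" "\<And>x. padic_norm x < r \<Longrightarrow> (\<lambda>n. fps_nth G n * x ^ n) sums padic_Gamma x" by blast
    show "G = ?F"
      by (rule fps_eqI_of_sums[of "min r ?r" _ padic_Gamma]) (use r F r0 in auto)
  qed
qed

section \<open>The logarithmic derivative of the Gamma function\<close>

definition fps_lim :: "(nat \<Rightarrow> 'p::prime_card padic fps) \<Rightarrow> 'p padic fps \<Rightarrow> bool" where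
  "fps_lim Fs F \<longleftrightarrow> (\<forall>j. (\<lambda>s. fps_nth (Fs s) j) \<longlonglongrightarrow> fps_nth F j)"

lemma fps_lim_const: "fps_lim (\<lambda>_. F) F"
  by (simp add: fps_lim_def)

lemma fps_lim_mult: "fps_lim Fs F \<Longrightarrow> fps_lim Gs G \<Longrightarrow> fps_lim (\<lambda>s. Fs s * Gs s) (F * G)"
  unfolding fps_lim_def fps_mult_nth by (auto intro!: tendsto_sum tendsto_mult_padic)

lemma fps_lim_diff: "fps_lim Fs F \<Longrightarrow> fps_lim Gs G \<Longrightarrow> fps_lim (\<lambda>s. Fs s - Gs s) (F - G)"
  unfolding fps_lim_def by (auto intro!: tendsto_diff)

lemma fps_lim_deriv: "fps_lim Fs F \<Longrightarrow> fps_lim (\<lambda>s. fps_deriv (Fs s)) (fps_deriv F)"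
  unfolding fps_lim_def by (auto intro!: tendsto_mult_padic)

lemma fps_lim_unique: "fps_lim Fs F \<Longrightarrow> fps_lim Fs G \<Longrightarrow> F = G"
  unfolding fps_lim_def by (auto intro!: fps_ext intro: LIMSEQ_unique)

text \<open>The expansions of \<open>F (x + h)\<close> and \<open>(F (x + h) - F x) / h\<close> in powers of \<open>x\<close>.\<close>

definition fps_shift_arg :: "'p::prime_card padic fps \<Rightarrow> 'p padic \<Rightarrow> 'p padic fps" where
  "fps_shift_arg F h = Abs_fps (\<lambda>j. \<Sum>\<^sub>\<infinity>i. fps_nth F i * of_nat (i choose j) * h ^ (i - j))"

definition fps_quotient_arg :: "'p::prime_card padic fps \<Rightarrow> 'p padic \<Rightarrow> 'p padic fps" where
  "fps_quotient_arg F h = Abs_fps (\<lambda>j. \<Sum>\<^sub>\<infinity>i. if i \<le> j then 0 else fps_nth F i * of_nat (i choose j) * h ^ (i - j - 1))"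

lemma padic_integers_power: "h \<in> padic_integers \<Longrightarrow> padic_norm (h ^ n :: 'p::prime_card padic) \<le> 1"
  by (simp add: padic_norm_power power_le_one padic_integers_def)

lemma padic_norm_term_le:
  fixes F :: "'p::prime_card padic fps"
  assumes F: "\<And>j. padic_norm (fps_nth F j) \<le> 1 / real CARD('p) ^ j" and h: "h \<in> padic_integers"
  shows "padic_norm (fps_nth F i * of_nat m * h ^ n) \<le> 1 / real CARD('p) ^ i"
  using padic_norm_mult_le[OF padic_norm_mult_le[OF F padic_norm_of_nat_le_1] padic_integers_power[OF h], of i m n] by simp

lemma fps_shift_arg_has_sum:
  fixes F :: "'p::prime_card padic fps"
  assumes F: "\<And>j. padic_norm (fps_nth F j) \<le> 1 / real CARD('p) ^ j"
    and h: "h \<in> padic_integers" and x: "x \<in> padic_integers"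
  shows "((\<lambda>j. fps_nth (fps_shift_arg F h) j * x ^ j) has_sum (\<Sum>\<^sub>\<infinity>i. fps_nth F i * (x + h) ^ i)) UNIV"
proof -
  let ?T = "\<lambda>i j. fps_nth F i * of_nat (i choose j) * h ^ (i - j) * x ^ j"
  have "((\<lambda>j. \<Sum>\<^sub>\<infinity>i. ?T i j) has_sum (\<Sum>\<^sub>\<infinity>i. \<Sum>j\<le>i. ?T i j)) UNIV"
  proof (rule padic_triangular_swap[OF one_over_CARD_power_tendsto_0[where 'p='p]])
    show "padic_norm (?T i j) \<le> 1 / real CARD('p) ^ i" for i j
      using padic_norm_mult_le[OF padic_norm_term_le[OF F h] padic_integers_power[OF x], of i "i choose j" "i - j" j] by simp
  qed simp
  also have "(\<lambda>j. \<Sum>\<^sub>\<infinity>i. ?T i j) = (\<lambda>j. fps_nth (fps_shift_arg F h) j * x ^ j)"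
    by (simp add: fps_shift_arg_def infsum_cmult_left')
  also have "(\<Sum>\<^sub>\<infinity>i. \<Sum>j\<le>i. ?T i j) = (\<Sum>\<^sub>\<infinity>i. fps_nth F i * (x + h) ^ i)"
    by (simp add: binomial_ring[of x h] sum_distrib_left mult_ac)
  finally show ?thesis .
qed

lemma fps_shift_arg_eq:
  fixes F :: "'p::prime_card padic fps"
  assumes F: "\<And>j. padic_norm (fps_nth F j) \<le> 1 / real CARD('p) ^ j" and h: "h \<in> padic_integers"
  shows "fps_shift_arg F h = F + fps_const h * fps_quotient_arg F h"
proof (rule fps_ext)
  fix j
  let ?u = "\<lambda>i. if i \<le> j then 0 else fps_nth F i * of_nat (i choose j) * h ^ (i - j - 1)"
  have ub: "padic_norm (?u i) \<le> 1 / real CARD('p) ^ i" for i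
    using padic_norm_term_le[OF F h, of i "i choose j" "i - j - 1"] by simp
  have "?u summable_on UNIV"
    by (intro padic_summable_on_natI tendsto_0_padicI[OF _ one_over_CARD_power_tendsto_0[where 'p='p]] always_eventually allI ub)
  hence "((\<lambda>i. (if i = j then fps_nth F j else 0) + h * ?u i) has_sum fps_nth F j + h * infsum ?u UNIV) UNIV"
    by (intro has_sum_add has_sum_cmult_right has_sum_infsum has_sum_finite_neutralI[of "{j}"]) auto
  also have "(\<lambda>i. (if i = j then fps_nth F j else 0) + h * ?u i) = (\<lambda>i. fps_nth F i * of_nat (i choose j) * h ^ (i - j))"
  proof
    fix i
    consider "i < j" | "i = j" | "i > j" by linarith
    thus "(if i = j then fps_nth F j else 0) + h * ?u i = fps_nth F i * of_nat (i choose j) * h ^ (i - j)"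
    proof cases
      case 3
      then obtain m where "i - j = Suc m" by (metis Suc_diff_Suc)
      thus ?thesis using 3 by simp
    qed auto
  qed
  finally show "fps_nth (fps_shift_arg F h) j = fps_nth (F + fps_const h * fps_quotient_arg F h) j"
    by (simp add: fps_shift_arg_def fps_quotient_arg_def infsumI)
qed

text \<open>In degree \<open>j\<close> the term of index \<open>i\<close> carries
  \<open>h^(i - j - 1)\<close>; as \<open>h\<close> tends to zero only \<open>i = j + 1\<close>
  remains, with coefficient \<open>j + 1\<close>.\<close>

lemma fps_lim_quotient_arg:
  fixes F :: "'p::prime_card padic fps"
  assumes F: "\<And>j. padic_norm (fps_nth F j) \<le> 1 / real CARD('p) ^ j"
  shows "fps_lim (\<lambda>s. fps_quotient_arg F (of_nat CARD('p) ^ s)) (fps_deriv F)"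
  unfolding fps_lim_def
proof
  fix j
  let ?P = "of_nat CARD('p) :: 'p padic"
  let ?u = "\<lambda>s i. if i \<le> j then 0 else fps_nth F i * of_nat (i choose j) * (?P ^ s) ^ (i - j - 1)"
  let ?g = "\<lambda>i. if i = Suc j then of_nat (Suc j) * fps_nth F (Suc j) else 0"
  have P: "?P ^ s \<in> padic_integers" for s unfolding of_nat_power[symmetric] by (rule padic_integers_of_nat)
  have "(\<lambda>s. infsum (?u s) UNIV) \<longlonglongrightarrow> infsum ?g UNIV"
  proof (rule tendsto_padic_infsum[where B = "\<lambda>i. 1 / real CARD('p) ^ i" and f = ?u and g = ?g])
    fix i
    consider "i \<le> j" | "i = Suc j" | m where "i = Suc (Suc (j + m))"
      by (metis less_imp_Suc_add not_less not_less_eq_eq add_Suc_right le_neq_implies_less less_iff_Suc_add)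
    thus "(\<lambda>s. ?u s i) \<longlonglongrightarrow> ?g i"
    proof cases
      case 3
      have "(\<lambda>s. fps_nth F i * of_nat (i choose j) * (?P ^ s) ^ Suc m) \<longlonglongrightarrow> fps_nth F i * of_nat (i choose j) * 0 ^ Suc m"
        by (intro tendsto_mult_padic tendsto_power_padic CARD_power_tendsto_0 tendsto_const)
      thus ?thesis using 3 by simp
    qed (auto simp: mult.commute)
  next
    show "\<forall>\<^sub>F s in sequentially. \<forall>i\<in>UNIV. padic_norm (?u s i) \<le> 1 / real CARD('p) ^ i"
      using padic_norm_term_le[OF F P] by (intro always_eventually) simp
    show "finite {i \<in> UNIV. 1 / real CARD('p) ^ i \<ge> e}" if "e > 0" for e
      by (rule finite_nat_ge_of_tendsto_0[OF one_over_CARD_power_tendsto_0 that])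
  qed
  moreover have "infsum ?g UNIV = of_nat (Suc j) * fps_nth F (Suc j)"
    by (intro infsumI has_sum_finite_neutralI[of "{Suc j}"]) auto
  ultimately show "(\<lambda>s. fps_nth (fps_quotient_arg F (?P ^ s)) j) \<longlonglongrightarrow> fps_nth (fps_deriv F) j"
    by (simp add: fps_quotient_arg_def)
qed

section \<open>Shift polynomials as power series\<close>

lemma fps_conv_linear:
  fixes a b :: "'p::prime_card padic"
  shows "fps_conv (fps_const a + fps_const b * fps_X) x"
    and "fps_val (fps_const a + fps_const b * fps_X) x = a + b * x"
proof -
  let ?F = "fps_const a + fps_const b * fps_X"
  have "((\<lambda>n. fps_nth ?F n * x ^ n) has_sum (\<Sum>n\<in>{0,1}. fps_nth ?F n * x ^ n)) UNIV"
    by (rule has_sum_finite_neutralI[of "{0,1}"]) auto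
  hence h: "((\<lambda>n. fps_nth ?F n * x ^ n) has_sum a + b * x) UNIV" by simp
  thus "fps_val ?F x = a + b * x" by (simp add: fps_val_def infsumI)
  show "fps_conv ?F x" unfolding fps_conv_def by (rule sums_terms_tendsto_0[OF has_sum_imp_sums[OF h]])
qed

lemma fps_conv_mult: "fps_conv F x \<Longrightarrow> fps_conv G x \<Longrightarrow> fps_conv (F * G) (x :: 'p::prime_card padic)"
  unfolding fps_conv_def[of "F * G"] by (rule sums_terms_tendsto_0[OF has_sum_imp_sums[OF fps_val_mult(2)]])

text \<open>Links the polynomial formed among power series to its pointwise values, so that the
  identity theorem can compare it with the Gamma function.\<close>

lemma fps_gamma_shift:
  fixes c :: "'p::prime_card padic"
  shows "fps_conv (gamma_shift p A (fps_const c * fps_X)) x \<and>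
         fps_val (gamma_shift p A (fps_const c * fps_X)) x = gamma_shift p A (c * x)"
proof (induction A)
  case (Suc A)
  let ?G = "gamma_shift p A (fps_const c * fps_X)"
  show ?case
  proof (cases "coprime A p")
    case True
    hence "gamma_shift p (Suc A) (fps_const c * fps_X) = (fps_const (- of_nat A) + fps_const (- c) * fps_X) * ?G"
      by (simp add: gamma_shift_Suc fps_of_nat[symmetric] flip: fps_const_neg)
    thus ?thesis using True Suc fps_conv_linear[of "- of_nat A" "- c" x] fps_val_mult(1)[of _ x ?G] fps_conv_mult[of _ x ?G]
      by (simp only: gamma_shift_Suc) (simp add: algebra_simps)
  next
    case False
    hence "gamma_shift p (Suc A) (fps_const c * fps_X) = (fps_const (- 1) + fps_const 0 * fps_X) * ?G"
      by (simp add: gamma_shift_Suc flip: fps_const_neg)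
    thus ?thesis using False Suc fps_conv_linear[of "- 1" 0 x] fps_val_mult(1)[of _ x ?G] fps_conv_mult[of _ x ?G]
      by (simp only: gamma_shift_Suc) simp
  qed
qed simp

text \<open>The expansion in \<open>T\<close> of the sum of \<open>c / (c T + i)\<close>, the
  logarithmic derivative of \<open>gamma_shift p A\<close> at \<open>c T\<close>.\<close>

definition log_deriv_shift :: "nat \<Rightarrow> nat \<Rightarrow> 'a::field_char_0 \<Rightarrow> 'a fps" where
  "log_deriv_shift p A c = Abs_fps (\<lambda>j. \<Sum>i | i < A \<and> coprime i p. c * (- c) ^ j * inverse (of_nat i) ^ Suc j)"

lemma fps_deriv_gamma_shift:
  fixes c :: "'a::field_char_0"
  assumes p: "p \<noteq> 1"
  shows "fps_deriv (gamma_shift p A (fps_const c * fps_X)) = gamma_shift p A (fps_const c * fps_X) * log_deriv_shift p A c"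
proof (induction A)
  case 0
  show ?case by (simp add: fps_eq_iff log_deriv_shift_def)
next
  case (Suc A)
  let ?G = "gamma_shift p A (fps_const c * fps_X)"
  show ?case
  proof (cases "coprime A p")
    case True
    hence A0: "(of_nat A :: 'a) \<noteq> 0" using p by (cases "A = 0") auto
    \<comment> \<open>The geometric series for \<open>c / (c X + A)\<close>, contributed by the new
      factor; \<open>A\<close> is nonzero because it is coprime to
      \<open>p \<noteq> 1\<close>.\<close>
    define G where "G = Abs_fps (\<lambda>j. c * (- c) ^ j * inverse (of_nat A :: 'a) ^ Suc j)"
    have L: "log_deriv_shift p (Suc A) c = log_deriv_shift p A c + G"
      using True by (simp add: fps_eq_iff log_deriv_shift_def G_def coprime_less_Suc algebra_simps)
    have G: "(fps_const c * fps_X + of_nat A) * G = fps_const c"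
    proof (rule fps_ext)
      fix j
      show "fps_nth ((fps_const c * fps_X + of_nat A) * G) j = fps_nth (fps_const c) j"
        using A0 by (cases j) (simp_all add: distrib_right G_def mult.assoc fps_of_nat[symmetric] field_simps)
    qed
    have "fps_deriv (gamma_shift p (Suc A) (fps_const c * fps_X)) =
        - (fps_const c * ?G) - (fps_const c * fps_X + of_nat A) * fps_deriv ?G"
      using True by (simp add: gamma_shift_Suc algebra_simps)
    also have "\<dots> = - (fps_const c * ?G) - (fps_const c * fps_X + of_nat A) * (?G * log_deriv_shift p A c)"
      unfolding Suc.IH ..
    also have "\<dots> = (- (fps_const c * fps_X + of_nat A) * ?G) * (log_deriv_shift p A c + G)"
    proof -
      have "(- B * H) * (M + G) = - (B * G * H) - B * (H * M)" for B H M :: "'a fps"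
        by (simp add: algebra_simps)
      thus ?thesis by (simp only: G)
    qed
    also have "\<dots> = gamma_shift p (Suc A) (fps_const c * fps_X) * log_deriv_shift p (Suc A) c"
      using True by (simp only: L gamma_shift_Suc if_True)
    finally show ?thesis .
  next
    case False
    hence "log_deriv_shift p (Suc A) c = log_deriv_shift p A c"
      by (simp add: log_deriv_shift_def coprime_less_Suc)
    thus ?thesis using False Suc.IH by (simp add: gamma_shift_Suc)
  qed
qed

text \<open>A step \<open>p^s\<close> of the scaled variable is a step \<open>p^(4+s)\<close> of the
  argument. At natural numbers this is \<open>gamma_int_add\<close>; continuity does the
  rest.\<close>

lemma padic_Gamma_shift:
  fixes x :: "'p::prime_card padic"
  assumes p2: "CARD('p) \<noteq> 2" and x: "x \<in> padic_integers"
  shows "padic_Gamma (of_nat CARD('p) ^ 4 * (x + of_nat CARD('p) ^ s)) =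
     gamma_shift CARD('p) (CARD('p) ^ (4 + s)) (of_nat CARD('p) ^ 4 * x) * padic_Gamma (of_nat CARD('p) ^ 4 * x)"
proof -
  let ?p = "CARD('p)"
  let ?c = "of_nat ?p ^ 4 :: 'p padic"
  let ?A = "?p ^ (4 + s)"
  have P: "of_nat ?p ^ n \<in> (padic_integers :: 'p padic set)" for n unfolding of_nat_power[symmetric] by (rule padic_integers_of_nat)
  have G: "continuous_on padic_integers (\<lambda>x. padic_Gamma (f x) :: 'p padic)"
    if "continuous_on padic_integers f" "\<And>x. x \<in> padic_integers \<Longrightarrow> f x \<in> padic_integers" for f :: "'p padic \<Rightarrow> 'p padic"
    by (rule continuous_on_compose2[OF padic_Gamma_props(1)[OF p2] that(1)]) (use that(2) in auto)
  have lin: "continuous_on padic_integers (\<lambda>x. ?c * (x + h))" for h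
    unfolding continuous_on_def by (auto intro!: tendsto_mult_padic tendsto_add tendsto_ident_at)
  have lin0: "continuous_on padic_integers (\<lambda>x. ?c * x)" using lin[of 0] by simp
  have sh: "continuous_on padic_integers (\<lambda>x. gamma_shift ?p ?A (?c * x) :: 'p padic)"
  proof (rule continuous_on_padic_integersI)
    fix x y :: "'p padic" and k assume xy: "x \<in> padic_integers" "y \<in> padic_integers" "padic_norm (x - y) \<le> 1 / real CARD('p) ^ k"
    have "padic_norm (gamma_shift ?p ?A (?c * x) - gamma_shift ?p ?A (?c * y)) \<le> padic_norm (?c * x - ?c * y)"
      by (intro gamma_shift_cong padic_integers_closed P xy)
    also have "\<dots> \<le> 1 * (1 / real CARD('p) ^ k)"
      unfolding right_diff_distrib[symmetric] using P[of 4] by (intro padic_norm_mult_le xy) (simp add: padic_integers_def)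
    finally show "padic_norm (gamma_shift ?p ?A (?c * x) - gamma_shift ?p ?A (?c * y)) \<le> 1 / real CARD('p) ^ k" by simp
  qed
  show ?thesis
  proof (rule padic_continuous_eqI[OF _ _ _ x, where f = "\<lambda>x. padic_Gamma (?c * (x + of_nat ?p ^ s))"
        and g = "\<lambda>x. gamma_shift ?p ?A (?c * x) * padic_Gamma (?c * x)"])
    show "continuous_on padic_integers (\<lambda>x. padic_Gamma (?c * (x + of_nat ?p ^ s)) :: 'p padic)"
      by (intro G lin padic_integers_closed P)
    have "continuous_on padic_integers (\<lambda>x. padic_Gamma (?c * x) :: 'p padic)"
      by (intro G lin0 padic_integers_closed P)
    with sh show "continuous_on padic_integers (\<lambda>x. gamma_shift ?p ?A (?c * x) * padic_Gamma (?c * x))"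
      unfolding continuous_on_def by (auto intro!: tendsto_mult_padic)
    fix n
    have "padic_Gamma (?c * (of_nat n + of_nat ?p ^ s)) = padic_Gamma (of_nat (?p ^ 4 * n + ?A))"
      by (simp add: algebra_simps power_add)
    also have "\<dots> = of_int (gamma_int ?p (?p ^ 4 * n + ?A))" by (rule padic_Gamma_props(2)[OF p2])
    also have "gamma_int ?p (?p ^ 4 * n + ?A) = gamma_int ?p (?p ^ 4 * n) * gamma_shift ?p ?A (int (?p ^ 4 * n))"
      by (rule gamma_int_add) simp
    also have "of_int \<dots> = gamma_shift ?p ?A (?c * of_nat n) * padic_Gamma (of_nat (?p ^ 4 * n))"
      by (simp add: of_int_gamma_shift padic_Gamma_props(2)[OF p2] del: of_nat_mult) (simp add: mult.commute)
    finally show "padic_Gamma (?c * (of_nat n + of_nat ?p ^ s)) = gamma_shift ?p ?A (?c * of_nat n) * padic_Gamma (?c * of_nat n)"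
      by simp
  qed
qed

text \<open>Each coefficient is a Riemann sum at level \<open>s + 4\<close>, while only
  \<open>p^s\<close> is divided out. The difference is one more factor \<open>c\<close>, hence the
  exponent \<open>j + 2\<close>.\<close>

lemma fps_lim_log_deriv_shift:
  assumes c: "c = (of_nat CARD('p) ^ 4 :: 'p::prime_card padic)"
  shows "fps_lim (\<lambda>s. fps_const (inverse (of_nat CARD('p) ^ s)) * log_deriv_shift CARD('p) (CARD('p) ^ (4 + s)) c)
     (Abs_fps (\<lambda>j. (- 1) ^ j * c ^ (j + 2) * volk_inverse_power (Suc j)))"
  unfolding fps_lim_def
proof
  fix j
  let ?P = "of_nat CARD('p) :: 'p padic"
  have P0: "?P \<noteq> 0" using CARD_gt_1[where 'p='p] by auto
  let ?S = "\<lambda>N. unit_sum (\<lambda>a. inverse (of_int a) ^ Suc j) N / ?P ^ N"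
  have "?S \<longlonglongrightarrow> volk_inverse_power (Suc j)"
    using has_volk_volk_inverse_power[of "Suc j", where 'p='p] unfolding has_volk_def by simp
  hence "(\<lambda>s. (- 1) ^ j * c ^ (j + 2) * ?S (s + 4)) \<longlonglongrightarrow> (- 1) ^ j * c ^ (j + 2) * volk_inverse_power (Suc j)"
    by (intro tendsto_mult_padic tendsto_const LIMSEQ_ignore_initial_segment)
  also have "(\<lambda>s. (- 1) ^ j * c ^ (j + 2) * ?S (s + 4)) =
      (\<lambda>s. fps_nth (fps_const (inverse (?P ^ s)) * log_deriv_shift CARD('p) (CARD('p) ^ (4 + s)) c) j)"
  proof
    fix s
    have "fps_nth (log_deriv_shift CARD('p) (CARD('p) ^ (4 + s)) c) j = (c * (- c) ^ j) * unit_sum (\<lambda>a. inverse (of_int a) ^ Suc j) (s + 4)"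
      unfolding log_deriv_shift_def unit_sum_def by (simp add: sum_distrib_left add.commute)
    moreover have "?P ^ (s + 4) = ?P ^ s * c" by (simp add: c power_add)
    moreover have "c \<noteq> 0" using P0 by (simp add: c)
    ultimately show "(- 1) ^ j * c ^ (j + 2) * ?S (s + 4) =
        fps_nth (fps_const (inverse (?P ^ s)) * log_deriv_shift CARD('p) (CARD('p) ^ (4 + s)) c) j"
      using P0 by (simp add: power_minus[of c] field_simps)
  qed
  finally show "(\<lambda>s. fps_nth (fps_const (inverse (?P ^ s)) * log_deriv_shift CARD('p) (CARD('p) ^ (4 + s)) c) j)
     \<longlonglongrightarrow> fps_nth (Abs_fps (\<lambda>j. (- 1) ^ j * c ^ (j + 2) * volk_inverse_power (Suc j))) j" by simp
qed

text \<open>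
  Comparing the logarithmic derivatives of \<open>\<Phi> (x + p^s)\<close> and \<open>\<Phi> x\<close>, dividing by \<open>p^s\<close> and letting \<open>s\<close> tend to
  infinity computes the derivative of \<open>\<Phi>' / \<Phi>\<close>; denominators are cleared to avoid limits of quotients.
\<close>

lemma log_deriv_scaled:
  fixes \<Phi> :: "'p::prime_card padic fps"
  assumes p2: "CARD('p) \<noteq> 2"
    and F: "\<And>j. padic_norm (fps_nth \<Phi> j) \<le> 1 / real CARD('p) ^ j"
    and \<Phi>: "\<And>x. x \<in> padic_integers \<Longrightarrow> ((\<lambda>j. fps_nth \<Phi> j * x ^ j) has_sum padic_Gamma (of_nat CARD('p) ^ 4 * x)) UNIV"
    and c: "c = of_nat CARD('p) ^ 4"
  shows "fps_deriv (fps_deriv \<Phi>) * \<Phi> - fps_deriv \<Phi> * fps_deriv \<Phi> =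
     Abs_fps (\<lambda>j. (- 1) ^ j * c ^ (j + 2) * volk_inverse_power (Suc j)) * (\<Phi> * \<Phi>)"
proof -
  let ?p = "CARD('p)"
  let ?h = "\<lambda>s. of_nat ?p ^ s :: 'p padic"
  let ?D = "\<lambda>s. fps_quotient_arg \<Phi> (?h s)"
  let ?S = "\<lambda>s. fps_shift_arg \<Phi> (?h s)"
  let ?L = "\<lambda>s. fps_const (inverse (?h s)) * log_deriv_shift ?p (?p ^ (4 + s)) c"
  have h0: "?h s \<noteq> 0" for s using CARD_gt_1[where 'p='p] by auto
  have hZ: "?h s \<in> padic_integers" for s unfolding of_nat_power[symmetric] by (rule padic_integers_of_nat)
  have S: "?S s = \<Phi> + fps_const (?h s) * ?D s" for s by (rule fps_shift_arg_eq[OF F hZ])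
  \<comment> \<open>From \<open>S = A \<Phi>\<close> one gets
    \<open>S' \<Phi> - \<Phi>' S = A' \<Phi> \<Phi>\<close>; from \<open>S = \<Phi> + h D\<close>
    the left side is \<open>h (D' \<Phi> - \<Phi>' D)\<close>. So \<open>h\<close> cancels before
    the limit is taken.\<close>
  have key: "fps_deriv (?D s) * \<Phi> - fps_deriv \<Phi> * ?D s = ?L s * (?S s * \<Phi>)" for s
  proof -
    let ?A = "gamma_shift ?p (?p ^ (4 + s)) (fps_const c * fps_X)"
    have SA: "?S s = ?A * \<Phi>"
    proof (rule fps_eqI_of_sums[of 1 _ "\<lambda>x. padic_Gamma (of_nat ?p ^ 4 * (x + ?h s))"])
      fix x :: "'p padic" assume "padic_norm x < 1"
      hence x: "x \<in> padic_integers" by (simp add: padic_integers_def)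
      show "(\<lambda>n. fps_nth (?S s) n * x ^ n) sums padic_Gamma (of_nat ?p ^ 4 * (x + ?h s))"
        using has_sum_imp_sums[OF fps_shift_arg_has_sum[OF F hZ x]] infsumI[OF \<Phi>[OF padic_integers_closed(1)[OF x hZ]]] by simp
      have cv: "fps_conv \<Phi> x" unfolding fps_conv_def by (rule sums_terms_tendsto_0[OF has_sum_imp_sums[OF \<Phi>[OF x]]])
      have vl: "fps_val \<Phi> x = padic_Gamma (c * x)" unfolding fps_val_def c by (rule infsumI[OF \<Phi>[OF x]])
      have "((\<lambda>n. fps_nth (?A * \<Phi>) n * x ^ n) has_sum gamma_shift ?p (?p ^ (4 + s)) (c * x) * padic_Gamma (c * x)) UNIV"
        using fps_val_mult(2)[OF _ cv, of ?A] fps_gamma_shift[of ?p "?p ^ (4 + s)" c x] vl by simp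
      thus "(\<lambda>n. fps_nth (?A * \<Phi>) n * x ^ n) sums padic_Gamma (of_nat ?p ^ 4 * (x + ?h s))"
        unfolding padic_Gamma_shift[OF p2 x] c by (rule has_sum_imp_sums)
    qed simp
    have p1: "?p \<noteq> 1" using CARD_gt_1[where 'p='p] by simp
    have "fps_const (?h s) * (fps_deriv (?D s) * \<Phi> - fps_deriv \<Phi> * ?D s) = fps_deriv (?S s) * \<Phi> - fps_deriv \<Phi> * ?S s"
      unfolding S by (simp add: algebra_simps)
    also have "\<dots> = fps_deriv ?A * \<Phi> * \<Phi>" unfolding SA by (simp add: algebra_simps)
    also have "\<dots> = log_deriv_shift ?p (?p ^ (4 + s)) c * (?S s * \<Phi>)"
      unfolding fps_deriv_gamma_shift[OF p1] SA by (simp add: mult_ac)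
    also have "log_deriv_shift ?p (?p ^ (4 + s)) c = fps_const (?h s) * ?L s"
      using h0[of s] by (simp add: mult.assoc[symmetric] fps_const_mult)
    finally have "fps_const (?h s) * (fps_deriv (?D s) * \<Phi> - fps_deriv \<Phi> * ?D s) = fps_const (?h s) * (?L s * (?S s * \<Phi>))"
      by (simp only: mult.assoc)
    thus ?thesis using h0[of s] by (simp only: mult_cancel_left fps_const_eq_0_iff) simp
  qed
  have D: "fps_lim ?D (fps_deriv \<Phi>)" by (rule fps_lim_quotient_arg[OF F])
  have "fps_lim ?S \<Phi>"
    unfolding fps_lim_def
  proof
    fix j
    have "(\<lambda>s. fps_nth \<Phi> j + ?h s * fps_nth (?D s) j) \<longlonglongrightarrow> fps_nth \<Phi> j + 0 * fps_nth (fps_deriv \<Phi>) j"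
      using D unfolding fps_lim_def by (intro tendsto_add tendsto_mult_padic tendsto_const CARD_power_tendsto_0) blast
    thus "(\<lambda>s. fps_nth (?S s) j) \<longlonglongrightarrow> fps_nth \<Phi> j" unfolding S by simp
  qed
  hence "fps_lim (\<lambda>s. ?L s * (?S s * \<Phi>)) (Abs_fps (\<lambda>j. (- 1) ^ j * c ^ (j + 2) * volk_inverse_power (Suc j)) * (\<Phi> * \<Phi>))"
    by (intro fps_lim_mult fps_lim_log_deriv_shift c fps_lim_const)
  moreover have "fps_lim (\<lambda>s. fps_deriv (?D s) * \<Phi> - fps_deriv \<Phi> * ?D s)
      (fps_deriv (fps_deriv \<Phi>) * \<Phi> - fps_deriv \<Phi> * fps_deriv \<Phi>)"
    by (intro fps_lim_diff fps_lim_mult fps_lim_deriv fps_lim_const D)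
  ultimately show ?thesis unfolding key by (rule fps_lim_unique[rotated])
qed

section \<open>Removing the scale \<open>p^4\<close> and conclusion\<close>

definition fps_rescale :: "'a::field \<Rightarrow> 'a fps \<Rightarrow> 'a fps" where
  "fps_rescale c F = Abs_fps (\<lambda>n. fps_nth F n / c ^ n)"

lemma fps_rescale_mult:
  assumes "c \<noteq> 0" shows "fps_rescale c (F * G) = fps_rescale c F * fps_rescale c G"
proof (rule fps_ext)
  fix n
  have "fps_nth F i * fps_nth G (n - i) / c ^ n = fps_nth F i / c ^ i * (fps_nth G (n - i) / c ^ (n - i))"
    if "i \<in> {0..n}" for i
    using that assms by (simp flip: power_add)
  hence "(\<Sum>i=0..n. fps_nth F i * fps_nth G (n - i) / c ^ n) =
      (\<Sum>i=0..n. fps_nth F i / c ^ i * (fps_nth G (n - i) / c ^ (n - i)))"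
    by (rule sum.cong[OF refl])
  thus "fps_nth (fps_rescale c (F * G)) n = fps_nth (fps_rescale c F * fps_rescale c G) n"
    by (simp only: fps_rescale_def fps_mult_nth sum_divide_distrib fps_nth_Abs_fps)
qed

lemma fps_rescale_diff: "fps_rescale c (F - G) = fps_rescale c F - fps_rescale c G"
  by (simp add: fps_rescale_def fps_eq_iff diff_divide_distrib)

lemma fps_rescale_deriv: "c \<noteq> 0 \<Longrightarrow> fps_rescale c (fps_deriv F) = fps_const c * fps_deriv (fps_rescale c F)"
  by (simp add: fps_rescale_def fps_eq_iff)

text \<open>The quotient \<open>g = G' / G\<close> satisfies \<open>g' G^2 = G'' G - G'^2\<close>,
  so the scaled identity determines \<open>g'\<close>. Each derivative yields a factor
  \<open>c\<close> under rescaling, which uses up the excess in \<open>c^(j+2)\<close>.\<close>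

lemma padic_log_deriv_Gamma_nth:
  assumes p2: "CARD('p::prime_card) \<noteq> 2"
  shows "fps_nth padic_log_deriv_Gamma (Suc j) = (log_coeff (Suc j) * volk_inverse_power (Suc j) :: 'p padic)"
proof -
  obtain \<Phi> :: "'p padic fps" where F: "\<And>j. padic_norm (fps_nth \<Phi> j) \<le> 1 / real CARD('p) ^ j"
    and \<Phi>: "\<And>x. x \<in> padic_integers \<Longrightarrow> ((\<lambda>j. fps_nth \<Phi> j * x ^ j) has_sum padic_Gamma (of_nat CARD('p) ^ 4 * x)) UNIV"
    using padic_Gamma_local_series[OF p2] by blast
  define c where "c = (of_nat CARD('p) ^ 4 :: 'p padic)"
  have c0: "c \<noteq> 0" using CARD_gt_1[where 'p='p] by (auto simp: c_def)
  define G where "G = (padic_Gamma_fps :: 'p padic fps)"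
  have G: "G = fps_rescale c \<Phi>" unfolding G_def c_def fps_rescale_def by (rule padic_Gamma_fps_eq[OF \<Phi>])
  define V where "V = Abs_fps (\<lambda>j. (- 1) ^ j * c ^ (j + 2) * volk_inverse_power (Suc j) :: 'p padic)"
  define g where "g = (padic_log_deriv_Gamma :: 'p padic fps)"
  have "((\<lambda>j. fps_nth \<Phi> j * 0 ^ j) has_sum fps_nth \<Phi> 0) UNIV"
    by (rule has_sum_finite_neutralI[of "{0}"]) auto
  moreover have "((\<lambda>j. fps_nth \<Phi> j * 0 ^ j) has_sum padic_Gamma 0) UNIV" using \<Phi>[of 0] by simp
  ultimately have "fps_nth \<Phi> 0 = padic_Gamma 0" by (rule has_sum_unique)
  also have "\<dots> = 1" using padic_Gamma_props(2)[OF p2, of 0] by simp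
  finally have G0: "fps_nth G 0 = 1" by (simp add: G fps_rescale_def)
  hence Gn: "G \<noteq> 0" by auto
  \<comment> \<open>The division is genuine because the constant coefficient of \<open>G\<close> is
    1, the value of the Gamma function at 0.\<close>
  have gG: "g * G = fps_deriv G"
    using G0 unfolding g_def padic_log_deriv_Gamma_def G_def[symmetric]
    by (simp add: fps_divide_unit mult.assoc inverse_mult_eq_1)
  have "fps_deriv (fps_deriv G) = fps_deriv g * G + g * fps_deriv G"
    using arg_cong[OF gG, of fps_deriv] by (simp add: add.commute)
  hence gd: "fps_deriv (fps_deriv G) * G - fps_deriv G * fps_deriv G = fps_deriv g * (G * G)"
    using gG by (simp add: algebra_simps)
  have "fps_const c * (fps_const c * (fps_deriv (fps_deriv G) * G - fps_deriv G * fps_deriv G)) = fps_rescale c V * (G * G)"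
    using arg_cong[OF log_deriv_scaled[OF p2 F \<Phi> c_def], of "fps_rescale c"]
    unfolding V_def[symmetric] fps_rescale_diff fps_rescale_mult[OF c0] fps_rescale_deriv[OF c0] G[symmetric]
    by (simp add: algebra_simps)
  hence "(fps_const c * (fps_const c * fps_deriv g)) * (G * G) = fps_rescale c V * (G * G)"
    unfolding gd by (simp only: mult.assoc)
  hence "fps_const c * (fps_const c * fps_deriv g) = fps_rescale c V" using Gn by simp
  hence "fps_nth (fps_const c * (fps_const c * fps_deriv g)) j = fps_nth (fps_rescale c V) j" by simp
  hence "c * (c * (of_nat (Suc j) * fps_nth g (Suc j))) = (- 1) ^ j * c ^ (j + 2) * volk_inverse_power (Suc j) / c ^ j"
    by (simp add: fps_rescale_def V_def)
  also have "\<dots> = c * (c * ((- 1) ^ j * volk_inverse_power (Suc j)))"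
    using c0 by (simp add: power_add power2_eq_square)
  finally have "of_nat (Suc j) * fps_nth g (Suc j) = (- 1) ^ j * volk_inverse_power (Suc j)"
    using c0 by (simp only: mult_cancel_left) simp
  thus ?thesis unfolding g_def log_coeff_def by (simp add: field_simps del: of_nat_Suc)
qed

theorem corollary7p4p1:
  fixes p :: nat
  assumes "p = CARD('p::prime_card)" and "p \<noteq> 2"
  shows
    "(\<forall>n\<ge>1. \<forall>l\<ge>1.
        (\<lambda>m. of_nat ((1 + 2 * m) choose l) * of_nat (n * p) ^ (1 + 2 * m - l) *
             (padic_L (\<lambda>a. inverse (teichmueller a) ^ (2 * m)) (of_nat (1 + 2 * m)) /
              of_nat (1 + 2 * m)) :: 'p padic)
          summable_on {m :: nat. real m \<ge> real l / 2} \<and>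
        (- 1) ^ (l - 1) / of_nat l * coprime_power_sum l (n * p) =
        - (\<Sum>\<^sub>\<infinity>m\<in>{m :: nat. real m \<ge> real l / 2}.
             of_nat ((1 + 2 * m) choose l) * of_nat (n * p) ^ (1 + 2 * m - l) *
             (padic_L (\<lambda>a. inverse (teichmueller a) ^ (2 * m)) (of_nat (1 + 2 * m)) /
              of_nat (1 + 2 * m)) :: 'p padic)) \<and>
     (\<forall>n\<ge>1.
        summable (\<lambda>j. fps_nth (padic_log_deriv_Gamma :: 'p padic fps) j * of_nat (n * p) ^ j) \<and>
        coprime_power_sum 1 (n * p) =
          padic_fps_eval (padic_log_deriv_Gamma :: 'p padic fps) (of_nat (n * p)) -
          padic_fps_eval padic_log_deriv_Gamma 0) \<and>
     fps_nth (fps_deriv (padic_log_deriv_Gamma :: 'p padic fps)) 0 = 0 \<and>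
     (\<lambda>k. (1 / of_nat p ^ k) *
           (\<Sum>i | i \<le> p ^ k - 1 \<and> coprime i p. inverse (of_nat i)) :: 'p padic) \<longlonglongrightarrow> 0"
proof (intro conjI allI impI)
  have p2: "CARD('p) \<noteq> 2" using assms by simp
  have teich: "teich_char e = (\<lambda>a. inverse (teichmueller a :: 'p padic) ^ e)" for e by (simp add: teich_char_def fun_eq_iff)
  fix n l :: nat assume n: "n \<ge> 1" and l: "l \<ge> 1"
  let ?M = "{m :: nat. real m \<ge> real l / 2}"
  let ?T = "\<lambda>m. of_nat ((1 + 2 * m) choose l) * of_nat (n * p) ^ (1 + 2 * m - l) *
             (padic_L (\<lambda>a. inverse (teichmueller a) ^ (2 * m)) (of_nat (1 + 2 * m)) / of_nat (1 + 2 * m)) :: 'p padic"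
  have "((\<lambda>m. - ?T m) has_sum (- 1) ^ (l - 1) / of_nat l * coprime_power_sum l (n * p)) ?M"
    using coprime_power_sum_series[OF n l p2] unfolding teich assms(1)[symmetric] .
  hence *: "(?T has_sum - ((- 1) ^ (l - 1) / of_nat l * coprime_power_sum l (n * p))) ?M"
    by (subst has_sum_uminus[symmetric]) simp
  show "?T summable_on ?M" using * by (rule has_sum_imp_summable)
  show "(- 1) ^ (l - 1) / of_nat l * coprime_power_sum l (n * p) = - infsum ?T ?M"
    unfolding infsumI[OF *] by simp
next
  have p2: "CARD('p) \<noteq> 2" using assms by simp
  fix n :: nat assume n: "n \<ge> 1"
  define g where "g = (padic_log_deriv_Gamma :: 'p padic fps)"
  let ?x = "of_nat (n * p) :: 'p padic"
  have "((\<lambda>k. log_coeff k * ?x ^ k * volk_inverse_power k) has_sum coprime_power_sum 1 (n * p)) UNIV"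
    using power_sum_series_1[OF n, where 'p='p] unfolding assms(1)[symmetric] .
  \<comment> \<open>The coefficients of \<open>g\<close> are known from degree 1 on;
    \<open>log_coeff 0 = 0\<close> leaves room to insert the constant term, which is the value of
    \<open>g\<close> at 0.\<close>
  hence "((\<lambda>k. (if k = 0 then fps_nth g 0 else 0) + log_coeff k * ?x ^ k * volk_inverse_power k) has_sum
      fps_nth g 0 + coprime_power_sum 1 (n * p)) UNIV"
    by (intro has_sum_add[OF has_sum_finite_neutralI[of "{0}"]]) auto
  also have "(\<lambda>k. (if k = 0 then fps_nth g 0 else 0) + log_coeff k * ?x ^ k * volk_inverse_power k) = (\<lambda>j. fps_nth g j * ?x ^ j)"
  proof
    fix k show "(if k = 0 then fps_nth g 0 else 0) + log_coeff k * ?x ^ k * volk_inverse_power k = fps_nth g k * ?x ^ k"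
      using padic_log_deriv_Gamma_nth[OF p2, folded g_def] by (cases k) (simp_all add: log_coeff_def mult_ac)
  qed
  finally have s: "(\<lambda>j. fps_nth g j * ?x ^ j) sums (fps_nth g 0 + coprime_power_sum 1 (n * p))" by (rule has_sum_imp_sums)
  thus "summable (\<lambda>j. fps_nth padic_log_deriv_Gamma j * ?x ^ j)" unfolding g_def by (rule sums_summable)
  have "((\<lambda>j. fps_nth g j * 0 ^ j) has_sum fps_nth g 0) UNIV"
    by (rule has_sum_finite_neutralI[of "{0}"]) auto
  hence "padic_fps_eval g 0 = fps_nth g 0"
    unfolding padic_fps_eval_def by (intro sums_unique[symmetric] has_sum_imp_sums)
  moreover have "padic_fps_eval g ?x = fps_nth g 0 + coprime_power_sum 1 (n * p)"
    unfolding padic_fps_eval_def using s by (rule sums_unique[symmetric])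
  ultimately show "coprime_power_sum 1 (n * p) = padic_fps_eval padic_log_deriv_Gamma ?x - padic_fps_eval padic_log_deriv_Gamma 0"
    by (simp add: g_def)
next
  have p2: "CARD('p) \<noteq> 2" using assms by simp
  have "volk_inverse_power 1 = (0 :: 'p padic)" using p2 by (intro volk_inverse_power_odd) auto
  thus "fps_nth (fps_deriv (padic_log_deriv_Gamma :: 'p padic fps)) 0 = 0"
    using padic_log_deriv_Gamma_nth[OF p2, of 0] by simp
  \<comment> \<open>The limit is the integral of \<open>u^(-1)\<close> itself, whose vanishing has
    just given \<open>g'(0) = 0\<close>.\<close>
  have "has_volk (\<lambda>a. inverse (of_int a) ^ 1 :: 'p padic) 0" using p2 by (intro has_volk_inverse_power_odd) auto
  hence "(\<lambda>k. unit_sum (\<lambda>a. inverse (of_int a) :: 'p padic) k / of_nat p ^ k) \<longlonglongrightarrow> 0"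
    by (simp add: has_volk_def assms(1))
  moreover have "{i. i \<le> p ^ k - 1 \<and> coprime i p} = {i. i < p ^ k \<and> coprime i p}" for k
  proof -
    have "p ^ k > 0" using CARD_pos[where 'p='p] by (simp add: assms(1))
    hence "i \<le> p ^ k - 1 \<longleftrightarrow> i < p ^ k" for i by linarith
    thus ?thesis by (simp only:)
  qed
  ultimately show "(\<lambda>k. (1 / of_nat p ^ k) * (\<Sum>i | i \<le> p ^ k - 1 \<and> coprime i p. inverse (of_nat i)) :: 'p padic) \<longlonglongrightarrow> 0"
    by (simp add: unit_sum_def assms(1) divide_inverse mult.commute)
qed

end
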